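(* Let $B^0$ be an $n\times n$ skew-symmetrizable integer matrix, $D$ an $n\times n$ diagonal matrix with positive integer diagonal entries such that $DB^0$ is skew-symmetric, $t_0\in\mathbb{T}_n$, and $\Lambda$ an $n\times n$ skew-symmetric integer matrix. Let $j\in[1,n]$, $t\in\mathbb{T}_n$, and let $F_{j;t}=F_{j;t}^{B^0;D;t_0}$ be the (left) quantum $F$-polynomial. Then $\overline{F_{j;t}}$ is the unique polynomial in $Z_1,\dots,Z_n$ with coefficients in $\mathbb{Z}[q^{\pm\frac12}]$ such that the cluster variable $X_{j;t}\in\mathcal{A}_\bullet(B^0,D,\Lambda,t_0)$ is given by $$X_{j;t}=M_0(\mathbf{g}_{j;t})\,\overline{F_{j;t}}(\hat Y).$$ Furthermore, for any quantum cluster algebra $\mathcal{A}$ whose initial exchange matrix is $\tilde B^0$ (an $m\times n$ integer matrix with principal part $B^0$, with initial commutation matrix $\Lambda_0$ satisfying $(\tilde B^0)^T\Lambda_0=(D\,|\,0)$), the cluster variable $X_{j;t}\in\mathcal{A}$ is given by $$X_{j;t}=q^{-\lambda_{j;t}^{\tilde B^0;t_0}}M_0(\tilde{\mathbf g}_{j;t}^{\tilde B^0;t_0})\,\overline{F_{j;t}}(\hat Y).$$ Setting $q=1$ and $Z_i=u_i$ in $\overline{F_{j;t}}$ yields the nonquantum $F$-polynomial $F_{j;t}^{B^0;t_0}$.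
   Context: Notation: $[i,j]=\{k\in\mathbb{Z}: i\le k\le j\}$; $[x]_+=\max(x,0)$; $\mathbf{e}_i$ are standard basis vectors. $\mathbb{T}_n$ is the $n$-regular tree with edges labeled by $1,\dots,n$ so that the $n$ edges at each vertex have distinct labels. The principal part of an $m\times n$ matrix ($m\ge n$) is its top $n\times n$ submatrix. Mutation of an $m\times n$ integer matrix $\tilde B=(b_{ij})$ in direction $k\in[1,n]$: $b'_{ij}=-b_{ij}$ if $i=k$ or $j=k$, and $b'_{ij}=b_{ij}+\mathrm{sgn}(b_{ik})[b_{ik}b_{kj}]_+$ otherwise. Classical cluster algebras. A labeled seed is a pair $(\tilde{\mathbf x},\tilde B)$ with $\tilde{\mathbf x}=(x_1,\dots,x_m)$ a free generating set of the ambient field of rational functions in $m$ variables, and $\tilde B$ an $m\times n$ integer matrix with skew-symmetrizable principal part. Seed mutation in direction $k\in[1,n]$ mutates $\tilde B$ and replaces only $x_k$, by $x_k'=x_k^{-1}(\prod_i x_i^{[b_{ik}]_+}+\prod_i x_i^{[-b_{ik}]_+})$. A cluster pattern assigns seeds $((x_{1;t},\dots,x_{m;t}),\tilde B_t)$ to $t\in\mathbb{T}_n$ so that seeds joined by an edge labeled $k$ are related by mutation in direction $k$; cluster variables are $x_{j;t}$, $j\in[1,n]$. Principal coefficients at $t_0$: $m=2n$, initial extended cluster $(x_1,\dots,x_n,y_1,\dots,y_n)$ and initial matrix $\left(\begin{smallmatrix}B^0\\ I\end{smallmatrix}\right)$. In this case $x_{j;t}\in\mathbb{Z}[x_1^{\pm1},\dots,x_n^{\pm1},y_1,\dots,y_n]$;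 the $F$-polynomial $F_{j;t}^{B^0;t_0}\in\mathbb{Z}[u_1,\dots,u_n]$ is obtained from $x_{j;t}$ by setting all $x_i=1$, $y_i=u_i$; and $x_{j;t}$ is homogeneous for the $\mathbb{Z}^n$-grading $\deg x_i=\mathbf{e}_i$, $\deg y_i=-(\text{$i$th column of }B^0)$, its degree being the $\mathbf{g}$-vector $\mathbf{g}_{j;t}=\mathbf{g}_{j;t}^{B^0;t_0}$ (regarded in $\mathbb{Z}^{2n}$ by appending zeros). For a general $m\times n$ initial matrix $\tilde B^0=(b^0_{ij})$ with principal part $B^0$ and initial extended cluster $(x_1,\dots,x_m)$, put $\hat y_j=\prod_{i=1}^m x_i^{b^0_{ij}}$; the extended $\mathbf{g}$-vector $\tilde{\mathbf g}_{j;t}^{\tilde B^0;t_0}=(g_1,\dots,g_m)\in\mathbb{Z}^m$ ($j\in[1,n]$) is the unique vector with $x_{j;t}=F_{j;t}^{B^0;t_0}(\hat y_1,\dots,\hat y_n)x_1^{g_1}\cdots x_m^{g_m}$. Quantum cluster algebras. Let $L$ be a rank $m$ lattice with skew-symmetric form $\Lambda_L:L\times L\to\mathbb{Z}$; the based quantum torus is the $\mathbb{Z}[q^{\pm1/2}]$-algebra with basis $\{X^e:e\in L\}$ and $X^eX^f=q^{\Lambda_L(e,f)/2}X^{e+f}$; $\mathcal{F}$ is its skew-field of fractions. A toric frame is a map $M:\mathbb{Z}^m\to\mathcal{F}\setminus\{0\}$, $M(\mathbf c)=\varphi(X^{\eta(\mathbf c)})$, with $\varphi$ an automorphism of $\mathcal{F}$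 (fixing $q^{1/2}$) and $\eta:\mathbb{Z}^m\to L$ a lattice isomorphism; $\Lambda_M$ is the form on $\mathbb{Z}^m$ transferred by $\eta$ (also its matrix), so $M(\mathbf c)M(\mathbf d)=q^{\Lambda_M(\mathbf c,\mathbf d)/2}M(\mathbf c+\mathbf d)$. A quantum seed is a pair $(M,\tilde B)$ with $\tilde B^T\Lambda_M=(D|0)$. Its mutation in direction $k$ is $(M',\tilde B')$, where $\tilde B'$ is the matrix mutation and $M'$ is the toric frame determined by $M'(\mathbf{e}_i)=M(\mathbf{e}_i)$ for $i\ne k$ and $M'(\mathbf{e}_k)=M(-\mathbf{e}_k+\sum_{i=1}^m[b_{ik}]_+\mathbf{e}_i)+M(-\mathbf{e}_k+\sum_{i=1}^m[-b_{ik}]_+\mathbf{e}_i)$; this is again a quantum seed with the same $D$. A quantum cluster pattern assigns quantum seeds $(M_t,\tilde B^t)$ to $t\in\mathbb{T}_n$ compatibly with mutations; $X_{j;t}=M_t(\mathbf{e}_j)$; cluster variables are $X_{j;t}$, $j\in[1,n]$; the quantum cluster algebra is the $\mathbb{Z}[q^{\pm1/2},X_{n+1}^{\pm1},\dots,X_m^{\pm1}]$-subalgebra of $\mathcal{F}$ they generate. Put $M_0=M_{t_0}$, $\tilde B^0=\tilde B^{t_0}$, $\Lambda_0=\Lambda_{M_0}$, and $\hat Y_j=M_0(\tilde{\mathbf b}^j)$ with $\tilde{\mathbf b}^j$ the $j$th column of $\tilde B^0$. $\mathcal{A}_\bullet(B^0,D,\Lambda,t_0)$ is the quantum cluster algebra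 with $m=2n$, initial matrix $\left(\begin{smallmatrix}B^0\\ I\end{smallmatrix}\right)$ and the unique skew-symmetric $\Lambda_0$ with $(\tilde B^0)^T\Lambda_0=(D|0)$ whose upper left $n\times n$ block is $\Lambda$. Quantum $F$-polynomials. Write $D=\mathrm{diag}(d_1,\dots,d_n)$, $B^0=(b^0_{ij})$, and let $R$ be the quantum torus over $\mathbb{Z}[q^{\pm1/2}]$ generated by $Z_1^{\pm1},\dots,Z_n^{\pm1}$ with $Z_iZ_j=q^{d_ib^0_{ij}}Z_jZ_i$; put $Z^{\mathbf c}=q^{\frac12\sum_{1\le i<j\le n}d_jb^0_{ji}c_ic_j}Z_1^{c_1}\cdots Z_n^{c_n}$. $F(\hat Y)$ denotes substitution $Z_i\mapsto\hat Y_i$. The (left) quantum $F$-polynomial $F_{j;t}=F_{j;t}^{B^0;D;t_0}$ is the unique polynomial in $Z_1,\dots,Z_n$ with coefficients in $\mathbb{Z}[q^{\pm1/2}]$ such that $X_{j;t}=F_{j;t}(\hat Y)M_0(\mathbf{g}_{j;t})$ in $\mathcal{A}_\bullet(B^0,D,\Lambda,t_0)$ (it exists and does not depend on $\Lambda$). It is known that for every $\tilde B^0$ as in the claim there is $\lambda_{j;t}^{\tilde B^0;t_0}\in\frac12\mathbb{Z}$, depending on $\tilde B^0$ but not on $\mathcal{A}$, such that $X_{j;t}=q^{\lambda_{j;t}^{\tilde B^0;t_0}}F_{j;t}(\hat Y)M_0(\tilde{\mathbf g}_{j;t}^{\tilde B^0;t_0})$ in every quantum cluster algebra $\mathcal{A}$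 with initial exchange matrix $\tilde B^0$ (and the given $D$). The bar-involution on $R$ is the $\mathbb{Z}$-linear map with $\overline{q^{r/2}Z^{\mathbf c}}=q^{-r/2}Z^{\mathbf c}$ ($r\in\mathbb{Z}$, $\mathbf c\in\mathbb{Z}^n$). *)

theory Defs
  imports
    "Jordan_Normal_Form.Matrix"
    "HOL-Library.Poly_Mapping"
    "HOL-Computational_Algebra.Fraction_Field"
begin

text \<open>
  All index sets \<open>[1,n]\<close> are shifted to \<open>{0..<n}\<close>. In an \<open>m \<times> n\<close> extended exchange matrix the
  rows and columns below \<open>n\<close> are the mutable directions.
\<close>

section \<open>The regular tree and matrix mutation\<close>

text \<open>
  The \<open>n\<close>-regular edge-labelled tree is realised on the words over \<open>{0..<n}\<close> without two equal
  neighbouring letters; the edge labelled \<open>k\<close> prepends \<open>k\<close>, or deletes a leading \<open>k\<close>.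
  No vertex is distinguished below: the base point \<open>t0\<close> is an arbitrary vertex.
\<close>

definition tree_vertices :: "nat \<Rightarrow> nat list set" where
  "tree_vertices n = {w. set w \<subseteq> {..<n} \<and> distinct_adj w}"

definition tree_edge :: "nat \<Rightarrow> nat \<Rightarrow> nat list \<Rightarrow> nat list \<Rightarrow> bool" where
  "tree_edge n k t t' \<longleftrightarrow>
     t \<in> tree_vertices n \<and> t' \<in> tree_vertices n \<and> (t' = k # t \<or> t = k # t')"

definition pos_part :: "int \<Rightarrow> int" where
  "pos_part b = max b 0"

definition principal_part :: "nat \<Rightarrow> int mat \<Rightarrow> int mat" where
  "principal_part n B = mat n n (\<lambda>(i, j). B $$ (i, j))"

definition skew_symmetric :: "int mat \<Rightarrow> bool" where
  "skew_symmetric A \<longleftrightarrow> transpose_mat A = - A"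

definition matrix_mutation :: "nat \<Rightarrow> int mat \<Rightarrow> int mat" where
  "matrix_mutation k B = mat (dim_row B) (dim_col B) (\<lambda>(i, j).
     if i = k \<or> j = k then - B $$ (i, j)
     else B $$ (i, j) + sgn (B $$ (i, k)) * pos_part (B $$ (i, k) * B $$ (k, j)))"


section \<open>Classical cluster patterns, g-vectors and F-polynomials\<close>

text \<open>
  Rational functions in the countably many variables \<open>x\<^sub>0, x\<^sub>1, \<dots>\<close>; a cluster algebra of rank \<open>m\<close>
  lives in the subfield generated by the first \<open>m\<close> of them.
\<close>

type_synonym ratfun = "((nat \<Rightarrow>\<^sub>0 nat) \<Rightarrow>\<^sub>0 int) fract"

definition ratvar :: "nat \<Rightarrow> ratfun" where
  "ratvar i = Fract (Poly_Mapping.single (Poly_Mapping.single i 1) 1) 1"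

text \<open>
  A commutative Laurent polynomial with integer coefficients in \<open>r\<close> variables is a finitely
  supported function on \<open>carrier_vec r\<close>, mapping exponent vectors to coefficients.
\<close>

definition laurent_eval :: "nat \<Rightarrow> (nat \<Rightarrow> 'k::field) \<Rightarrow> (int vec \<Rightarrow>\<^sub>0 int) \<Rightarrow> 'k" where
  "laurent_eval r x P = (\<Sum>e\<in>Poly_Mapping.keys P.
     of_int (Poly_Mapping.lookup P e) * (\<Prod>i<r. x i powi (e $ i)))"

definition seed_mutation ::
  "nat \<Rightarrow> (nat \<Rightarrow> ratfun) \<times> int mat \<Rightarrow> (nat \<Rightarrow> ratfun) \<times> int mat" where
  "seed_mutation k = (\<lambda>(x, B).
     (x(k := inverse (x k) *
         ((\<Prod>i<dim_row B. x i powi pos_part (B $$ (i, k))) +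
          (\<Prod>i<dim_row B. x i powi pos_part (- B $$ (i, k))))),
      matrix_mutation k B))"

text \<open>
  As the initial cluster consists of the variables themselves and seed mutation is invertible, every
  extended cluster of such a pattern is a free generating set of the ambient field. The values of
  \<open>S\<close> off the tree are irrelevant.
\<close>

definition cluster_pattern ::
  "int mat \<Rightarrow> nat list \<Rightarrow> (nat list \<Rightarrow> (nat \<Rightarrow> ratfun) \<times> int mat) \<Rightarrow> bool" where
  "cluster_pattern B t0 S \<longleftrightarrow>
     S t0 = (ratvar, B) \<and>
     (\<forall>k t t'. tree_edge (dim_col B) k t t' \<longrightarrow> S t' = seed_mutation k (S t))"

definition cluster_variable :: "int mat \<Rightarrow> nat list \<Rightarrow> nat list \<Rightarrow> nat \<Rightarrow> ratfun" where
  "cluster_variable B t0 t j = (THE z. \<exists>S. cluster_pattern B t0 S \<and> z = fst (S t) j)"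

definition principal_extension :: "int mat \<Rightarrow> int mat" where
  "principal_extension B0 = B0 @\<^sub>r 1\<^sub>m (dim_col B0)"

text \<open>
  The expansion of a cluster variable with principal coefficients as an element of
  \<open>\<int>[x\<^sub>1\<^sup>\<plusminus>\<^sup>1, \<dots>, x\<^sub>n\<^sup>\<plusminus>\<^sup>1, y\<^sub>1, \<dots>, y\<^sub>n]\<close>; the variables with indices in \<open>{n..<2*n}\<close> are
  the \<open>y\<^sub>i\<close>.
\<close>

definition principal_expansion ::
  "int mat \<Rightarrow> nat list \<Rightarrow> nat list \<Rightarrow> nat \<Rightarrow> (int vec \<Rightarrow>\<^sub>0 int)" where
  "principal_expansion B0 t0 t j = (let n = dim_col B0 in
     (THE P. (\<forall>e\<in>Poly_Mapping.keys P. e \<in> carrier_vec (2 * n) \<and> (\<forall>i\<in>{n..<2 * n}. e $ i \<ge> 0)) \<and>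
        cluster_variable (principal_extension B0) t0 t j = laurent_eval (2 * n) ratvar P))"

text \<open>Specialisation \<open>x\<^sub>i = 1\<close>, \<open>y\<^sub>i = u\<^sub>i\<close> of the expansion.\<close>

definition F_polynomial ::
  "int mat \<Rightarrow> nat list \<Rightarrow> nat list \<Rightarrow> nat \<Rightarrow> (int vec \<Rightarrow>\<^sub>0 int)" where
  "F_polynomial B0 t0 t j = (let P = principal_expansion B0 t0 t j in
     (\<Sum>e\<in>Poly_Mapping.keys P.
        Poly_Mapping.single (vec_last e (dim_col B0)) (Poly_Mapping.lookup P e)))"

definition variable_degree :: "int mat \<Rightarrow> nat \<Rightarrow> int vec" where
  "variable_degree B0 i = (let n = dim_col B0 in
     if i < n then unit_vec n i else - col B0 (i - n))"

definition monomial_degree :: "int mat \<Rightarrow> int vec \<Rightarrow> int vec" where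
  "monomial_degree B0 e = (let n = dim_col B0 in
     vec n (\<lambda>k. \<Sum>i<2 * n. e $ i * variable_degree B0 i $ k))"

definition g_vector :: "int mat \<Rightarrow> nat list \<Rightarrow> nat list \<Rightarrow> nat \<Rightarrow> int vec" where
  "g_vector B0 t0 t j =
     (THE g. \<forall>e\<in>Poly_Mapping.keys (principal_expansion B0 t0 t j). monomial_degree B0 e = g)"

definition y_hat :: "int mat \<Rightarrow> nat \<Rightarrow> ratfun" where
  "y_hat B j = (\<Prod>i<dim_row B. ratvar i powi (B $$ (i, j)))"

definition extended_g_vector :: "int mat \<Rightarrow> nat list \<Rightarrow> nat list \<Rightarrow> nat \<Rightarrow> int vec" where
  "extended_g_vector B t0 t j = (let m = dim_row B; n = dim_col B in
     (THE g. g \<in> carrier_vec m \<and>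
        cluster_variable B t0 t j =
          laurent_eval n (y_hat B) (F_polynomial (principal_part n B) t0 t j) *
          (\<Prod>i<m. ratvar i powi (g $ i))))"


section \<open>Based quantum tori and their skew-fields of fractions\<close>

text \<open>
  Throughout, \<open>v\<close> (or \<open>qhalf\<close>) stands for \<open>q\<^sup>1\<^sup>/\<^sup>2\<close>, so that \<open>q\<^bsup>r/2\<^esup>\<close> is \<open>v powi r\<close>. An element of
  \<open>\<int>[q\<^sup>\<plusminus>\<^sup>1\<^sup>/\<^sup>2]\<close> is a finitely supported \<open>int \<Rightarrow>\<^sub>0 int\<close> mapping \<open>r\<close> to the coefficient of
  \<open>q\<^bsup>r/2\<^esup>\<close>, and an element of a quantum torus is given by its coefficients with respect to the
  basis \<open>X\<^sup>e\<close> (or \<open>Z\<^sup>c\<close>).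
\<close>

type_synonym q_coeff = "int \<Rightarrow>\<^sub>0 int"
type_synonym q_laurent = "int vec \<Rightarrow>\<^sub>0 q_coeff"

definition q_coeff_eval :: "'f::division_ring \<Rightarrow> q_coeff \<Rightarrow> 'f" where
  "q_coeff_eval v a =
     (\<Sum>r\<in>Poly_Mapping.keys a. of_int (Poly_Mapping.lookup a r) * v powi r)"

definition q_combination :: "'f::division_ring \<Rightarrow> (int vec \<Rightarrow> 'f) \<Rightarrow> q_laurent \<Rightarrow> 'f" where
  "q_combination v X f =
     (\<Sum>e\<in>Poly_Mapping.keys f. q_coeff_eval v (Poly_Mapping.lookup f e) * X e)"

text \<open>
  A skew-field (the whole type \<open>'f\<close>) together with \<open>q\<^sup>1\<^sup>/\<^sup>2\<close>, the skew-symmetric form on the lattice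
  \<open>L = \<int>\<^sup>m\<close>, and the basis \<open>X\<^sup>e\<close> of a quantum torus contained in it.
\<close>

record 'f quantum_ambient =
  qhalf :: 'f
  lattice_form :: "int mat"
  torus_basis :: "int vec \<Rightarrow> 'f"

definition form_value :: "int mat \<Rightarrow> int vec \<Rightarrow> int vec \<Rightarrow> int" where
  "form_value L c d = c \<bullet> (L *\<^sub>v d)"

definition skew_field_of_fractions ::
  "nat \<Rightarrow> ('f::division_ring, 'z) quantum_ambient_scheme \<Rightarrow> bool" where
  "skew_field_of_fractions m K \<longleftrightarrow>
     lattice_form K \<in> carrier_mat m m \<and> skew_symmetric (lattice_form K) \<and>
     (\<forall>z. qhalf K * z = z * qhalf K) \<and>
     torus_basis K (0\<^sub>v m) = 1 \<and>
     (\<forall>e\<in>carrier_vec m. \<forall>f\<in>carrier_vec m.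
        torus_basis K e * torus_basis K f =
          qhalf K powi form_value (lattice_form K) e f * torus_basis K (e + f)) \<and>
     (\<forall>a. Poly_Mapping.keys a \<subseteq> carrier_vec m \<longrightarrow>
        q_combination (qhalf K) (torus_basis K) a = 0 \<longrightarrow> a = 0) \<and>
     (\<forall>z. \<exists>a b. Poly_Mapping.keys a \<subseteq> carrier_vec m \<and> Poly_Mapping.keys b \<subseteq> carrier_vec m \<and>
        b \<noteq> 0 \<and>
        z = q_combination (qhalf K) (torus_basis K) a *
            inverse (q_combination (qhalf K) (torus_basis K) b))"


section \<open>Quantum seeds and quantum cluster algebras\<close>

text \<open>\<open>M\<close> is a toric frame and \<open>\<Lambda>\<close> is the matrix of the form that it transfers to \<open>\<int>\<^sup>m\<close>.\<close>

definition toric_frame ::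
  "nat \<Rightarrow> ('f::division_ring, 'z) quantum_ambient_scheme \<Rightarrow> (int vec \<Rightarrow> 'f) \<Rightarrow> int mat \<Rightarrow> bool" where
  "toric_frame m K M \<Lambda> \<longleftrightarrow>
     (\<exists>(\<phi> :: 'f \<Rightarrow> 'f) (\<eta> :: int vec \<Rightarrow> int vec).
        bij \<phi> \<and> (\<forall>a b. \<phi> (a + b) = \<phi> a + \<phi> b) \<and> (\<forall>a b. \<phi> (a * b) = \<phi> a * \<phi> b) \<and>
        \<phi> (qhalf K) = qhalf K \<and>
        bij_betw \<eta> (carrier_vec m) (carrier_vec m) \<and>
        (\<forall>c\<in>carrier_vec m. \<forall>d\<in>carrier_vec m. \<eta> (c + d) = \<eta> c + \<eta> d) \<and>
        (\<forall>c\<in>carrier_vec m. M c = \<phi> (torus_basis K (\<eta> c))) \<and>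
        \<Lambda> \<in> carrier_mat m m \<and>
        (\<forall>c\<in>carrier_vec m. \<forall>d\<in>carrier_vec m.
           form_value \<Lambda> c d = form_value (lattice_form K) (\<eta> c) (\<eta> d)))"

text \<open>\<open>compatible B \<Lambda> D\<close> says that \<open>B\<^sup>T \<Lambda> = (D | 0)\<close>.\<close>

definition compatible :: "int mat \<Rightarrow> int mat \<Rightarrow> int mat \<Rightarrow> bool" where
  "compatible B \<Lambda> D \<longleftrightarrow>
     transpose_mat B * \<Lambda> =
       mat (dim_col B) (dim_row B) (\<lambda>(i, j). if j < dim_col B then D $$ (i, j) else 0)"

definition quantum_seed ::
  "nat \<Rightarrow> nat \<Rightarrow> ('f::division_ring, 'z) quantum_ambient_scheme \<Rightarrow> int mat \<Rightarrow>
     (int vec \<Rightarrow> 'f) \<Rightarrow> int mat \<Rightarrow> bool" where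
  "quantum_seed m n K D M B \<longleftrightarrow>
     B \<in> carrier_mat m n \<and> (\<exists>\<Lambda>. toric_frame m K M \<Lambda> \<and> compatible B \<Lambda> D)"

text \<open>
  The relation between a quantum seed and its mutation; the values on basis vectors determine
  \<open>M'\<close> on \<open>carrier_vec m\<close> because \<open>M'\<close> is required to be a toric frame.
\<close>

definition quantum_mutation ::
  "nat \<Rightarrow> nat \<Rightarrow> (int vec \<Rightarrow> 'f::division_ring) \<Rightarrow> int mat \<Rightarrow> (int vec \<Rightarrow> 'f) \<Rightarrow> int mat \<Rightarrow> bool" where
  "quantum_mutation m k M B M' B' \<longleftrightarrow>
     B' = matrix_mutation k B \<and>
     (\<forall>i<m. i \<noteq> k \<longrightarrow> M' (unit_vec m i) = M (unit_vec m i)) \<and>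
     M' (unit_vec m k) =
       M (- unit_vec m k + vec m (\<lambda>i. pos_part (B $$ (i, k)))) +
       M (- unit_vec m k + vec m (\<lambda>i. pos_part (- B $$ (i, k))))"

text \<open>A quantum cluster algebra is recorded through its ambient skew-field and its seed pattern.\<close>

record 'f quantum_cluster_data = "'f quantum_ambient" +
  frame :: "nat list \<Rightarrow> int vec \<Rightarrow> 'f"
  exchange_matrix :: "nat list \<Rightarrow> int mat"

definition quantum_cluster_algebra ::
  "int mat \<Rightarrow> int mat \<Rightarrow> nat list \<Rightarrow> 'f::division_ring quantum_cluster_data \<Rightarrow> bool" where
  "quantum_cluster_algebra B D t0 \<A> \<longleftrightarrow>
     (let m = dim_row B; n = dim_col B in
        n \<le> m \<and> skew_field_of_fractions m \<A> \<and>
        (\<forall>t\<in>tree_vertices n. quantum_seed m n \<A> D (frame \<A> t) (exchange_matrix \<A> t)) \<and>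
        (\<forall>k t t'. tree_edge n k t t' \<longrightarrow>
           quantum_mutation m k (frame \<A> t) (exchange_matrix \<A> t)
             (frame \<A> t') (exchange_matrix \<A> t')) \<and>
        exchange_matrix \<A> t0 = B)"

text \<open>
  \<open>\<A>\<close> is the algebra \<open>\<A>\<^sub>\<bullet>(B0, D, \<Lambda>, t0)\<close> with principal coefficients.
\<close>

definition principal_quantum_cluster_algebra ::
  "int mat \<Rightarrow> int mat \<Rightarrow> int mat \<Rightarrow> nat list \<Rightarrow> 'f::division_ring quantum_cluster_data \<Rightarrow> bool" where
  "principal_quantum_cluster_algebra B0 D \<Lambda> t0 \<A> \<longleftrightarrow>
     quantum_cluster_algebra (principal_extension B0) D t0 \<A> \<and>
     (\<exists>\<Lambda>0. toric_frame (2 * dim_col B0) \<A> (frame \<A> t0) \<Lambda>0 \<and> skew_symmetric \<Lambda>0 \<and>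
        compatible (principal_extension B0) \<Lambda>0 D \<and> principal_part (dim_col B0) \<Lambda>0 = \<Lambda>)"

definition quantum_cluster_variable ::
  "'f::division_ring quantum_cluster_data \<Rightarrow> nat list \<Rightarrow> nat \<Rightarrow> 'f" where
  "quantum_cluster_variable \<A> t j = frame \<A> t (unit_vec (dim_row (exchange_matrix \<A> t)) j)"

definition Y_hat :: "'f::division_ring quantum_cluster_data \<Rightarrow> nat list \<Rightarrow> nat \<Rightarrow> 'f" where
  "Y_hat \<A> t0 j = frame \<A> t0 (col (exchange_matrix \<A> t0) j)"


section \<open>Quantum F-polynomials\<close>

text \<open>
  Elements of the quantum torus \<open>R\<close> with \<open>Z\<^sub>i Z\<^sub>j = q\<^bsup>d\<^sub>i b\<^sub>i\<^sub>j\<^esup> Z\<^sub>j Z\<^sub>i\<close> are written in the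
  basis \<open>Z\<^sup>c\<close>. The following is the image of
  \<open>Z\<^sup>c = q\<^bsup>1/2 \<Sum>\<^sub>i\<^sub><\<^sub>j d\<^sub>j b\<^sub>j\<^sub>i c\<^sub>i c\<^sub>j\<^esup> Z\<^sub>1\<^bsup>c\<^sub>1\<^esup> \<cdots> Z\<^sub>n\<^bsup>c\<^sub>n\<^esup>\<close> under
  \<open>Z\<^sub>i \<mapsto> Y i\<close>; the product is an ordered one.
\<close>

definition Z_monomial_subst ::
  "int mat \<Rightarrow> int mat \<Rightarrow> 'f::division_ring \<Rightarrow> (nat \<Rightarrow> 'f) \<Rightarrow> int vec \<Rightarrow> 'f" where
  "Z_monomial_subst B0 D v Y c = (let n = dim_col B0 in
     v powi (\<Sum>j<n. \<Sum>i<j. D $$ (j, j) * B0 $$ (j, i) * c $ i * c $ j) *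
     prod_list (map (\<lambda>i. Y i powi (c $ i)) [0..<n]))"

text \<open>The substitution \<open>F(Y\<^sub>1, \<dots>, Y\<^sub>n)\<close>.\<close>

definition Z_subst ::
  "int mat \<Rightarrow> int mat \<Rightarrow> 'f::division_ring \<Rightarrow> (nat \<Rightarrow> 'f) \<Rightarrow> q_laurent \<Rightarrow> 'f" where
  "Z_subst B0 D v Y F = q_combination v (Z_monomial_subst B0 D v Y) F"

definition Z_polynomials :: "nat \<Rightarrow> q_laurent set" where
  "Z_polynomials n =
     {F. \<forall>c\<in>Poly_Mapping.keys F. c \<in> carrier_vec n \<and> (\<forall>i<n. c $ i \<ge> 0)}"

text \<open>\<open>F\<close> is the left quantum F-polynomial defined by the principal coefficient algebra \<open>\<A>\<close>.\<close>

definition left_quantum_F_polynomial ::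
  "'f::division_ring quantum_cluster_data \<Rightarrow> int mat \<Rightarrow> int mat \<Rightarrow> nat list \<Rightarrow> nat list \<Rightarrow> nat \<Rightarrow>
     q_laurent \<Rightarrow> bool" where
  "left_quantum_F_polynomial \<A> B0 D t0 t j F \<longleftrightarrow>
     (let n = dim_col B0 in
        F \<in> Z_polynomials n \<and>
        quantum_cluster_variable \<A> t j =
          Z_subst B0 D (qhalf \<A>) (Y_hat \<A> t0) F * frame \<A> t0 (g_vector B0 t0 t j @\<^sub>v 0\<^sub>v n))"

definition bar :: "q_laurent \<Rightarrow> q_laurent" where
  "bar F = Poly_Mapping.map (Poly_Mapping.map_key uminus) F"

text \<open>The defining properties of the bar-involution on \<open>R\<close>.\<close>

lemma bar_single:
  "bar (Poly_Mapping.single c (Poly_Mapping.single r a)) =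
     Poly_Mapping.single c (Poly_Mapping.single (- r) a)"
proof -
  have "Poly_Mapping.map_key uminus (Poly_Mapping.single r a) =
      Poly_Mapping.single (- r) (a :: int)" for r :: int
    using map_key_single[of uminus "- r" a] by simp
  then show ?thesis
    by (auto simp: bar_def Poly_Mapping.map_single)
qed

lemma bar_add: "bar (F + G) = bar F + bar G"
proof (rule poly_mapping_eqI)
  have z: "Poly_Mapping.map_key (uminus :: int \<Rightarrow> int) (0 :: q_coeff) = 0"
    by (rule map_key_zero) simp
  fix c
  show "Poly_Mapping.lookup (bar (F + G)) c = Poly_Mapping.lookup (bar F + bar G) c"
    by (auto simp: bar_def Poly_Mapping.map.rep_eq lookup_add when_def z
        map_key_plus[symmetric])
qed

text \<open>Specialisation at \<open>q = 1\<close>, \<open>Z\<^sub>i = u\<^sub>i\<close>; it sends \<open>Z\<^sup>c\<close> to \<open>u\<^sup>c\<close>.\<close>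

definition specialize_q1 :: "q_laurent \<Rightarrow> (int vec \<Rightarrow>\<^sub>0 int)" where
  "specialize_q1 F = Poly_Mapping.map
     (\<lambda>a. \<Sum>r\<in>Poly_Mapping.keys a. Poly_Mapping.lookup a r) F"

end

theory Submission
  imports Defs
begin

text \<open>
  The bar involution extends to an antiautomorphism of the ambient skew-field that inverts
  \<open>q\<^sup>1\<^sup>/\<^sup>2\<close> and fixes the initial toric frame. Mutation then shows that it fixes every toric
  frame, so applying it to \<open>X = F(Y) M\<^sub>0(g)\<close> reverses the factors and conjugates \<open>F\<close>.

  The specialization \<open>q = 1\<close> is, like the bar involution, an antihomomorphism on the initial quantum
  torus, because its target is commutative; both extend to localizations by the same Ore argument.
  Comparing the specialized expansion with the classical one gives the statement about
  \<open>F\<close>-polynomials.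

  That g-vectors and F-polynomials are well defined rests on the Laurent phenomenon. Its induction
  step adjoins a frozen variable that makes the first exchange polynomial linear, hence prime, and
  shows by evaluation at its generic zero that it cannot divide the denominator. Evaluation at
  \<open>x\<^sub>z = 0\<close> proves in the same way that frozen variables do not occur in denominators.
\<close>

text \<open>At q = 1 denominators may vanish, so the specialization is only a partial map on the
  skew-field. This is why maps are represented by relations: \<open>antihom_graph\<close> starts
  from a relation on a ring, and \<open>ext\<close> gives a value to a fraction only if it has a
  denominator with nonzero image. Sums and products then need an Ore condition whose new denominator
  again survives the map. For evaluation of rational functions this is commutativity, for the bar
  involution injectivity; for q = 1 it is the real work.

  Evaluation points may have coordinates in the field of rational functions itself. They replace
  factorization: a linear exchange polynomial is represented by the point where one coordinate
  solves the equation, and regularity there plays the role of coprimality. Positivity at (1, 1, ...)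
  keeps mutations defined under specialization.

  Quantum and classical expansions can be compared coefficient by coefficient because, with
  principal coefficients, the lower identity block keeps the monomials in the y-hats
  distinct.\<close>

abbreviation "keys \<equiv> Poly_Mapping.keys"
abbreviation "lookup \<equiv> Poly_Mapping.lookup"
abbreviation "single \<equiv> Poly_Mapping.single"

section \<open>Extending antihomomorphisms to rings of fractions\<close>

text \<open>\<open>zero\<close> and additivity make \<open>G\<close> single-valued.
  \<open>ore\<close> is the right Ore condition for the denominators whose image is nonzero: it
  turns b^-1 c into e f^-1 and demands that f again has nonzero image.\<close>

locale antihom_graph =
  fixes G :: "('f::division_ring \<times> 'e::division_ring) set"
  assumes one: "(1, 1) \<in> G"
    and add: "(a, a') \<in> G \<Longrightarrow> (b, b') \<in> G \<Longrightarrow> (a + b, a' + b') \<in> G"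
    and uminus: "(a, a') \<in> G \<Longrightarrow> (- a, - a') \<in> G"
    and mult: "(a, a') \<in> G \<Longrightarrow> (b, b') \<in> G \<Longrightarrow> (a * b, b' * a') \<in> G"
    and zero: "(0, w) \<in> G \<Longrightarrow> w = 0"
    and ore: "(b, b') \<in> G \<Longrightarrow> b' \<noteq> 0 \<Longrightarrow> (c, c') \<in> G \<Longrightarrow>
      \<exists>e e' f f'. (e, e') \<in> G \<and> (f, f') \<in> G \<and> f' \<noteq> 0 \<and> c * f = b * e"
begin

text \<open>The fraction a b^-1 goes to b'^-1 a': the order of the factors is reversed, so the
  denominator stands on the other side.\<close>

definition ext :: "'f \<Rightarrow> 'e \<Rightarrow> bool" where
  "ext z r \<longleftrightarrow> (\<exists>a a' b b'. (a, a') \<in> G \<and> (b, b') \<in> G \<and> b' \<noteq> 0 \<and> z * b = a \<and> b' * r = a')"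

lemma functional: "(a, w) \<in> G \<Longrightarrow> (a, w') \<in> G \<Longrightarrow> w = w'"
  using add[of a w "- a" "- w'"] uminus[of a w'] zero[of "w - w'"] by simp

lemma nonzero: "(a, w) \<in> G \<Longrightarrow> w \<noteq> 0 \<Longrightarrow> a \<noteq> 0"
  using zero by blast

lemma ext_graph: "(a, a') \<in> G \<Longrightarrow> ext a a'"
  unfolding ext_def using one by force

text \<open>The Ore condition applied to the two denominators gives d f = b e, a common right
  multiple. Its image is computed from either side, and \<open>functional\<close> identifies the
  results.\<close>

lemma common_denominator:
  assumes "ext z r" "ext y s"
  obtains N N' a a' c c' where "(N, N') \<in> G" "N' \<noteq> 0" "(a, a') \<in> G" "(c, c') \<in> G"
    "z * N = a" "N' * r = a'" "y * N = c" "N' * s = c'"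
proof -
  from assms obtain a a' b b' c c' d d' where
    1: "(a, a') \<in> G" "(b, b') \<in> G" "b' \<noteq> 0" "z * b = a" "b' * r = a'" and
    2: "(c, c') \<in> G" "(d, d') \<in> G" "d' \<noteq> 0" "y * d = c" "d' * s = c'"
    unfolding ext_def by blast
  from ore[OF 1(2) 1(3) 2(2)] obtain e e' f f' where
    3: "(e, e') \<in> G" "(f, f') \<in> G" "f' \<noteq> 0" "d * f = b * e" by blast
  have df: "(d * f, f' * d') \<in> G" and be: "(b * e, e' * b') \<in> G"
    using mult 1 2 3 by blast+
  have eq: "f' * d' = e' * b'" using functional[OF df] be 3(4) by simp
  show ?thesis
  proof (rule that[OF df])
    show "f' * d' \<noteq> 0" using 3 2 by simp
    show "(a * e, e' * a') \<in> G" "(c * f, f' * c') \<in> G" using mult 1 2 3 by blast+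
    show "z * (d * f) = a * e" using 1 3 by (simp add: mult.assoc[symmetric])
    show "f' * d' * r = e' * a'" using 1 eq by (simp add: mult.assoc)
    show "y * (d * f) = c * f" using 2 by (simp add: mult.assoc[symmetric])
    show "f' * d' * s = f' * c'" using 2 by (simp add: mult.assoc)
  qed
qed

lemma ext_unique: assumes "ext z r" "ext z s" shows "r = s"
  using assms
proof (rule common_denominator)
  fix N N' a a' c c'
  assume *: "(N, N') \<in> G" "N' \<noteq> 0" "(a, a') \<in> G" "(c, c') \<in> G"
    "z * N = a" "N' * r = a'" "z * N = c" "N' * s = c'"
  then have "N' * r = N' * s" using functional by blast
  then show "r = s" using *(2) by simp
qed

lemma ext_add: assumes "ext z r" "ext y s" shows "ext (z + y) (r + s)"
  using assms
proof (rule common_denominator)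
  fix N N' a a' c c'
  assume *: "(N, N') \<in> G" "N' \<noteq> 0" "(a, a') \<in> G" "(c, c') \<in> G"
    "z * N = a" "N' * r = a'" "y * N = c" "N' * s = c'"
  then have "(z + y) * N = a + c" "N' * (r + s) = a' + c'" by (simp_all add: algebra_simps)
  then show "ext (z + y) (r + s)" unfolding ext_def using add *(1-4) by blast
qed

text \<open>In a b^-1 c d^-1 the Ore condition rewrites b^-1 c as e f^-1, which leaves the fraction
  (a e) (d f)^-1.\<close>

lemma ext_mult: assumes "ext z r" "ext y s" shows "ext (z * y) (s * r)"
proof -
  from assms obtain a a' b b' c c' d d' where
    1: "(a, a') \<in> G" "(b, b') \<in> G" "b' \<noteq> 0" "z * b = a" "b' * r = a'" and
    2: "(c, c') \<in> G" "(d, d') \<in> G" "d' \<noteq> 0" "y * d = c" "d' * s = c'"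
    unfolding ext_def by blast
  from ore[OF 1(2) 1(3) 2(1)] obtain e e' f f' where
    3: "(e, e') \<in> G" "(f, f') \<in> G" "f' \<noteq> 0" "c * f = b * e" by blast
  have cf: "(c * f, f' * c') \<in> G" and be: "(b * e, e' * b') \<in> G"
    using mult 1 2 3 by blast+
  have eq: "f' * c' = e' * b'" using functional[OF cf] be 3(4) by simp
  have "z * y * (d * f) = z * (y * d * f)" by (simp add: mult.assoc)
  also have "\<dots> = z * (c * f)" using 2 by simp
  also have "\<dots> = a * e" using 1 3 by (simp add: mult.assoc[symmetric])
  finally have l: "z * y * (d * f) = a * e" .
  have "f' * d' * (s * r) = f' * (d' * s) * r" by (simp add: mult.assoc)
  also have "\<dots> = e' * (b' * r)" using 2 eq by (simp add: mult.assoc)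
  also have "\<dots> = e' * a'" using 1 by simp
  finally have r: "f' * d' * (s * r) = e' * a'" .
  have "(a * e, e' * a') \<in> G" "(d * f, f' * d') \<in> G" "f' * d' \<noteq> 0"
    using mult 1 2 3 by auto
  then show ?thesis unfolding ext_def using l r by blast
qed

lemma ext_inverse: assumes "ext z r" "r \<noteq> 0" shows "ext (inverse z) (inverse r)"
proof -
  from assms obtain a a' b b' where
    1: "(a, a') \<in> G" "(b, b') \<in> G" "b' \<noteq> 0" "z * b = a" "b' * r = a'"
    unfolding ext_def by blast
  have "a' \<noteq> 0" using 1 assms by auto
  moreover have "z \<noteq> 0" using nonzero[OF 1(1) calculation] 1 by auto
  then have "inverse z * a = b" unfolding 1(4)[symmetric] by (simp add: mult.assoc[symmetric])
  moreover have "a' * inverse r = b'" unfolding 1(5)[symmetric] using assms(2) by (simp add: mult.assoc)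
  ultimately show ?thesis unfolding ext_def using 1 by blast
qed

lemma ext_0: "ext 0 0" and ext_1: "ext 1 1"
  using ext_graph[OF one] ext_graph[OF add[OF one uminus[OF one]]] by auto

lemma ext_uminus: "ext z r \<Longrightarrow> ext (- z) (- r)"
  using ext_mult[OF _ ext_graph[OF uminus[OF one]], of z r] by simp

lemma ext_diff: "ext z r \<Longrightarrow> ext y s \<Longrightarrow> ext (z - y) (r - s)"
  using ext_add[OF _ ext_uminus, of z r y s] by simp

lemma ext_power: "ext z r \<Longrightarrow> ext (z ^ k) (r ^ k)"
proof (induction k)
  case (Suc k)
  then show ?case using ext_mult[of z r "z ^ k" "r ^ k"] by (simp add: power_commutes)
qed (simp add: ext_1)

lemma ext_power_int: "ext z r \<Longrightarrow> r \<noteq> 0 \<Longrightarrow> ext (z powi k) (r powi k)"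
  by (cases k rule: int_cases4) (simp_all add: ext_power ext_inverse power_int_minus)

lemma ext_of_nat: "ext (of_nat k) (of_nat k)"
  by (induction k) (auto simp: ext_0 ext_1 ext_add)

lemma ext_of_int: "ext (of_int k) (of_int k)"
  by (cases k rule: int_cases4) (simp_all add: ext_of_nat ext_uminus)

lemma ext_sum: "(\<And>i. i \<in> I \<Longrightarrow> ext (f i) (g i)) \<Longrightarrow> ext (sum f I) (sum g I)"
  by (induction I rule: infinite_finite_induct) (auto simp: ext_0 ext_add)

end

text \<open>Unordered products require commutative source and target, hence fields, where the
  reversal of factors is invisible.\<close>

lemma antihom_graph_ext_prod:
  fixes f :: "'i \<Rightarrow> 'a::field" and g :: "'i \<Rightarrow> 'b::field"
  assumes "antihom_graph G" "\<And>i. i \<in> I \<Longrightarrow> antihom_graph.ext G (f i) (g i)"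
  shows "antihom_graph.ext G (prod f I) (prod g I)"
proof -
  interpret antihom_graph G by fact
  show ?thesis using assms(2)
  proof (induction I rule: infinite_finite_induct)
    case (insert i I)
    then show ?case using ext_mult[of "f i" "g i" "prod f I" "prod g I"] by (simp add: mult.commute)
  qed (simp_all add: ext_1)
qed

section \<open>Linear combinations with finitely supported coefficients\<close>

lemma keys_sum_subset:
  "keys (sum f I) \<subseteq> (\<Union>i\<in>I. keys (f i))"
  by (induction I rule: infinite_finite_induct) (use keys_add in fastforce)+

lemma poly_mapping_eq_sum_single:
  "p = (\<Sum>k\<in>keys p. single k (lookup p k))"
  by (rule poly_mapping_eqI) (auto simp: lookup_sum lookup_single when_def in_keys_iff)

lemma poly_mapping_keys_induct [consumes 1, case_names zero add]:
  fixes p :: "'k \<Rightarrow>\<^sub>0 'c::comm_monoid_add"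
  assumes "keys p \<subseteq> S" "P 0"
    and step: "\<And>p k c. keys p \<subseteq> S \<Longrightarrow> k \<in> S \<Longrightarrow> P p \<Longrightarrow> P (p + single k c)"
  shows "P p"
proof -
  have "keys (\<Sum>k\<in>A. single k (lookup p k)) \<subseteq> S \<and>
      P (\<Sum>k\<in>A. single k (lookup p k))"
    if "finite A" "A \<subseteq> S" for A
    using that
  proof (induction A rule: finite_induct)
    case (insert k A)
    then have "P ((\<Sum>k\<in>A. single k (lookup p k)) +
        single k (lookup p k))"
      by (intro step) auto
    moreover have "keys (\<Sum>k\<in>insert k A. single k (lookup p k)) \<subseteq> S"
      using insert.prems by (intro order.trans[OF keys_sum_subset]) (auto split: if_splits)
    ultimately show ?case using insert by (simp add: add.commute)
  qed (use assms in auto)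
  from this[of "keys p"] show ?thesis
    using assms(1) poly_mapping_eq_sum_single[of p] by simp
qed

text \<open>With a suitable \<open>X\<close> this is evaluation of polynomials, of Laurent
  polynomials, or of coefficients in q^(1/2), so that additivity is proved once.\<close>

definition lin :: "('k \<Rightarrow> 'a::ring_1) \<Rightarrow> ('k \<Rightarrow>\<^sub>0 int) \<Rightarrow> 'a" where
  "lin X p = (\<Sum>k\<in>keys p. of_int (lookup p k) * X k)"

lemma lin_0 [simp]: "lin X 0 = 0"
  by (simp add: lin_def)

lemma lin_add: "lin X (p + q) = lin X p + lin X q"
  unfolding lin_def by (rule setsum_keys_plus_distrib) (auto simp: algebra_simps)

lemma lin_single [simp]: "lin X (single k c) = of_int c * X k"
  by (simp add: lin_def)

lemma lin_sum: "lin X (sum f I) = (\<Sum>i\<in>I. lin X (f i))"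
  by (induction I rule: infinite_finite_induct) (auto simp: lin_add)

lemma lin_uminus: "lin X (- p) = - lin X p"
  using lin_add[of X p "- p"] by (simp add: eq_neg_iff_add_eq_0 add.commute)

lemma lin_diff: "lin X (p - q) = lin X p - lin X q"
  using lin_add[of X p "- q"] by (simp add: lin_uminus)

lemma lin_cong: "(\<And>k. k \<in> keys p \<Longrightarrow> X k = Y k) \<Longrightarrow> lin X p = lin Y p"
  by (simp add: lin_def)

text \<open>Pushforward along a change of exponents. Coefficients in one fibre add up, so the
  support can shrink unless \<open>f\<close> is injective on it.\<close>

definition push :: "('k \<Rightarrow> 'l) \<Rightarrow> ('k \<Rightarrow>\<^sub>0 'c::comm_monoid_add) \<Rightarrow> ('l \<Rightarrow>\<^sub>0 'c)" where
  "push f p = (\<Sum>k\<in>keys p. single (f k) (lookup p k))"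

lemma keys_push: "keys (push f p) \<subseteq> f ` keys p"
  unfolding push_def by (rule order.trans[OF keys_sum_subset]) (auto split: if_splits)

lemma push_0 [simp]: "push f 0 = 0"
  by (simp add: push_def)

lemma lookup_push:
  assumes "inj_on f S" "keys p \<subseteq> S" "k \<in> S"
  shows "lookup (push f p) (f k) = lookup p k"
proof -
  have "lookup (push f p) (f k) =
      (\<Sum>l\<in>keys p. if l = k then lookup p l else 0)"
    unfolding push_def lookup_sum using assms
    by (intro sum.cong) (auto simp: lookup_single when_def dest: inj_onD)
  then show ?thesis by (simp add: in_keys_iff)
qed

lemma push_eq_0_iff:
  assumes "inj_on f S" "keys p \<subseteq> S"
  shows "push f p = 0 \<longleftrightarrow> p = 0"
proof
  assume "push f p = 0"
  then have "lookup p k = 0" if "k \<in> S" for k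
    using lookup_push[OF assms that] by simp
  then show "p = 0" using assms(2) by (intro poly_mapping_eqI) (auto simp: in_keys_iff)
qed simp

lemma lin_push: "lin X (push f p) = lin (X \<circ> f) p"
  unfolding push_def lin_sum lin_single by (simp add: lin_def)

section \<open>Elements of quantum tori\<close>

lemma q_coeff_eval_lin: "q_coeff_eval v a = lin (\<lambda>r. v powi r) a"
  by (simp add: q_coeff_eval_def lin_def)

lemma q_combination_0 [simp]: "q_combination v X 0 = 0"
  by (simp add: q_combination_def)

lemma q_combination_add: "q_combination v X (a + b) = q_combination v X a + q_combination v X b"
  unfolding q_combination_def
  by (rule setsum_keys_plus_distrib) (auto simp: q_coeff_eval_lin lin_add distrib_right)

lemma q_combination_single [simp]:
  "q_combination v X (single e a) = q_coeff_eval v a * X e"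
  by (simp add: q_combination_def q_coeff_eval_def)

lemma q_combination_sum: "q_combination v X (sum f I) = (\<Sum>i\<in>I. q_combination v X (f i))"
  by (induction I rule: infinite_finite_induct) (auto simp: q_combination_add)

lemma q_combination_uminus: "q_combination v X (- a) = - q_combination v X a"
  using q_combination_add[of v X a "- a"] by (simp add: eq_neg_iff_add_eq_0 add.commute)

lemma q_combination_diff:
  "q_combination v X (a - b) = q_combination v X a - q_combination v X b"
  using q_combination_add[of v X a "- b"] by (simp add: q_combination_uminus)

lemma q_combination_cong:
  "(\<And>e. e \<in> keys a \<Longrightarrow> X e = Y e) \<Longrightarrow> q_combination v X a = q_combination v Y a"
  by (simp add: q_combination_def)

lemma q_combination_push: "q_combination v X (push f a) = q_combination v (X \<circ> f) a"
  unfolding push_def q_combination_sum q_combination_single by (simp add: q_combination_def)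

section \<open>Evaluation of rational functions\<close>

definition monom_eval :: "(nat \<Rightarrow> 'k::comm_ring_1) \<Rightarrow> (nat \<Rightarrow>\<^sub>0 nat) \<Rightarrow> 'k" where
  "monom_eval y e = (\<Prod>i\<in>keys e. y i ^ lookup e i)"

lemma monom_eval_superset:
  "finite S \<Longrightarrow> keys e \<subseteq> S \<Longrightarrow> monom_eval y e = (\<Prod>i\<in>S. y i ^ lookup e i)"
  unfolding monom_eval_def by (rule prod.mono_neutral_left) (auto simp: in_keys_iff)

lemma monom_eval_add: "monom_eval y (e + f) = monom_eval y e * monom_eval y f"
proof -
  let ?S = "keys e \<union> keys f"
  have "keys (e + f) \<subseteq> ?S" by (rule keys_add)
  then show ?thesis
    by (simp add: monom_eval_superset[of ?S] lookup_add power_add prod.distrib)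
qed

lemma monom_eval_0 [simp]: "monom_eval y 0 = 1"
  by (simp add: monom_eval_def)

lemma monom_eval_single [simp]: "monom_eval y (single i k) = y i ^ k"
  by (simp add: monom_eval_def)

lemma lin_monom_eval_mult:
  "lin (monom_eval y) (p * q) = lin (monom_eval y) p * lin (monom_eval y) q"
proof -
  have 0: "lin (monom_eval y) (single k d * single e c) =
      of_int d * monom_eval y k * (of_int c * monom_eval y e)" for k d e c
    by (simp add: mult_single monom_eval_add mult_ac)
  have *: "lin (monom_eval y) (p * single e c) =
      lin (monom_eval y) p * (of_int c * monom_eval y e)" for p e c
    using subset_UNIV[of "keys p"]
    by (induction p rule: poly_mapping_keys_induct) (simp_all add: distrib_right lin_add 0)
  show ?thesis
    using subset_UNIV[of "keys q"]
    by (induction q rule: poly_mapping_keys_induct) (simp_all add: distrib_left lin_add *)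
qed

definition eval_graph :: "(nat \<Rightarrow> 'k::field) \<Rightarrow> (ratfun \<times> 'k) set" where
  "eval_graph y = range (\<lambda>p. (Fract p 1, lin (monom_eval y) p))"

lemma Fract_1_eq_iff: "Fract p 1 = Fract q 1 \<longleftrightarrow> p = (q :: (nat \<Rightarrow>\<^sub>0 nat) \<Rightarrow>\<^sub>0 int)"
  by (subst eq_fract) auto

text \<open>By commutativity the Ore condition holds with the two given elements exchanged.\<close>

lemma antihom_graph_eval: "antihom_graph (eval_graph (y :: nat \<Rightarrow> 'k::field))"
proof
  show "(1, 1) \<in> eval_graph y"
    unfolding eval_graph_def
    using lin_single[of "monom_eval y" 0 1] by (intro range_eqI[of _ _ 1]) (simp add: One_fract_def)
next
  fix a b :: ratfun and a' b' :: 'k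
  assume a: "(a, a') \<in> eval_graph y" and b: "(b, b') \<in> eval_graph y"
  then obtain p q where pq: "a = Fract p 1" "a' = lin (monom_eval y) p"
    "b = Fract q 1" "b' = lin (monom_eval y) q"
    unfolding eval_graph_def by auto
  show "(a + b, a' + b') \<in> eval_graph y"
    unfolding eval_graph_def by (rule range_eqI[of _ _ "p + q"]) (simp add: pq lin_add)
  show "(a * b, b' * a') \<in> eval_graph y"
    unfolding eval_graph_def
    by (rule range_eqI[of _ _ "p * q"]) (simp add: pq lin_monom_eval_mult mult.commute)
  show "\<exists>e e' f f'. (e, e') \<in> eval_graph y \<and> (f, f') \<in> eval_graph y \<and> f' \<noteq> 0 \<and> b * f = a * e"
    if "a' \<noteq> 0"
    using a b that by (metis mult.commute)
next
  fix a :: ratfun and a' :: 'k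
  assume "(a, a') \<in> eval_graph y"
  then obtain p where pq: "a = Fract p 1" "a' = lin (monom_eval y) p"
    unfolding eval_graph_def by auto
  show "(- a, - a') \<in> eval_graph y"
    unfolding eval_graph_def by (rule range_eqI[of _ _ "- p"]) (simp add: pq lin_uminus)
next
  fix w :: 'k assume "(0, w) \<in> eval_graph y"
  then show "w = 0" unfolding eval_graph_def Zero_fract_def by (auto simp: Fract_1_eq_iff)
qed

text \<open>\<open>ev y r s\<close> says that the rational function \<open>r\<close> is regular at the point \<open>y\<close> with value \<open>s\<close>.\<close>

definition ev :: "(nat \<Rightarrow> 'k::field) \<Rightarrow> ratfun \<Rightarrow> 'k \<Rightarrow> bool" where
  "ev y = antihom_graph.ext (eval_graph y)"

interpretation ev: antihom_graph "eval_graph y"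
  rewrites "antihom_graph.ext (eval_graph y) = ev y"
  by (rule antihom_graph_eval) (simp add: ev_def)

lemma ev_mult: "ev y a r \<Longrightarrow> ev y b s \<Longrightarrow> ev y (a * b) (r * s)"
  using ev.ext_mult[of y a r b s] by (simp add: mult.commute)

lemma ev_prod: "(\<And>i. i \<in> I \<Longrightarrow> ev y (f i) (g i)) \<Longrightarrow> ev y (prod f I) (prod g I)"
  unfolding ev_def by (rule antihom_graph_ext_prod[OF antihom_graph_eval])

lemma ev_divide: "ev y a r \<Longrightarrow> ev y b s \<Longrightarrow> s \<noteq> 0 \<Longrightarrow> ev y (a / b) (r / s)"
  using ev_mult[OF _ ev.ext_inverse, of y a r b s] by (simp add: field_simps)

lemma ev_ratvar: "ev y (ratvar i) (y i)"
  by (rule ev.ext_graph)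
     (auto simp: ratvar_def eval_graph_def intro!: range_eqI[of _ _ "single (single i 1) 1"])

section \<open>The positive cone\<close>

text \<open>
  Cluster variables have subtraction-free expressions, hence positive values at \<open>(1, 1, \<dots>)\<close>;
  this is all the positivity that is needed to exclude vanishing denominators.
\<close>

definition pos :: "ratfun set" where
  "pos = {r. \<exists>s::rat. ev (\<lambda>_. 1) r s \<and> s > 0}"

lemma pos_add: "a \<in> pos \<Longrightarrow> b \<in> pos \<Longrightarrow> a + b \<in> pos"
  unfolding pos_def using ev.ext_add add_pos_pos by blast

lemma pos_mult: "a \<in> pos \<Longrightarrow> b \<in> pos \<Longrightarrow> a * b \<in> pos"
  unfolding pos_def using ev_mult mult_pos_pos by blast

lemma pos_inverse: "a \<in> pos \<Longrightarrow> inverse a \<in> pos"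
proof -
  assume "a \<in> pos"
  then obtain s :: rat where s: "ev (\<lambda>_. 1) a s" "s > 0" unfolding pos_def by blast
  then have "ev (\<lambda>_. 1) (inverse a) (inverse s)" by (intro ev.ext_inverse) auto
  with s(2) show ?thesis unfolding pos_def by (auto intro!: exI[of _ "inverse s"])
qed

lemma pos_1: "1 \<in> pos"
  unfolding pos_def using ev.ext_1[of "\<lambda>_. 1 :: rat"] by (auto intro!: exI[of _ 1])

lemma pos_ratvar: "ratvar i \<in> pos"
  unfolding pos_def using ev_ratvar[of "\<lambda>_. 1 :: rat" i] by (auto intro!: exI[of _ 1])

lemma pos_nonzero: "a \<in> pos \<Longrightarrow> a \<noteq> 0"
  unfolding pos_def mem_Collect_eq using ev.ext_unique[OF ev.ext_0] less_irrefl by metis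

lemma pos_power: "a \<in> pos \<Longrightarrow> a ^ k \<in> pos"
  by (induction k) (auto simp: pos_1 pos_mult)

lemma pos_power_int: "a \<in> pos \<Longrightarrow> a powi k \<in> pos"
  by (cases k rule: int_cases4) (auto simp: pos_power pos_inverse power_int_minus)

lemma pos_prod: "(\<And>i. i \<in> I \<Longrightarrow> f i \<in> pos) \<Longrightarrow> prod f I \<in> pos"
  by (induction I rule: infinite_finite_induct) (auto simp: pos_1 pos_mult)

lemma ratvar_nonzero [simp]: "ratvar i \<noteq> 0"
  using pos_nonzero[OF pos_ratvar] .

text \<open>Evaluation at (1, 1, ...) with rational values reduces characteristic zero to that of
  the rational numbers.\<close>

lemma of_int_ratfun_eq_0_iff [simp]: "of_int c = (0 :: ratfun) \<longleftrightarrow> c = 0"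
proof
  assume "of_int c = (0 :: ratfun)"
  then have "ev (\<lambda>_. 1 :: rat) 0 (of_int c)" using ev.ext_of_int[of "\<lambda>_. 1 :: rat" c] by simp
  from ev.ext_unique[OF this ev.ext_0] show "c = 0" by simp
qed simp

section \<open>Laurent monomials\<close>

definition vmon :: "nat \<Rightarrow> (nat \<Rightarrow> 'k::field) \<Rightarrow> int vec \<Rightarrow> 'k" where
  "vmon r x e = (\<Prod>i<r. x i powi (e $ i))"

lemma laurent_eval_lin: "laurent_eval r x P = lin (vmon r x) P"
  by (simp add: laurent_eval_def lin_def vmon_def)

lemma vmon_nonzero: "(\<And>i. i < r \<Longrightarrow> x i \<noteq> 0) \<Longrightarrow> vmon r x e \<noteq> 0"
  by (simp add: vmon_def)

lemma vmon_add:
  "(\<And>i. i < r \<Longrightarrow> x i \<noteq> 0) \<Longrightarrow> r \<le> dim_vec f \<Longrightarrow> vmon r x (e + f) = vmon r x e * vmon r x f"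
  by (simp add: vmon_def power_int_add flip: prod.distrib)

lemma vmon_uminus: "r \<le> dim_vec e \<Longrightarrow> vmon r x (- e) = inverse (vmon r x e)"
  by (simp add: vmon_def power_int_minus flip: prod_inversef)

lemma vmon_0 [simp]: "vmon r x (0\<^sub>v r) = 1"
  by (simp add: vmon_def)

lemma vmon_unit [simp]: "i < r \<Longrightarrow> vmon r x (unit_vec r i) = x i"
proof -
  assume "i < r"
  have "vmon r x (unit_vec r i) = (\<Prod>j<r. if j = i then x i else 1)"
    unfolding vmon_def by (rule prod.cong) (auto simp: unit_vec_def)
  with \<open>i < r\<close> show ?thesis by simp
qed

lemma ev_vmon:
  "(\<And>i. i < r \<Longrightarrow> ev y (x i) (s i)) \<Longrightarrow> (\<And>i. i < r \<Longrightarrow> s i \<noteq> 0) \<Longrightarrow> ev y (vmon r x e) (vmon r s e)"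
  unfolding vmon_def by (intro ev_prod ev.ext_power_int) auto

lemma lin_Fract_single: "lin (\<lambda>e. Fract (single e 1) 1) p = Fract p (1 :: (nat \<Rightarrow>\<^sub>0 nat) \<Rightarrow>\<^sub>0 int)"
proof -
  have *: "of_int c = Fract (of_int c) (1 :: (nat \<Rightarrow>\<^sub>0 nat) \<Rightarrow>\<^sub>0 int)" for c
    by (cases c rule: int_cases4) (auto simp: of_nat_fract)
  have single: "of_int c * Fract (single e 1) 1 = Fract (single e c) (1 :: (nat \<Rightarrow>\<^sub>0 nat) \<Rightarrow>\<^sub>0 int)" for c e
    unfolding * by (simp add: mult_single flip: single_of_int)
  show ?thesis
    using subset_UNIV[of "keys p"]
    by (induction p rule: poly_mapping_keys_induct) (simp_all add: lin_add single Zero_fract_def)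
qed

text \<open>A high power of the product of all variables clears denominators. The combination
  becomes the image of a polynomial, namely of the pushforward of \<open>P\<close> along a map of
  exponents that is injective on its support.\<close>

lemma laurent_independent:
  assumes keys: "keys P \<subseteq> carrier_vec m" and 0: "laurent_eval m ratvar P = 0"
  shows "P = 0"
proof -
  \<comment> \<open>\<open>N\<close> bounds every negative exponent that occurs; the inserted 0
    keeps the set nonempty.\<close>
  define N where "N = Max (insert 0 ((\<lambda>(e, i). - (e $ i)) ` (keys P \<times> {..<m})))"
  have N: "e $ i + N \<ge> 0" if "e \<in> keys P" "i < m" for e i
  proof -
    have "- (e $ i) \<le> N"
      unfolding N_def using that by (intro Max_ge) (auto intro!: rev_image_eqI)
    then show ?thesis by simp
  qed
  define mo where "mo e = (\<Sum>i<m. single i (nat (e $ i + N)))" for e :: "int vec"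
  have inj: "inj_on mo (keys P)"
  proof
    fix e f assume *: "e \<in> keys P" "f \<in> keys P" "mo e = mo f"
    have l: "lookup (mo g) i = nat (g $ i + N)" if "i < m" for g i
      using that by (simp add: mo_def lookup_sum lookup_single when_def)
    show "e = f"
    proof
      show d: "dim_vec e = dim_vec f" using keys * by (metis carrier_vecD subsetD)
      fix i assume "i < dim_vec f"
      then have i: "i < m" using keys * by auto
      have "nat (e $ i + N) = nat (f $ i + N)"
        using * l[OF i, of e] l[OF i, of f] by simp
      then show "e $ i = f $ i" using N[OF *(1) i] N[OF *(2) i] by simp
    qed
  qed
  have ratvar_power: "ratvar i ^ k = Fract (single (single i k) 1) 1" for i k
  proof (induction k)
    case (Suc k)
    then show ?case by (simp add: ratvar_def mult_single single_add[symmetric])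
  qed (simp add: One_fract_def)
  have prod_Fract: "(\<Prod>i\<in>I. Fract (single (f i) 1) 1) =
      Fract (single (\<Sum>i\<in>I. f i) 1) (1 :: (nat \<Rightarrow>\<^sub>0 nat) \<Rightarrow>\<^sub>0 int)" for I :: "nat set" and f
    by (induction I rule: infinite_finite_induct) (simp_all add: mult_single One_fract_def)
  have mon: "vmon m ratvar e * (\<Prod>i<m. ratvar i powi N) = Fract (single (mo e) 1) 1"
    if e: "e \<in> keys P" for e
  proof -
    have "vmon m ratvar e * (\<Prod>i<m. ratvar i powi N) = (\<Prod>i<m. ratvar i powi (e $ i + N))"
      by (simp add: vmon_def power_int_add flip: prod.distrib)
    also have "\<dots> = (\<Prod>i<m. Fract (single (single i (nat (e $ i + N))) 1) 1)"
      using N[OF e] by (intro prod.cong) (auto simp: power_int_nonneg_exp ratvar_power)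
    finally show ?thesis by (simp add: prod_Fract mo_def)
  qed
  have "0 = lin (vmon m ratvar) P * (\<Prod>i<m. ratvar i powi N)"
    using 0 by (simp add: laurent_eval_lin)
  also have "\<dots> = lin ((\<lambda>e. Fract (single e 1) 1) \<circ> mo) P"
    unfolding lin_def sum_distrib_right o_def
    by (intro sum.cong refl) (simp only: mult.assoc mon)
  also have "\<dots> = Fract (push mo P) 1"
    by (simp add: lin_push[symmetric] lin_Fract_single)
  finally have "push mo P = 0" by (metis Fract_1_eq_iff Zero_fract_def)
  with push_eq_0_iff[OF inj order_refl] show ?thesis by simp
qed

lemma vmon_inject:
  assumes "e \<in> carrier_vec m" "f \<in> carrier_vec m" "vmon m ratvar e = vmon m ratvar f"
  shows "e = f"
proof -
  have "keys (single e (1::int) - single f 1) \<subseteq> carrier_vec m"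
    using keys_diff[of "single e (1::int)" "single f 1"] assms by auto
  from laurent_independent[OF this] have "single e (1::int) = single f 1"
    using assms(3) by (simp add: laurent_eval_lin lin_diff)
  then show ?thesis by (simp only: frag_of_eq)
qed

section \<open>Laurent rings\<close>

inductive_set subring :: "'a::comm_ring_1 set \<Rightarrow> 'a set" for G where
  base: "g \<in> G \<Longrightarrow> g \<in> subring G"
| one: "1 \<in> subring G"
| diff: "a \<in> subring G \<Longrightarrow> b \<in> subring G \<Longrightarrow> a - b \<in> subring G"
| mult: "a \<in> subring G \<Longrightarrow> b \<in> subring G \<Longrightarrow> a * b \<in> subring G"

lemma subring_0: "0 \<in> subring G"
  using subring.diff[OF subring.one subring.one] by simp

lemma subring_uminus: "a \<in> subring G \<Longrightarrow> - a \<in> subring G"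
  using subring.diff[OF subring_0] by fastforce

lemma subring_add: "a \<in> subring G \<Longrightarrow> b \<in> subring G \<Longrightarrow> a + b \<in> subring G"
  using subring.diff[OF _ subring_uminus, of a G b] by simp

lemma subring_power: "a \<in> subring G \<Longrightarrow> a ^ k \<in> subring G"
  by (induction k) (auto intro: subring.intros)

lemma subring_prod: "(\<And>i. i \<in> I \<Longrightarrow> f i \<in> subring G) \<Longrightarrow> prod f I \<in> subring G"
  by (induction I rule: infinite_finite_induct) (auto intro: subring.intros)

lemma subring_power_int:
  "(a :: 'a::field) \<in> subring G \<Longrightarrow> inverse a \<in> subring G \<Longrightarrow> a powi k \<in> subring G"
  by (auto simp: power_int_def subring_power)

lemma subring_subset: assumes "\<And>g. g \<in> G \<Longrightarrow> g \<in> subring H" shows "subring G \<subseteq> subring H"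
proof
  fix a assume "a \<in> subring G"
  then show "a \<in> subring H" by induction (auto intro: subring.intros assms)
qed

definition laurent_ring :: "nat \<Rightarrow> nat set \<Rightarrow> (nat \<Rightarrow> 'k::field) \<Rightarrow> 'k set" where
  "laurent_ring m J x = subring (x ` {..<m} \<union> (\<lambda>i. inverse (x i)) ` J)"

lemma laurent_ring_var: "i < m \<Longrightarrow> x i \<in> laurent_ring m J x"
  and laurent_ring_inverse: "i \<in> J \<Longrightarrow> inverse (x i) \<in> laurent_ring m J x"
  unfolding laurent_ring_def by (auto intro: subring.base)

text \<open>Besides regularity, the value is located in the Laurent ring of the values; this is what
  transports Laurentness from the initial variables to other clusters.\<close>

lemma laurent_ring_ev:
  assumes "f \<in> laurent_ring m J x" "\<And>i. i < m \<Longrightarrow> ev y (x i) (s i)" "\<And>i. i \<in> J \<Longrightarrow> s i \<noteq> 0" "J \<subseteq> {..<m}"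
  shows "\<exists>r \<in> laurent_ring m J s. ev y f r"
  using assms(1) unfolding laurent_ring_def
proof induction
  case (base g)
  then consider i where "i < m" "g = x i" | i where "i \<in> J" "g = inverse (x i)" by auto
  then show ?case
  proof cases
    case 1
    then show ?thesis using assms(2) by (intro bexI[of _ "s i"]) (auto intro: subring.base)
  next
    case 2
    then show ?thesis using assms(2-4)
      by (intro bexI[of _ "inverse (s i)"]) (auto intro!: subring.base ev.ext_inverse)
  qed
next
  case one
  show ?case using ev.ext_1 subring.one by blast
next
  case (diff a b)
  then show ?case using ev.ext_diff subring.diff by blast
next
  case (mult a b)
  then show ?case using ev_mult subring.mult by blast
qed

lemma laurent_ring_laurent_eval:
  assumes "f \<in> laurent_ring m J x" "J \<subseteq> {..<m}" "\<And>i. i < m \<Longrightarrow> x i \<noteq> 0"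
  shows "\<exists>P. keys P \<subseteq> {e \<in> carrier_vec m. \<forall>i<m. i \<notin> J \<longrightarrow> e $ i \<ge> 0} \<and>
    f = laurent_eval m x P"
proof -
  let ?S = "{e \<in> carrier_vec m. \<forall>i<m. i \<notin> J \<longrightarrow> e $ i \<ge> 0} :: int vec set"
  have "\<exists>P. keys P \<subseteq> ?S \<and> f = lin (vmon m x) P"
    using assms(1) unfolding laurent_ring_def
  proof induction
    case (base g)
    then consider i where "i < m" "g = x i" | i where "i \<in> J" "g = inverse (x i)" by auto
    then show ?case
    proof cases
      case 1
      then show ?thesis
        by (intro exI[of _ "single (unit_vec m i) 1"]) auto
    next
      case 2
      then show ?thesis using assms(2)
        by (intro exI[of _ "single (- unit_vec m i) 1"])
           (auto simp: vmon_uminus subset_iff)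
    qed
  next
    case one
    show ?case by (rule exI[of _ "single (0\<^sub>v m) 1"]) auto
  next
    case (diff a b)
    then obtain P Q where "keys P \<subseteq> ?S" "a = lin (vmon m x) P"
      "keys Q \<subseteq> ?S" "b = lin (vmon m x) Q" by blast
    then show ?case using keys_diff[of P Q] by (intro exI[of _ "P - Q"]) (auto simp: lin_diff)
  next
    case (mult a b)
    then obtain P Q where P: "keys P \<subseteq> ?S" "a = lin (vmon m x) P"
      and Q: "keys Q \<subseteq> ?S" "b = lin (vmon m x) Q" by blast
    \<comment> \<open>The product is written out as a convolution, since vectors of varying length
      have no common zero.\<close>
    let ?R = "\<Sum>e\<in>keys P. \<Sum>f\<in>keys Q.
      single (e + f) (lookup P e * lookup Q f)"
    have "a * b = (\<Sum>e\<in>keys P. \<Sum>f\<in>keys Q.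
      of_int (lookup P e) * of_int (lookup Q f) * (vmon m x e * vmon m x f))"
      unfolding P Q lin_def sum_product by (simp add: mult_ac)
    also have "\<dots> = lin (vmon m x) ?R"
      unfolding lin_sum lin_single
    proof (intro sum.cong refl)
      fix e f assume "e \<in> keys P" "f \<in> keys Q"
      with P Q have "f \<in> carrier_vec m" by auto
      then show "of_int (lookup P e) * of_int (lookup Q f) *
          (vmon m x e * vmon m x f) =
        of_int (lookup P e * lookup Q f) * vmon m x (e + f)"
        using assms(3) by (subst vmon_add) auto
    qed
    finally have "a * b = lin (vmon m x) ?R" .
    have closed: "e + f \<in> ?S" if "e \<in> ?S" "f \<in> ?S" for e f
    proof (intro CollectI conjI allI impI)
      show "e + f \<in> carrier_vec m" using that by simp
      fix i assume i: "i < m" "i \<notin> J"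
      then have "0 \<le> e $ i" "0 \<le> f $ i" using that by blast+
      moreover have "dim_vec f = m" using that by (intro carrier_vecD) simp
      ultimately show "0 \<le> (e + f) $ i" using i by (simp only: index_add_vec(1) add_nonneg_nonneg)
    qed
    have sub: "keys (single (e + f) (c :: int)) \<subseteq> ?S"
      if "e \<in> keys P" "f \<in> keys Q" for e f c
      using closed[OF subsetD[OF P(1) that(1)] subsetD[OF Q(1) that(2)]]
      by (auto simp del: mem_Collect_eq)
    have "keys ?R \<subseteq> ?S"
      by (intro order.trans[OF keys_sum_subset] UN_least sub)
    moreover have "a * b = lin (vmon m x) ?R" by fact
    ultimately show ?case by blast
  qed
  then show ?thesis by (simp add: laurent_eval_lin)
qed

section \<open>Mutation of seeds\<close>

text \<open>Only the top \<open>n\<close> rows are inspected, so the notion applies to extended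
  matrices as it stands.\<close>

definition skew_symmetrizer :: "(nat \<Rightarrow> int) \<Rightarrow> nat \<Rightarrow> int mat \<Rightarrow> bool" where
  "skew_symmetrizer d n B \<longleftrightarrow> (\<forall>i<n. d i > 0) \<and> (\<forall>i<n. \<forall>j<n. d i * B $$ (i, j) = - (d j * B $$ (j, i)))"

lemma pos_part_nonneg [simp]: "pos_part b \<ge> 0"
  by (simp add: pos_part_def)

lemma pos_part_0 [simp]: "pos_part 0 = 0"
  by (simp add: pos_part_def)

lemma dim_matrix_mutation [simp]:
  "dim_row (matrix_mutation k B) = dim_row B" "dim_col (matrix_mutation k B) = dim_col B"
  by (simp_all add: matrix_mutation_def)

lemma matrix_mutation_carrier [simp]:
  "matrix_mutation k B \<in> carrier_mat m n \<longleftrightarrow> B \<in> carrier_mat m n"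
  unfolding carrier_mat_def by simp

lemma matrix_mutation_index:
  "i < dim_row B \<Longrightarrow> j < dim_col B \<Longrightarrow> matrix_mutation k B $$ (i, j) =
    (if i = k \<or> j = k then - B $$ (i, j)
     else B $$ (i, j) + sgn (B $$ (i, k)) * pos_part (B $$ (i, k) * B $$ (k, j)))"
  by (simp add: matrix_mutation_def)

text \<open>Once a sign \<open>e\<close> of \<open>c\<close> is fixed, the piecewise correction of
  matrix mutation becomes linear in \<open>c\<close>. This form turns the mutation of y-hats into
  identities between products.\<close>

lemma sgn_mult_pos_part:
  assumes "e = 1 \<or> e = -1" "e * c \<ge> 0"
  shows "sgn b * pos_part (b * c) = pos_part (e * b) * (c :: int)"
proof -
  consider "b > 0" | "b = 0" | "b < 0" by linarith
  then show ?thesis using assms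
    by cases (auto simp: pos_part_def max_def sgn_if mult_le_0_iff zero_le_mult_iff
        not_le mult_less_0_iff zero_less_mult_iff)
qed

lemma matrix_mutation_index_sign:
  "i < dim_row B \<Longrightarrow> j < dim_col B \<Longrightarrow> i \<noteq> k \<Longrightarrow> j \<noteq> k \<Longrightarrow> e = 1 \<or> e = -1 \<Longrightarrow> e * B $$ (k, j) \<ge> 0 \<Longrightarrow>
    matrix_mutation k B $$ (i, j) = B $$ (i, j) + pos_part (e * B $$ (i, k)) * B $$ (k, j)"
  by (simp add: matrix_mutation_index sgn_mult_pos_part)

lemma matrix_mutation_involution:
  assumes "k < dim_row B" "k < dim_col B"
  shows "matrix_mutation k (matrix_mutation k B) = B"
  by (rule eq_matI) (use assms in \<open>auto simp: matrix_mutation_index\<close>)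

lemma skew_symmetrizer_cong:
  assumes "skew_symmetrizer d n B" "\<And>i j. i < n \<Longrightarrow> j < n \<Longrightarrow> B' $$ (i, j) = B $$ (i, j)"
  shows "skew_symmetrizer d n B'"
  unfolding skew_symmetrizer_def
proof (intro conjI allI impI)
  fix r c assume rc: "r < n" "c < n"
  show "d r * B' $$ (r, c) = - (d c * B' $$ (c, r))"
    unfolding assms(2)[OF rc] assms(2)[OF rc(2,1)]
    using assms(1) rc unfolding skew_symmetrizer_def by blast
qed (use assms(1) in \<open>unfold skew_symmetrizer_def, blast\<close>)

lemma skew_symmetrizer_diag:
  assumes "skew_symmetrizer d n B" "k < n"
  shows "B $$ (k, k) = 0"
proof -
  have "d k * B $$ (k, k) = - (d k * B $$ (k, k))" "d k > 0"
    using assms unfolding skew_symmetrizer_def by blast+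
  then show ?thesis by simp
qed

lemma skew_symmetrizer_sgn:
  assumes "skew_symmetrizer d n B" "i < n" "j < n"
  shows "sgn (B $$ (j, i)) = - sgn (B $$ (i, j))"
proof -
  have "d i * B $$ (i, j) = - (d j * B $$ (j, i))" "d i > 0" "d j > 0"
    using assms unfolding skew_symmetrizer_def by blast+
  then have "sgn (d i * B $$ (i, j)) = - sgn (d j * B $$ (j, i))" "sgn (d i) = 1" "sgn (d j) = 1"
    by (simp_all add: sgn_minus)
  then show ?thesis by (simp add: sgn_mult)
qed

text \<open>The corrections at (i, j) and (j, i) vanish unless b_ki and b_kj have opposite signs. In
  that case both d_i b_ik b_kj and d_j b_jk b_ki equal -d_k b_ki b_kj, and the two positive parts
  supply opposite signs.\<close>

lemma skew_symmetrizer_mutation: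
  assumes B: "B \<in> carrier_mat m n" "n \<le> m" and skew: "skew_symmetrizer d n B" and k: "k < n"
  shows "skew_symmetrizer d n (matrix_mutation k B)"
  unfolding skew_symmetrizer_def
proof (intro conjI allI impI)
  fix i j assume ij: "i < n" "j < n"
  have sk: "d a * B $$ (a, b) = - (d b * B $$ (b, a))" if "a < n" "b < n" for a b
    using skew that unfolding skew_symmetrizer_def by blast
  have dims: "dim_row B = m" "dim_col B = n" using B by auto
  show "d i * matrix_mutation k B $$ (i, j) = - (d j * matrix_mutation k B $$ (j, i))"
  proof (cases "i = k \<or> j = k")
    case True
    then have "matrix_mutation k B $$ (i, j) = - B $$ (i, j)" "matrix_mutation k B $$ (j, i) = - B $$ (j, i)"
      using ij B by (auto simp: matrix_mutation_index)
    then show ?thesis using sk[OF ij] by (simp only: mult_minus_right)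
  next
    case False
    define e :: int where "e = (if B $$ (k, j) \<ge> 0 then 1 else -1)"
    define e' :: int where "e' = (if B $$ (k, i) \<ge> 0 then 1 else -1)"
    have e: "e = 1 \<or> e = -1" "e * B $$ (k, j) \<ge> 0" and e': "e' = 1 \<or> e' = -1" "e' * B $$ (k, i) \<ge> 0"
      by (auto simp: e_def e'_def)
    have "pos_part (e * B $$ (i, k)) * B $$ (k, j) * d i = - (pos_part (e' * B $$ (j, k)) * B $$ (k, i) * d j)"
    proof -
      have s: "sgn (B $$ (i, k)) = - sgn (B $$ (k, i))" "sgn (B $$ (j, k)) = - sgn (B $$ (k, j))"
        using skew_symmetrizer_sgn[OF skew] k ij by blast+
      have 1: "B $$ (i, k) * d i = - (B $$ (k, i) * d k)" "B $$ (j, k) * d j = - (B $$ (k, j) * d k)"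
        using sk[OF ij(1) k] sk[OF ij(2) k] by (simp_all add: mult.commute)
      have 2: "B $$ (i, k) * B $$ (k, j) * d i = - (B $$ (k, i) * B $$ (k, j) * d k)"
        "B $$ (j, k) * B $$ (k, i) * d j = - (B $$ (k, j) * B $$ (k, i) * d k)"
        using 1 by (metis mult.assoc mult.commute mult_minus_left)+
      have eq: "B $$ (i, k) * B $$ (k, j) * d i = B $$ (j, k) * B $$ (k, i) * d j"
        using 2 by (simp add: mult.commute)
      consider "B $$ (k, j) = 0" | "B $$ (k, i) = 0" | "B $$ (k, j) > 0" "B $$ (k, i) > 0"
        | "B $$ (k, j) > 0" "B $$ (k, i) < 0" | "B $$ (k, j) < 0" "B $$ (k, i) > 0"
        | "B $$ (k, j) < 0" "B $$ (k, i) < 0" by linarith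
      then show ?thesis
      proof cases
        case 4
        then have "B $$ (i, k) > 0" "B $$ (j, k) < 0" using s by (auto simp: sgn_if split: if_splits)
        with 4 eq show ?thesis by (simp add: e_def e'_def pos_part_def)
      next
        case 5
        then have "B $$ (i, k) < 0" "B $$ (j, k) > 0" using s by (auto simp: sgn_if split: if_splits)
        with 5 eq show ?thesis by (simp add: e_def e'_def pos_part_def)
      qed (use s in \<open>auto simp: e_def e'_def pos_part_def sgn_if split: if_splits\<close>)
    qed
    moreover have "matrix_mutation k B $$ (i, j) = B $$ (i, j) + pos_part (e * B $$ (i, k)) * B $$ (k, j)"
      using False ij B e by (intro matrix_mutation_index_sign) auto
    moreover have "matrix_mutation k B $$ (j, i) = B $$ (j, i) + pos_part (e' * B $$ (j, k)) * B $$ (k, i)"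
      using False ij B e' by (intro matrix_mutation_index_sign) auto
    ultimately show ?thesis using sk[OF ij] by (metis distrib_left mult.commute minus_add_distrib)
  qed
next
  show "d i > 0" if "i < n" for i using skew that unfolding skew_symmetrizer_def by blast
qed

section \<open>Exchange polynomials and the mutation of the y-hats\<close>

definition exchange_monomial :: "int \<Rightarrow> (nat \<Rightarrow> 'k::field) \<Rightarrow> int mat \<Rightarrow> nat \<Rightarrow> 'k" where
  "exchange_monomial e x B k = (\<Prod>i<dim_row B. x i powi pos_part (e * B $$ (i, k)))"

text \<open>For the initial cluster this is \<open>y_hat\<close>; arbitrary clusters are needed
  because the quantity is followed through mutations.\<close>

definition yhat :: "(nat \<Rightarrow> 'k::field) \<Rightarrow> int mat \<Rightarrow> nat \<Rightarrow> 'k" where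
  "yhat x B k = (\<Prod>i<dim_row B. x i powi (B $$ (i, k)))"

lemma snd_seed_mutation [simp]: "snd (seed_mutation k s) = matrix_mutation k (snd s)"
  by (simp add: seed_mutation_def split: prod.split)

lemma fst_seed_mutation:
  "fst (seed_mutation k (x, B)) = x(k := inverse (x k) * (exchange_monomial 1 x B k + exchange_monomial (-1) x B k))"
  by (simp add: seed_mutation_def exchange_monomial_def)

lemma seed_mutation_eq:
  "seed_mutation k (x, B) =
    (x(k := inverse (x k) * (exchange_monomial 1 x B k + exchange_monomial (-1) x B k)), matrix_mutation k B)"
  by (simp add: seed_mutation_def exchange_monomial_def)

lemma snd_fold_seed_mutation [simp]: "snd (fold seed_mutation w s) = fold matrix_mutation w (snd s)"
  by (induction w arbitrary: s) simp_all

lemma exchange_monomial_nonzero: "(\<And>i. i < dim_row B \<Longrightarrow> x i \<noteq> 0) \<Longrightarrow> exchange_monomial e x B k \<noteq> 0"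
  by (simp add: exchange_monomial_def)

lemma exchange_monomial_vmon:
  "exchange_monomial e x B k = vmon (dim_row B) x (vec (dim_row B) (\<lambda>i. pos_part (e * B $$ (i, k))))"
  by (simp add: exchange_monomial_def vmon_def)

lemma yhat_vmon: "k < dim_col B \<Longrightarrow> yhat x B k = vmon (dim_row B) x (col B k)"
  by (simp add: yhat_def vmon_def)

lemma prod_power_int: "prod f S powi c = (\<Prod>i\<in>S. f i powi c :: 'k::field)"
  by (induction S rule: infinite_finite_induct) (auto simp: power_int_mult_distrib)

text \<open>Comes from [e b]_+ = [-e b]_+ + e b in every exponent. Both signs are kept available, so
  that either exchange monomial can be factored out.\<close>

lemma exchange_monomial_yhat:
  assumes "\<And>i. i < dim_row B \<Longrightarrow> x i \<noteq> 0" "e = 1 \<or> e = -1"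
  shows "exchange_monomial e x B k = exchange_monomial (- e) x B k * yhat x B k powi e"
proof -
  have *: "pos_part (e * b) = pos_part (- e * b) + b * e" for b
    using assms(2) by (auto simp: pos_part_def)
  show ?thesis
    unfolding exchange_monomial_def yhat_def prod_power_int prod.distrib[symmetric] power_int_mult[symmetric]
    using assms(1) by (intro prod.cong) (simp_all add: * power_int_add)
qed

lemma exchange_polynomial_yhat:
  assumes "\<And>i. i < dim_row B \<Longrightarrow> x i \<noteq> 0" "e = 1 \<or> e = -1"
  shows "exchange_monomial 1 x B k + exchange_monomial (-1) x B k =
    exchange_monomial (- e) x B k * (1 + yhat x B k powi e)"
  using exchange_monomial_yhat[OF assms, where k = k] assms(2) by (auto simp: algebra_simps)

text \<open>This is the mutation rule of Y-variables. The new x_k contributes Q to the power -b_kj,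
  which cancels the power Q^(b_kj) collected from the changed entries of column j.\<close>

lemma yhat_mutation:
  fixes x :: "nat \<Rightarrow> ratfun"
  assumes B: "B \<in> carrier_mat m n" "k < n" "n \<le> m" "j < n" "j \<noteq> k" "B $$ (k, k) = 0"
    and x: "\<And>i. i < m \<Longrightarrow> x i \<noteq> 0"
    and e: "e = 1 \<or> e = -1" "e * B $$ (k, j) \<ge> 0"
  shows "yhat (fst (seed_mutation k (x, B))) (matrix_mutation k B) j =
    yhat x B j * (1 + yhat x B k powi (- e)) powi (- B $$ (k, j))"
proof -
  have dims: "dim_row B = m" "dim_col B = n" and km: "k < m" using B by auto
  let ?S = "{..<m} - {k}"
  have split: "(\<Prod>i<m. f i) = f k * prod f ?S" for f :: "nat \<Rightarrow> ratfun"
    using km by (simp add: prod.remove)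
  \<comment> \<open>Omitting the index k loses nothing because b_kk = 0.\<close>
  define Q where "Q = (\<Prod>i\<in>?S. x i powi pos_part (e * B $$ (i, k)))"
  have Q: "exchange_monomial e x B k = Q"
    unfolding exchange_monomial_def dims split Q_def using B by simp
  have Q0: "Q \<noteq> 0" unfolding Q_def using x by simp
  define x' where "x' = inverse (x k) * (Q * (1 + yhat x B k powi (- e)))"
  have x': "fst (seed_mutation k (x, B)) = x(k := x')"
    unfolding fst_seed_mutation x'_def Q[symmetric]
    using exchange_polynomial_yhat[of B x "- e" k] x e dims by auto
  have "yhat (x(k := x')) (matrix_mutation k B) j =
      x' powi (- B $$ (k, j)) * (\<Prod>i\<in>?S. x i powi (B $$ (i, j) + pos_part (e * B $$ (i, k)) * B $$ (k, j)))"
    unfolding yhat_def dim_matrix_mutation dims split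
    using B km e by (auto simp: matrix_mutation_index dims sgn_mult_pos_part)
  also have "(\<Prod>i\<in>?S. x i powi (B $$ (i, j) + pos_part (e * B $$ (i, k)) * B $$ (k, j))) =
      (\<Prod>i\<in>?S. x i powi B $$ (i, j)) * Q powi B $$ (k, j)"
    unfolding Q_def prod_power_int prod.distrib[symmetric] power_int_mult[symmetric]
    using x by (intro prod.cong) (auto simp: power_int_add)
  also have "x' powi (- B $$ (k, j)) = x k powi B $$ (k, j) * Q powi (- B $$ (k, j)) *
      (1 + yhat x B k powi (- e)) powi (- B $$ (k, j))"
    unfolding x'_def power_int_mult_distrib by (simp add: power_int_minus power_int_inverse)
  finally have "yhat (x(k := x')) (matrix_mutation k B) j =
      (x k powi B $$ (k, j) * (\<Prod>i\<in>?S. x i powi B $$ (i, j))) *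
      (1 + yhat x B k powi (- e)) powi (- B $$ (k, j)) * (Q powi (- B $$ (k, j)) * Q powi B $$ (k, j))"
    by (simp only: mult_ac)
  also have "Q powi (- B $$ (k, j)) * Q powi B $$ (k, j) = 1"
    using Q0 by (simp add: power_int_minus)
  also have "x k powi B $$ (k, j) * (\<Prod>i\<in>?S. x i powi B $$ (i, j)) = yhat x B j"
    unfolding yhat_def dims split ..
  finally show ?thesis unfolding x' mult_1_right .
qed

lemma exchange_monomial_update:
  assumes "B $$ (k, k) = 0" "k < dim_col B"
  shows "exchange_monomial e (x(k := z)) (matrix_mutation k B) k = exchange_monomial (- e) x B k"
  unfolding exchange_monomial_def dim_matrix_mutation
  using assms by (intro prod.cong) (auto simp: matrix_mutation_index)

lemma yhat_mutation_self:
  assumes "B \<in> carrier_mat m n" "k < n" "n \<le> m" "B $$ (k, k) = 0"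
  shows "yhat (fst (seed_mutation k (x, B))) (matrix_mutation k B) k = inverse (yhat x B k)"
  unfolding yhat_def dim_matrix_mutation prod_inversef[symmetric] o_def fst_seed_mutation
  using assms by (intro prod.cong) (auto simp: matrix_mutation_index power_int_minus)

text \<open>Positivity is demanded at all indices, not only below \<open>m\<close>, which spares
  range conditions on the cluster.\<close>

definition positive_seed :: "(nat \<Rightarrow> int) \<Rightarrow> nat \<Rightarrow> nat \<Rightarrow> (nat \<Rightarrow> ratfun) \<times> int mat \<Rightarrow> bool" where
  "positive_seed d m n s \<longleftrightarrow> n \<le> m \<and> (\<forall>i. fst s i \<in> pos) \<and> snd s \<in> carrier_mat m n \<and> skew_symmetrizer d n (snd s)"

lemma exchange_monomial_pos: "(\<And>i. x i \<in> pos) \<Longrightarrow> exchange_monomial e x B k \<in> pos"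
  unfolding exchange_monomial_def by (intro pos_prod pos_power_int)

lemma positive_seed_mutation:
  assumes "positive_seed d m n s" "k < n"
  shows "positive_seed d m n (seed_mutation k s)"
proof -
  obtain x B where s: "s = (x, B)" by fastforce
  show ?thesis
    using assms unfolding positive_seed_def s fst_seed_mutation
    by (auto intro!: pos_mult pos_inverse pos_add exchange_monomial_pos skew_symmetrizer_mutation)
qed

lemma positive_seed_fold:
  "positive_seed d m n s \<Longrightarrow> set w \<subseteq> {..<n} \<Longrightarrow> positive_seed d m n (fold seed_mutation w s)"
  by (induction w arbitrary: s) (simp_all add: positive_seed_mutation)

text \<open>Mutation interchanges the two monomials of the exchange polynomial \<open>E\<close>, and
  x_k does not occur in them. The second mutation therefore divides \<open>E\<close> by x_k^-1
  \<open>E\<close>.\<close>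

lemma seed_mutation_involution:
  assumes "positive_seed d m n s" "k < n"
  shows "seed_mutation k (seed_mutation k s) = s"
proof -
  obtain x B where s: "s = (x, B)" by fastforce
  have B: "B \<in> carrier_mat m n" "n \<le> m" "skew_symmetrizer d n B" and x: "\<And>i. x i \<in> pos"
    using assms(1) by (auto simp: positive_seed_def s)
  have diag: "B $$ (k, k) = 0" using skew_symmetrizer_diag B(3) assms(2) .
  have kc: "k < dim_col B" "k < dim_row B" using B assms(2) by auto
  define E where "E = exchange_monomial 1 x B k + exchange_monomial (-1) x B k"
  have "E \<noteq> 0" "x k \<noteq> 0"
    unfolding E_def by (intro pos_nonzero pos_add exchange_monomial_pos x)+
  then show ?thesis
    using exchange_monomial_update[of B k _ x _, OF diag kc(1)] matrix_mutation_involution[OF kc(2,1)]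
    by (simp add: s seed_mutation_eq E_def[symmetric] add.commute mult.assoc)
qed

section \<open>The seed pattern\<close>

text \<open>Every vertex is joined to the empty word by deleting letters, so the path descends from
  \<open>t0\<close> to the empty word and climbs to \<open>t\<close>.\<close>

lemma tree_connected:
  assumes "t0 \<in> tree_vertices n" "t \<in> tree_vertices n" "P t0"
    and step: "\<And>k s s'. tree_edge n k s s' \<Longrightarrow> P s \<Longrightarrow> P s'"
  shows "P t"
proof -
  have vertex: "s \<in> tree_vertices n" if "k # s \<in> tree_vertices n" for k s
    using that by (auto simp: tree_vertices_def dest: distinct_adj_ConsD)
  have "P []" using assms(1,3)
  proof (induction t0)
    case (Cons k s)
    then show ?case using vertex[OF Cons.prems(1)] step[of k "k # s" s] by (auto simp: tree_edge_def)
  qed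
  then show ?thesis using assms(2)
  proof (induction t)
    case (Cons k s)
    then show ?case using vertex[OF Cons.prems(2)] step[of k s "k # s"] by (auto simp: tree_edge_def)
  qed
qed

text \<open>The word \<open>t0 @ rev t\<close> lists the edge labels on the way from
  \<open>t0\<close> to the empty word and on to \<open>t\<close>. The path may backtrack, which is
  harmless because mutation is an involution.\<close>

definition pattern :: "int mat \<Rightarrow> nat list \<Rightarrow> nat list \<Rightarrow> (nat \<Rightarrow> ratfun) \<times> int mat" where
  "pattern B t0 t = fold seed_mutation (t0 @ rev t) (ratvar, B)"

lemma positive_seed_initial:
  "n \<le> m \<Longrightarrow> B \<in> carrier_mat m n \<Longrightarrow> skew_symmetrizer d n B \<Longrightarrow> positive_seed d m n (ratvar, B)"
  by (simp add: positive_seed_def pos_ratvar)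

lemma pattern_initial:
  assumes "positive_seed d m n s" "set t0 \<subseteq> {..<n}"
  shows "fold seed_mutation (t0 @ rev t0) s = s"
  using assms
proof (induction t0 arbitrary: s)
  case (Cons k w)
  have "fold seed_mutation (rev w) (fold seed_mutation w (seed_mutation k s)) = seed_mutation k s"
    using Cons positive_seed_mutation[of d m n s k] by simp
  then show ?case using Cons.prems seed_mutation_involution[of d m n s k] by simp
qed simp

lemma pattern_edge:
  assumes "positive_seed d m n (ratvar, B)" "t0 \<in> tree_vertices n" "tree_edge n k t t'"
  shows "pattern B t0 t' = seed_mutation k (pattern B t0 t)"
proof -
  have *: "positive_seed d m n (pattern B t0 s)" if "s \<in> tree_vertices n" for s
    unfolding pattern_def using assms(2) that
    by (intro positive_seed_fold[OF assms(1)]) (auto simp: tree_vertices_def)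
  from assms(3) consider "t' = k # t" | "t = k # t'" "t' \<in> tree_vertices n" "k < n"
    by (auto simp: tree_edge_def tree_vertices_def)
  then show ?thesis
  proof cases
    case 2
    then show ?thesis using seed_mutation_involution[OF *] by (auto simp: pattern_def)
  qed (simp add: pattern_def)
qed

text \<open>Seeds are forced along edges starting from \<open>t0\<close>, so cluster patterns agree
  on the tree and the definite description has exactly one candidate.\<close>

lemma cluster_variable_pattern:
  assumes "positive_seed d m n (ratvar, B)" "t0 \<in> tree_vertices n" "t \<in> tree_vertices n"
  shows "cluster_variable B t0 t j = fst (pattern B t0 t) j"
proof -
  have n: "dim_col B = n" using assms(1) by (auto simp: positive_seed_def)
  have ex: "cluster_pattern B t0 (pattern B t0)"
    unfolding cluster_pattern_def n
    using pattern_edge[OF assms(1,2)] pattern_initial[OF assms(1)] assms(2)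
    by (auto simp: pattern_def tree_vertices_def)
  have "S t = pattern B t0 t" if S: "cluster_pattern B t0 S" for S
    using assms(2,3)
  proof (rule tree_connected)
    show "S t0 = pattern B t0 t0" using S ex by (simp add: cluster_pattern_def)
    fix k s s' assume "tree_edge n k s s'" "S s = pattern B t0 s"
    then show "S s' = pattern B t0 s'" using S ex by (simp add: cluster_pattern_def n)
  qed
  then have "z = fst (pattern B t0 t) j"
    if "\<exists>S. cluster_pattern B t0 S \<and> z = fst (S t) j" for z using that by metis
  then show ?thesis unfolding cluster_variable_def using ex by (intro the_equality) blast+
qed

section \<open>Specialization of seeds\<close>

lemma ev_exchange_monomial:
  assumes "\<And>i. i < dim_row B \<Longrightarrow> ev y (x i) (z i)"
  shows "ev y (exchange_monomial e x B k) (exchange_monomial e z B k)"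
  unfolding exchange_monomial_def
  using assms by (intro ev_prod) (auto simp: power_int_nonneg_exp intro!: ev.ext_power)

text \<open>The values are rational functions that undergo the same mutations. They remain in
  \<open>pos\<close>, so every x_k that is inverted has a nonzero value.\<close>

lemma ev_fold_seed_mutation:
  fixes z :: "nat \<Rightarrow> ratfun"
  assumes "\<And>i. ev y (x i) (z i)" "\<And>i. z i \<in> pos"
  shows "ev y (fst (fold seed_mutation w (x, B)) i) (fst (fold seed_mutation w (z, B)) i)"
  using assms
proof (induction w arbitrary: x z B)
  case (Cons k w)
  define x1 z1 where "x1 = fst (seed_mutation k (x, B))" and "z1 = fst (seed_mutation k (z, B))"
  have "ev y (x1 i) (z1 i)" for i
    unfolding x1_def z1_def fst_seed_mutation using Cons.prems
    by (auto intro!: ev_mult ev.ext_inverse ev.ext_add ev_exchange_monomial pos_nonzero)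
  moreover have "z1 i \<in> pos" for i
    unfolding z1_def fst_seed_mutation using Cons.prems
    by (auto intro!: pos_mult pos_inverse pos_add exchange_monomial_pos)
  moreover have "seed_mutation k (x, B) = (x1, matrix_mutation k B)"
    "seed_mutation k (z, B) = (z1, matrix_mutation k B)"
    by (simp_all add: prod_eq_iff x1_def z1_def)
  ultimately show ?case using Cons.IH by simp
qed simp

section \<open>The Laurent phenomenon\<close>

text \<open>
  Elements of \<open>subring G\<close> that vanish at \<open>y\<close> are divisible by \<open>p\<close>, so \<open>p\<close> cannot occur in
  the denominator of a rational function regular at \<open>y\<close>.
\<close>

lemma regular_division:
  assumes gens: "\<And>g. g \<in> G \<Longrightarrow> \<exists>s h. ev y g s \<and> s \<in> subring G \<and> h \<in> subring G \<and> g - s = p * h"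
    and p: "p \<noteq> 0" "ev y p 0" and f: "ev y f r" and N: "f * p ^ N \<in> subring G"
  shows "f \<in> subring G"
proof -
  \<comment> \<open>Being congruent modulo \<open>p\<close> to one's own value passes from the
    generators to differences and products; the value is again an element of the subring.\<close>
  have residue: "\<exists>s h. ev y a s \<and> s \<in> subring G \<and> h \<in> subring G \<and> a - s = p * h" if "a \<in> subring G" for a
    using that
  proof induction
    case (base g)
    then show ?case by (rule gens)
  next
    case one
    show ?case
      by (rule exI[of _ 1], rule exI[of _ 0]) (simp add: ev.ext_1 subring.one subring_0)
  next
    case (diff a b)
    then obtain s h s' h' where *: "ev y a s" "s \<in> subring G" "h \<in> subring G" "a - s = p * h"
      "ev y b s'" "s' \<in> subring G" "h' \<in> subring G" "b - s' = p * h'" by blast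
    have "a - b - (s - s') = p * (h - h')" using *(4,8) by (simp add: algebra_simps)
    then show ?case using * ev.ext_diff subring.diff by blast
  next
    case (mult a b)
    then obtain s h s' h' where *: "ev y a s" "s \<in> subring G" "h \<in> subring G" "a - s = p * h"
      "ev y b s'" "s' \<in> subring G" "h' \<in> subring G" "b - s' = p * h'" by blast
    have "a * b - s * s' = (a - s) * b + s * (b - s')" by (simp add: algebra_simps)
    also have "\<dots> = p * (h * b + s * h')" unfolding *(4,8) by (simp add: algebra_simps)
    finally have "a * b - s * s' = p * (h * b + s * h')" .
    moreover have "h * b + s * h' \<in> subring G" using * mult by (intro subring_add subring.mult)
    moreover have "s * s' \<in> subring G" using * by (intro subring.mult)
    moreover have "ev y (a * b) (s * s')" using * by (intro ev_mult)
    ultimately show ?case by blast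
  qed
  show ?thesis using N
  proof (induction N)
    case (Suc N)
    obtain s h where *: "ev y (f * p ^ Suc N) s" "h \<in> subring G" "f * p ^ Suc N - s = p * h"
      using residue[OF Suc.prems] by blast
    \<comment> \<open>Regularity of \<open>f\<close> makes the value zero, so the residue vanishes
      and one factor \<open>p\<close> splits off.\<close>
    have "ev y (f * p ^ Suc N) (r * 0 ^ Suc N)" by (intro ev_mult ev.ext_power f p)
    with *(1) have "s = 0" using ev.ext_unique by fastforce
    with *(3) have "p * (f * p ^ N) = p * h" by (simp add: algebra_simps)
    with p(1) have "f * p ^ N = h" by simp
    with *(2) Suc.IH show ?case by simp
  qed simp
qed

lemma subring_denominator:
  assumes gens: "\<And>g. g \<in> G \<Longrightarrow> \<exists>N. g * p ^ N \<in> subring H" and p: "p \<in> subring H" and f: "f \<in> subring G"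
  shows "\<exists>N. f * p ^ N \<in> subring H"
  using f
proof induction
  case (base g)
  then show ?case by (rule gens)
next
  case one
  show ?case by (intro exI[of _ 0]) (simp add: subring.one)
next
  case (diff a b)
  then obtain M N where *: "a * p ^ M \<in> subring H" "b * p ^ N \<in> subring H" by blast
  have "p ^ k \<in> subring H" for k using p by (rule subring_power)
  note subring.diff[OF subring.mult[OF *(1) this[of N]] subring.mult[OF *(2) this[of M]]]
  then show ?case by (intro exI[of _ "M + N"]) (simp add: power_add algebra_simps)
next
  case (mult a b)
  then obtain M N where "a * p ^ M \<in> subring H" "b * p ^ N \<in> subring H" by blast
  then have "a * p ^ M * (b * p ^ N) \<in> subring H" by (rule subring.mult)
  then show ?case by (intro exI[of _ "M + N"]) (simp add: power_add mult_ac)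
qed

lemma laurent_ring_closed:
  "0 \<in> laurent_ring m J x" "1 \<in> laurent_ring m J x"
  "a \<in> laurent_ring m J x \<Longrightarrow> b \<in> laurent_ring m J x \<Longrightarrow> a + b \<in> laurent_ring m J x"
  "a \<in> laurent_ring m J x \<Longrightarrow> b \<in> laurent_ring m J x \<Longrightarrow> a - b \<in> laurent_ring m J x"
  "a \<in> laurent_ring m J x \<Longrightarrow> - a \<in> laurent_ring m J x"
  "a \<in> laurent_ring m J x \<Longrightarrow> b \<in> laurent_ring m J x \<Longrightarrow> a * b \<in> laurent_ring m J x"
  "a \<in> laurent_ring m J x \<Longrightarrow> a ^ k \<in> laurent_ring m J x"
  unfolding laurent_ring_def
  by (fact subring_0 subring.one subring_add subring.diff subring_uminus subring.mult subring_power)+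

lemma laurent_ring_power_int:
  "i < m \<Longrightarrow> i \<in> J \<Longrightarrow> x i powi c \<in> laurent_ring m J x"
  using laurent_ring_var[of i m x J] laurent_ring_inverse[of i J x m]
  unfolding laurent_ring_def by (intro subring_power_int)

lemma laurent_ring_prod:
  "(\<And>i. i \<in> I \<Longrightarrow> f i \<in> laurent_ring m J x) \<Longrightarrow> prod f I \<in> laurent_ring m J x"
  unfolding laurent_ring_def by (rule subring_prod)

text \<open>The units of the local ring at the point \<open>y\<close>.\<close>

definition ev_unit :: "(nat \<Rightarrow> 'k::field) \<Rightarrow> ratfun set" where
  "ev_unit y = {r. \<exists>s. ev y r s \<and> s \<noteq> 0}"

lemma ev_unitI: "ev y r s \<Longrightarrow> s \<noteq> 0 \<Longrightarrow> r \<in> ev_unit y"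
  unfolding ev_unit_def by blast

lemma ev_unit_mult: "a \<in> ev_unit y \<Longrightarrow> b \<in> ev_unit y \<Longrightarrow> a * b \<in> ev_unit y"
  unfolding ev_unit_def using ev_mult by fastforce

lemma ev_unit_inverse: "a \<in> ev_unit y \<Longrightarrow> inverse a \<in> ev_unit y"
  unfolding ev_unit_def using ev.ext_inverse by fastforce

lemma ev_unit_uminus: "a \<in> ev_unit y \<Longrightarrow> - a \<in> ev_unit y"
  unfolding ev_unit_def using ev.ext_uminus by fastforce

lemma ev_unit_of_nat: "c \<noteq> 0 \<Longrightarrow> of_nat c \<in> ev_unit (y :: nat \<Rightarrow> ratfun)"
  using ev.ext_of_nat[of y c] of_int_ratfun_eq_0_iff[of "int c"] by (auto intro!: ev_unitI)

lemma ev_unit_ratvar: "y i \<noteq> 0 \<Longrightarrow> ratvar i \<in> ev_unit y"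
  using ev_ratvar by (rule ev_unitI)

text \<open>Factors with exponent zero are exempt, so a variable that vanishes at \<open>y\<close>
  may still range over the index set.\<close>

lemma ev_unit_prod_power_int:
  "(\<And>i. i \<in> I \<Longrightarrow> c i \<noteq> 0 \<Longrightarrow> f i \<in> ev_unit y) \<Longrightarrow> (\<Prod>i\<in>I. f i powi c i) \<in> ev_unit y"
proof (induction I rule: infinite_finite_induct)
  case (insert i I)
  have "f i powi c i \<in> ev_unit y"
  proof (cases "c i = 0")
    case True
    then show ?thesis using ev_unitI[OF ev.ext_1, of y] by simp
  next
    case False
    with insert.prems obtain s where "ev y (f i) s" "s \<noteq> 0" unfolding ev_unit_def by blast
    then show ?thesis using ev_unitI[OF ev.ext_power_int[of y "f i" s "c i"]] by simp
  qed
  with insert show ?case by (simp add: ev_unit_mult)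
qed (simp_all add: ev_unitI[OF ev.ext_1])

text \<open>
  The row \<open>z\<close> makes the first exchange polynomial \<open>P = x\<^sub>z A + A'\<close> linear in the frozen variable
  \<open>x\<^sub>z\<close>. At the generic zero of \<open>P\<close> the clusters at distance \<open>0\<close> and \<open>3\<close> are regular and
  nonvanishing, while \<open>P\<close> is the only new denominator at distance \<open>1\<close>.
\<close>

lemma laurent_step:
  fixes B :: "int mat"
  assumes seed: "positive_seed d m n (ratvar, B)" and jk: "j < n" "k < n" "j \<noteq> k"
    and z: "z < m" "n \<le> z" "B $$ (z, j) = 1" "B $$ (z, k) = 0"
  defines "s1 \<equiv> seed_mutation j (ratvar, B)"
  defines "s2 \<equiv> seed_mutation k s1"
  defines "s3 \<equiv> seed_mutation j s2"
  assumes f1: "f \<in> laurent_ring m {..<m} (fst s1)" and f3: "f \<in> laurent_ring m {..<m} (fst s3)"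
  shows "f \<in> laurent_ring m {..<m} ratvar"
proof -
  let ?L = "laurent_ring m {..<m} ratvar"
  have nm: "n \<le> m" and B: "B \<in> carrier_mat m n" and skew: "skew_symmetrizer d n B"
    using seed by (auto simp: positive_seed_def)
  have jm: "j < m" "k < m" "j \<noteq> z" "k \<noteq> z" using jk nm z by auto
  define P where "P = exchange_monomial 1 ratvar B j + exchange_monomial (-1) ratvar B j"
  define A where "A = (\<Prod>i\<in>{..<m} - {z}. ratvar i powi pos_part (B $$ (i, j)))"
  define A' where "A' = exchange_monomial (-1) ratvar B j"
  have dims: "dim_row B = m" "dim_col B = n" using B by auto
  have P: "P = ratvar z * A + A'"
  proof -
    have "exchange_monomial 1 ratvar B j = ratvar z powi pos_part (B $$ (z, j)) * A"
      unfolding exchange_monomial_def A_def using z(1) by (simp add: dims prod.remove)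
    then show ?thesis unfolding P_def A'_def by (simp add: z pos_part_def)
  qed
  have A'_alt: "A' = (\<Prod>i\<in>{..<m} - {z}. ratvar i powi pos_part (- B $$ (i, j)))"
    unfolding A'_def exchange_monomial_def using z(1,3) by (simp add: dims prod.remove pos_part_def)
  \<comment> \<open>All coordinates but one are the variables themselves; the coordinate
    \<open>z\<close> is the solution of x_z A + A' = 0.\<close>
  define y where "y = ratvar(z := - A' / A)"
  have pos: "A \<in> pos" "A' \<in> pos" "P \<in> pos"
    unfolding A_def A'_def P_def by (intro pos_add exchange_monomial_pos pos_prod pos_power_int pos_ratvar)+
  then have nz: "A \<noteq> 0" "A' \<noteq> 0" "P \<noteq> 0" using pos_nonzero by auto
  have y: "y i \<noteq> 0" for i unfolding y_def using nz by simp
  have yi: "i \<noteq> z \<Longrightarrow> y i = ratvar i" for i by (simp add: y_def)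
  have unit_var: "ratvar i \<in> ev_unit y" for i using y by (rule ev_unit_ratvar)
  \<comment> \<open>Neither \<open>A\<close> nor \<open>A'\<close> contains x_z, the latter because
    b_zj = 1 has negative part zero; hence both are their own values.\<close>
  have ev_A: "ev y A A" and ev_A': "ev y A' A'"
    unfolding A_def A'_alt using ev_ratvar[of y] y
    by (intro ev_prod ev.ext_power_int, metis yi DiffE insertI1, simp)+
  have evP: "ev y P 0"
  proof -
    have "ev y P (y z * A + A')" unfolding P by (intro ev.ext_add ev_mult ev_ratvar ev_A ev_A')
    then show ?thesis using nz by (simp add: y_def)
  qed

  define x3 where "x3 = inverse (ratvar j) * P"
  define x1 where "x1 = ratvar(j := x3)"
  define B1 where "B1 = matrix_mutation j B"
  have s1: "s1 = (x1, B1)" unfolding s1_def seed_mutation_eq x1_def x3_def B1_def P_def ..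
  have seed1: "positive_seed d m n (x1, B1)"
    unfolding s1[symmetric] s1_def by (rule positive_seed_mutation[OF seed jk(1)])
  then have B1: "B1 \<in> carrier_mat m n" "skew_symmetrizer d n B1" and x1_pos: "x1 i \<in> pos" for i
    by (auto simp: positive_seed_def)
  have x1_nz: "x1 i \<noteq> 0" for i using x1_pos pos_nonzero by blast
  have x3_nz: "x3 \<noteq> 0" using x1_nz[of j] by (simp add: x1_def)
  have ev3: "ev y x3 0"
    unfolding x3_def using ev_mult[OF ev.ext_inverse[OF ev_ratvar[of y j] y] evP] by simp
  have dims1: "dim_row B1 = m" "dim_col B1 = n" using B1 by auto
  \<comment> \<open>\<open>e\<close> is a sign of b_kj after the first mutation, \<open>c\<close>
    and \<open>g\<close> are the absolute values of b_kj and b_jk. They vanish together by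
    skew-symmetrizability.\<close>
  define e :: int where "e = (if B1 $$ (k, j) \<ge> 0 then 1 else -1)"
  have e: "e = 1 \<or> e = -1" "e * B1 $$ (k, j) \<ge> 0" by (auto simp: e_def)
  then have me: "- e = 1 \<or> - e = -1" by auto
  define c where "c = nat (e * B1 $$ (k, j))"
  define g where "g = nat (- e * B1 $$ (j, k))"
  have sg: "sgn (B1 $$ (j, k)) = - sgn (B1 $$ (k, j))"
    using skew_symmetrizer_sgn[OF B1(2) jk(2,1)] .
  then have g: "int g = - e * B1 $$ (j, k)" and gc: "g = 0 \<longleftrightarrow> c = 0" and c: "int c = e * B1 $$ (k, j)"
    unfolding g_def c_def e_def by (auto simp: sgn_if split: if_splits)
  \<comment> \<open>The exponent \<open>- e\<close> makes x3, which vanishes at \<open>y\<close>,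
    occur in \<open>Y\<close> with the nonnegative exponent \<open>g\<close>.\<close>
  define Y where "Y = yhat x1 B1 k powi (- e)"
  define mon where "mon = (\<Prod>i\<in>{..<m} - {j}. ratvar i powi (- e * B1 $$ (i, k)))"
  have Y: "Y = x3 ^ g * mon"
  proof -
    have "Y = (\<Prod>i<m. x1 i powi (- e * B1 $$ (i, k)))"
      unfolding Y_def yhat_def dims1 prod_power_int power_int_mult[symmetric]
      by (simp add: mult.commute)
    also have "\<dots> = x1 j powi (- e * B1 $$ (j, k)) * mon"
      unfolding mon_def using jm(1) by (simp add: prod.remove x1_def)
    finally show ?thesis unfolding g[symmetric] by (simp add: x1_def)
  qed
  have mon_unit: "mon \<in> ev_unit y" unfolding mon_def by (intro ev_unit_prod_power_int unit_var)
  \<comment> \<open>For this choice of sign x3 has exponent zero in the factored monomial, so the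
    monomial is a unit at \<open>y\<close>.\<close>
  define M4 where "M4 = exchange_monomial e x1 B1 k"
  define x4 where "x4 = inverse (ratvar k) * (M4 * (1 + Y))"
  have M4_unit: "M4 \<in> ev_unit y"
    unfolding M4_def exchange_monomial_def
  proof (intro ev_unit_prod_power_int)
    fix i assume "i \<in> {..<dim_row B1}" "pos_part (e * B1 $$ (i, k)) \<noteq> 0"
    moreover have "pos_part (e * B1 $$ (j, k)) = 0"
      using g by (simp add: pos_part_def)
    ultimately show "x1 i \<in> ev_unit y" using unit_var by (auto simp: x1_def)
  qed
  define B2 where "B2 = matrix_mutation k B1"
  define x2 where "x2 = x1(k := x4)"
  have s2: "s2 = (x2, B2)"
  proof -
    have "exchange_monomial 1 x1 B1 k + exchange_monomial (-1) x1 B1 k = M4 * (1 + Y)"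
      unfolding M4_def Y_def using exchange_polynomial_yhat[of B1 x1 "- e" k] x1_nz me by simp
    then show ?thesis
      unfolding s2_def s1 seed_mutation_eq x2_def B2_def x4_def using jk(3) by (simp add: x1_def)
  qed
  \<comment> \<open>If g > 0, then \<open>Y\<close> vanishes at \<open>y\<close> and the value is 1.
    If g = 0, the zero in row \<open>z\<close>, column \<open>k\<close> survives the mutation at
    \<open>j\<close>, so \<open>Y\<close> is free of x_z and 1 + \<open>Y\<close> is its own,
    positive value.\<close>
  have "1 + Y \<in> ev_unit y"
  proof (cases "g = 0")
    case True
    have "B1 $$ (j, k) = 0" using g True e(1) by auto
    then have "B $$ (j, k) = 0" unfolding B1_def using jk jm B by (simp add: matrix_mutation_index)
    then have "B1 $$ (z, k) = 0"
      unfolding B1_def using z jk jm B by (simp add: matrix_mutation_index)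
    then have "ev y (ratvar i powi (- e * B1 $$ (i, k))) (ratvar i powi (- e * B1 $$ (i, k)))" for i
      using ev.ext_power_int[OF ev_ratvar[of y i] y[of i], of "- e * B1 $$ (i, k)"] ev.ext_1[of y]
      by (cases "i = z") (simp_all add: yi)
    then have "ev y mon mon" unfolding mon_def by (intro ev_prod)
    moreover have "1 + mon \<in> pos"
      unfolding mon_def by (intro pos_add pos_1 pos_prod pos_power_int pos_ratvar)
    ultimately show ?thesis
      using ev_unitI[OF ev.ext_add[OF ev.ext_1], of y mon mon] pos_nonzero[of "1 + mon"] Y True by simp
  next
    case False
    obtain v where "ev y mon v" using mon_unit unfolding ev_unit_def by blast
    then have "ev y Y (0 ^ g * v)" unfolding Y by (intro ev_mult ev.ext_power ev3)
    then show ?thesis using False ev_unitI[OF ev.ext_add[OF ev.ext_1], of y Y 0] by (simp add: zero_power)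
  qed
  then have x4_unit: "x4 \<in> ev_unit y"
    unfolding x4_def by (intro ev_unit_mult ev_unit_inverse unit_var M4_unit)
  have seed2: "positive_seed d m n (x2, B2)"
    unfolding s2[symmetric] s2_def s1 by (rule positive_seed_mutation[OF seed1 jk(2)])
  then have B2: "B2 \<in> carrier_mat m n" "skew_symmetrizer d n B2" and x2_pos: "x2 i \<in> pos" for i
    by (auto simp: positive_seed_def)
  have x2_nz: "x2 i \<noteq> 0" for i using x2_pos pos_nonzero by blast

  \<comment> \<open>In terms of \<open>y0\<close> the exchange polynomial is \<open>Pm\<close> (1 +
    y0), so where \<open>P\<close> vanishes \<open>y0\<close> takes the value -1. \<open>Q\<close>
    is the geometric sum with (1 + Y)^c = 1 + Y Q.\<close>
  define y0 where "y0 = yhat ratvar B j powi e"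
  define Q where "Q = (\<Sum>i<c. (1 + Y) ^ i)"
  define M5 where "M5 = exchange_monomial e x2 B2 j"
  define Pm where "Pm = exchange_monomial (- e) ratvar B j"
  define x5 where "x5 = inverse x3 * (M5 * (1 + y0 * (1 + Y * Q)))"
  have M5_unit: "M5 \<in> ev_unit y"
    unfolding M5_def exchange_monomial_def
  proof (intro ev_unit_prod_power_int)
    fix i assume "i \<in> {..<dim_row B2}" "pos_part (e * B2 $$ (i, j)) \<noteq> 0"
    moreover have "pos_part (e * B2 $$ (j, j)) = 0"
      using skew_symmetrizer_diag[OF B2(2) jk(1)] by simp
    ultimately show "x2 i \<in> ev_unit y" using unit_var x4_unit by (auto simp: x2_def x1_def)
  qed
  have Pm_nz: "Pm \<noteq> 0" unfolding Pm_def by (intro exchange_monomial_nonzero) simp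
  have Pm: "P = Pm * (1 + y0)"
    unfolding P_def Pm_def y0_def by (intro exchange_polynomial_yhat e) simp
  \<comment> \<open>Mutation at \<open>j\<close> inverts the y-hat of index \<open>j\<close>,
    mutation at \<open>k\<close> multiplies it by a power of 1 + Y; raising to \<open>- e\<close>
    turns this power into (1 + Y)^c.\<close>
  have yhat2: "yhat x2 B2 j powi (- e) = y0 * (1 + Y * Q)"
  proof -
    have "yhat x2 B2 j = yhat x1 B1 j * (1 + Y) powi (- B1 $$ (k, j))"
      using yhat_mutation[of B1 m n k j x1 e, OF B1(1) jk(2) nm jk(1,3) skew_symmetrizer_diag[OF B1(2) jk(2)] x1_nz e]
      unfolding Y_def s2[unfolded s2_def s1] B2_def fst_conv .
    moreover have "yhat x1 B1 j = inverse (yhat ratvar B j)"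
      using yhat_mutation_self[OF B jk(1) nm skew_symmetrizer_diag[OF skew jk(1)], of ratvar]
      unfolding s1[unfolded s1_def] B1_def fst_conv .
    ultimately have "yhat x2 B2 j powi (- e) = y0 * ((1 + Y) powi (- B1 $$ (k, j))) powi (- e)"
      unfolding y0_def by (simp add: power_int_mult_distrib power_int_minus power_int_inverse)
    also have "((1 + Y) powi (- B1 $$ (k, j))) powi (- e) = (1 + Y) ^ c"
      unfolding power_int_mult[symmetric] by (simp add: mult.commute flip: c)
    also have "(1 + Y) ^ c = 1 + Y * Q"
      using power_diff_1_eq[of "1 + Y" c] unfolding Q_def by (simp add: algebra_simps)
    finally show ?thesis .
  qed
  have s3: "fst s3 = x2(j := x5)"
  proof -
    have "exchange_monomial 1 x2 B2 j + exchange_monomial (-1) x2 B2 j = M5 * (1 + y0 * (1 + Y * Q))"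
      unfolding M5_def yhat2[symmetric] using exchange_polynomial_yhat[of B2 x2 "- e" j] x2_nz me by simp
    moreover have "x2 j = x3" using jk(3) by (simp add: x2_def x1_def)
    ultimately show ?thesis unfolding s3_def s2 fst_seed_mutation x5_def by simp
  qed
  have Pm_unit: "Pm \<in> ev_unit y"
    unfolding Pm_def exchange_monomial_def by (intro ev_unit_prod_power_int unit_var)
  \<comment> \<open>The denominator x3 vanishes at \<open>y\<close> and has to be divided out: 1 +
    y0 is divisible by it through \<open>P\<close>, and Y / x3 is harmless when g > 0. When g = 0,
    also c = 0 and the term with \<open>Q\<close> disappears.\<close>
  have x5_split: "x5 = M5 * (ratvar j / Pm + y0 * (Y / x3) * Q)"
  proof -
    have "1 + y0 = x3 * ratvar j / Pm" using Pm Pm_nz by (simp add: x3_def field_simps)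
    then have "1 + y0 * (1 + Y * Q) = x3 * (ratvar j / Pm + y0 * (Y / x3) * Q)"
      using x3_nz by (simp add: algebra_simps add_divide_distrib)
    then show ?thesis unfolding x5_def using x3_nz by simp
  qed
  have x5_unit: "x5 \<in> ev_unit y"
  proof (cases "g = 0")
    case True
    then have "Q = 0" unfolding Q_def using gc by simp
    then have "x5 = M5 * (ratvar j * inverse Pm)" unfolding x5_split by (simp add: field_simps)
    then show ?thesis by (simp add: ev_unit_mult M5_unit unit_var ev_unit_inverse Pm_unit)
  next
    case False
    then obtain h where h: "g = Suc h" by (cases g) auto
    define v where "v = (\<Prod>i\<in>{..<m} - {j}. y i powi (- e * B1 $$ (i, k)))"
    define u where "u = exchange_monomial (- e) y B j"
    have v: "ev y mon v" "v \<noteq> 0"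
      unfolding mon_def v_def using y by (auto intro!: ev_prod ev.ext_power_int ev_ratvar)
    have u: "ev y Pm u" "u \<noteq> 0"
      unfolding Pm_def u_def using y by (auto intro!: ev_exchange_monomial ev_ratvar exchange_monomial_nonzero)
    have "ev y Y (0 ^ g * v)" unfolding Y by (intro ev_mult ev.ext_power ev3 v)
    then have "ev y Y 0" by (simp add: h)
    then have "ev y Q (\<Sum>i<c. (1 + 0) ^ i)"
      unfolding Q_def by (intro ev.ext_sum ev.ext_power ev.ext_add ev.ext_1)
    then have evQ: "ev y Q (of_nat c)" by simp
    have "ev y (1 + y0) (0 / u)"
      using ev_divide[OF evP u] Pm Pm_nz by simp
    then have "ev y (1 + y0 - 1) (0 / u - 1)" by (intro ev.ext_diff ev.ext_1)
    then have evy0: "ev y y0 (- 1)" by simp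
    have "Y / x3 = x3 ^ h * mon" unfolding Y h using x3_nz by simp
    then have evYx: "ev y (Y / x3) (0 ^ h * v)" by (auto intro!: ev_mult ev.ext_power ev3 v)
    define val where "val = ratvar j / u + (- 1) * (0 ^ h * v) * of_nat c"
    have evx: "ev y (ratvar j / Pm + y0 * (Y / x3) * Q) val"
      unfolding val_def using ev_ratvar[of y j] yi[OF jm(3)]
      by (intro ev.ext_add ev_mult ev_divide u evy0 evYx evQ) auto
    have "val \<noteq> 0"
    proof (cases h)
      case 0
      \<comment> \<open>A vanishing value would mean x_j = u v c. Neither u nor v involves x_j, so
        the right side is a unit at x_j = 0 while the left side vanishes there.\<close>
      define y2 where "y2 = ratvar(j := 0)"
      have y2_unit: "y i \<in> ev_unit y2" if "i \<noteq> j" for i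
      proof (cases "i = z")
        case True
        have "B $$ (j, j) = 0" by (rule skew_symmetrizer_diag[OF skew jk(1)])
        moreover have "(\<Prod>i\<in>I. ratvar i powi pos_part (b i)) \<in> ev_unit y2" if "b j = 0" for I b
        proof (rule ev_unit_prod_power_int)
          fix i assume "pos_part (b i) \<noteq> 0"
          with that have "i \<noteq> j" by auto
          then show "ratvar i \<in> ev_unit y2" by (intro ev_unit_ratvar) (simp add: y2_def)
        qed
        ultimately have "A \<in> ev_unit y2" "A' \<in> ev_unit y2" unfolding A_def A'_alt by simp_all
        then show ?thesis
          unfolding True y_def using ev_unit_uminus[OF ev_unit_mult[OF _ ev_unit_inverse]]
          by (simp add: field_simps)
      qed (use that in \<open>auto simp: yi y2_def intro!: ev_unit_ratvar\<close>)
      have "v \<in> ev_unit y2"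
        unfolding v_def by (intro ev_unit_prod_power_int y2_unit) auto
      moreover have "u \<in> ev_unit y2"
        unfolding u_def exchange_monomial_def
        using skew_symmetrizer_diag[OF skew jk(1)] by (intro ev_unit_prod_power_int y2_unit) auto
      moreover have "of_nat c \<in> ev_unit y2" using False gc by (intro ev_unit_of_nat) auto
      ultimately have "u * v * of_nat c \<in> ev_unit y2" by (intro ev_unit_mult)
      moreover have "ratvar j = u * v * of_nat c" if "val = 0"
        using that u(2) unfolding val_def 0 by (simp add: field_simps)
      moreover have "ratvar j \<notin> ev_unit y2"
        using ev_ratvar[of y2 j] ev.ext_unique[of y2 "ratvar j"] unfolding ev_unit_def y2_def by auto
      ultimately show ?thesis by metis
    next
      case (Suc h')
      then show ?thesis using u by (simp add: val_def)
    qed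
    then have "ratvar j / Pm + y0 * (Y / x3) * Q \<in> ev_unit y" using evx by (intro ev_unitI)
    then show ?thesis unfolding x5_split by (intro ev_unit_mult M5_unit)
  qed

  have mono_L: "(\<Prod>i\<in>I. ratvar i powi c i) \<in> ?L" if "I \<subseteq> {..<m}" for I c
    using that by (intro laurent_ring_prod laurent_ring_power_int) auto
  have AL: "A \<in> ?L" "A' \<in> ?L" "inverse A \<in> ?L" "inverse A' \<in> ?L"
    unfolding A_def A'_alt prod_inversef[symmetric] o_def power_int_minus[symmetric]
    by (intro mono_L; force)+
  have zL: "ratvar i \<in> ?L" "inverse (ratvar i) \<in> ?L" if "i < m" for i
    using that by (auto intro: laurent_ring_var laurent_ring_inverse)
  have PL: "P \<in> ?L" unfolding P using AL zL z(1) by (intro laurent_ring_closed)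
  have "\<exists>N. f * P ^ N \<in> ?L"
    unfolding laurent_ring_def[of m "{..<m}" ratvar]
  proof (rule subring_denominator[OF _ _ f1[unfolded s1 fst_conv laurent_ring_def]], fold laurent_ring_def)
    fix g assume "g \<in> x1 ` {..<m} \<union> (\<lambda>i. inverse (x1 i)) ` {..<m}"
    then consider "g = x3" | "g = inverse x3" | i where "i < m" "g = ratvar i \<or> g = inverse (ratvar i)"
      unfolding x1_def by (auto split: if_splits)
    then show "\<exists>N. g * P ^ N \<in> ?L"
    proof cases
      case 1
      then show ?thesis using PL zL[OF jm(1)] unfolding x3_def
        by (intro exI[of _ 0]) (auto intro: laurent_ring_closed)
    next
      case 2
      then have "g * P ^ 1 = ratvar j" using nz by (simp add: x3_def)
      then show ?thesis using zL[OF jm(1)] by (intro exI[of _ 1]) simp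
    next
      case 3
      then show ?thesis using zL by (intro exI[of _ 0]) auto
    qed
  qed (rule PL)
  then obtain N where N: "f * P ^ N \<in> ?L" by blast
  \<comment> \<open>All variables of the third seed are units at \<open>y\<close>, so
    \<open>f\<close> is regular there and the power of \<open>P\<close> found above can be
    cancelled.\<close>
  have "\<exists>v. ev y (fst s3 i) v \<and> v \<noteq> 0" if "i < m" for i
    using x5_unit x4_unit unit_var unfolding s3 x2_def x1_def ev_unit_def by auto
  then obtain v where v: "\<And>i. i < m \<Longrightarrow> ev y (fst s3 i) (v i)" "\<And>i. i < m \<Longrightarrow> v i \<noteq> 0" by metis
  obtain r where r: "ev y f r"
    using laurent_ring_ev[OF f3, of y v] v by auto
  show ?thesis unfolding laurent_ring_def
  proof (rule regular_division[OF _ nz(3) evP r N[unfolded laurent_ring_def]], fold laurent_ring_def)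
    fix g assume "g \<in> ratvar ` {..<m} \<union> (\<lambda>i. inverse (ratvar i)) ` {..<m}"
    then obtain i where i: "i < m" "g = ratvar i \<or> g = inverse (ratvar i)" by auto
    show "\<exists>s h. ev y g s \<and> s \<in> ?L \<and> h \<in> ?L \<and> g - s = P * h"
    proof (cases "i = z")
      case False
      then have "ev y g g" using i ev_ratvar[of y i] y[of i] ev.ext_inverse[of y "ratvar i"] by (auto simp: yi)
      then show ?thesis using i zL by (intro exI[of _ g] exI[of _ 0]) (auto simp: laurent_ring_closed)
    next
      case True
      from i(2) show ?thesis
      proof
        assume g: "g = ratvar i"
        have "ev y g (- A' / A)" using ev_ratvar[of y z] unfolding g True by (simp add: y_def)
        moreover have "- A' / A \<in> ?L" "inverse A \<in> ?L"
          unfolding divide_inverse using AL by (intro laurent_ring_closed AL)+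
        moreover have "g - (- A' / A) = P * inverse A"
          unfolding g True P using nz by (simp add: field_simps)
        ultimately show ?thesis by blast
      next
        assume g: "g = inverse (ratvar i)"
        have "ev y g (inverse (- A' / A))"
          using ev.ext_inverse[OF ev_ratvar[of y z]] y[of z] unfolding g True by (simp add: y_def)
        then have "ev y g (- A / A')" by (simp add: field_simps)
        moreover have "- A / A' \<in> ?L" "inverse A' * inverse (ratvar z) \<in> ?L"
          unfolding divide_inverse using zL[OF z(1)] by (intro laurent_ring_closed AL; simp)+
        moreover have "g - (- A / A') = P * (inverse A' * inverse (ratvar z))"
          unfolding g True P using nz by (simp add: field_simps)
        ultimately show ?thesis by blast
      qed
    qed
  qed
qed

text \<open>A frozen variable with value 1 contributes the factor 1 to each exchange monomial, and
  the other rows mutate without reference to its row.\<close>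

lemma fold_seed_mutation_extend:
  assumes "B' \<in> carrier_mat (Suc m) n" "B \<in> carrier_mat m n" "n \<le> m"
    and "\<And>i j. i < m \<Longrightarrow> j < n \<Longrightarrow> B' $$ (i, j) = B $$ (i, j)"
    and "\<And>i. i < m \<Longrightarrow> x' i = x i" "x' m = 1" "set w \<subseteq> {..<n}" "i < m"
  shows "fst (fold seed_mutation w (x', B')) i = fst (fold seed_mutation w (x, B)) i"
  using assms
proof (induction w arbitrary: x x' B B')
  case (Cons k w)
  have kn: "k < n" "k < m" using Cons.prems by auto
  have mon: "exchange_monomial e x' B' k = exchange_monomial e x B k" for e
  proof -
    have dims: "dim_row B = m" "dim_row B' = Suc m" using Cons.prems(1,2) by auto
    show ?thesis unfolding exchange_monomial_def dims using Cons.prems kn by simp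
  qed
  define x1 x1' where "x1 = fst (seed_mutation k (x, B))" and "x1' = fst (seed_mutation k (x', B'))"
  have "seed_mutation k (x, B) = (x1, matrix_mutation k B)"
    "seed_mutation k (x', B') = (x1', matrix_mutation k B')"
    by (simp_all add: prod_eq_iff x1_def x1'_def)
  moreover have "fst (fold seed_mutation w (x1', matrix_mutation k B')) i =
      fst (fold seed_mutation w (x1, matrix_mutation k B)) i"
  proof (rule Cons.IH)
    show "matrix_mutation k B' $$ (i, j) = matrix_mutation k B $$ (i, j)" if "i < m" "j < n" for i j
      using that Cons.prems(1-4) kn by (simp add: matrix_mutation_index)
    show "x1' m = 1" "\<And>i. i < m \<Longrightarrow> x1' i = x1 i"
      unfolding x1_def x1'_def fst_seed_mutation mon using Cons.prems kn by auto
  qed (use Cons.prems in auto)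
  ultimately show ?case by simp
qed simp

text \<open>The expansion in the initial variables is evaluated at the cluster \<open>x\<close>,
  regarded as a point. The induction can thus restart from any positive seed.\<close>

lemma laurent_ring_transfer:
  assumes "fst (fold seed_mutation w (ratvar, B)) i \<in> laurent_ring m J ratvar"
    and "\<And>i. x i \<in> pos" "J \<subseteq> {..<m}"
  shows "fst (fold seed_mutation w (x, B)) i \<in> laurent_ring m J x"
proof -
  have "ev x (fst (fold seed_mutation w (ratvar, B)) i) (fst (fold seed_mutation w (x, B)) i)"
    using assms(2) by (intro ev_fold_seed_mutation ev_ratvar)
  moreover obtain r where "r \<in> laurent_ring m J x" "ev x (fst (fold seed_mutation w (ratvar, B)) i) r"
    using laurent_ring_ev[OF assms(1), of x x] ev_ratvar[of x] pos_nonzero[OF assms(2)] assms(3) by blast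
  ultimately show ?thesis using ev.ext_unique by metis
qed

text \<open>Induction on the length of the word, with the number of frozen variables free because
  every step adds one. For a word \<open>j # k # w'\<close> the seed after \<open>j\<close> needs
  only \<open>k # w'\<close>, and the seed after \<open>j\<close>, \<open>k\<close>,
  \<open>j\<close> needs only \<open>j # w'\<close>; both words are shorter, so
  \<open>laurent_step\<close> applies.\<close>

theorem laurent_phenomenon:
  assumes "positive_seed d m n (ratvar, B)" "set w \<subseteq> {..<n}" "i < m"
  shows "fst (fold seed_mutation w (ratvar, B)) i \<in> laurent_ring m {..<m} ratvar"
  using assms
proof (induction "length w" arbitrary: w m B i rule: less_induct)
  case less
  have nm: "n \<le> m" and B: "B \<in> carrier_mat m n" and skew: "skew_symmetrizer d n B"
    using less.prems(1) by (auto simp: positive_seed_def)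
  have var: "ratvar i \<in> laurent_ring m {..<m} ratvar" "inverse (ratvar i) \<in> laurent_ring m {..<m} ratvar"
    if "i < m" for i
    using that by (auto intro: laurent_ring_var laurent_ring_inverse)
  consider "w = []" | k where "w = [k]" | j w' where "w = j # j # w'" | j k w' where "w = j # k # w'" "j \<noteq> k"
    by (metis list.exhaust)
  then show ?case
  proof cases
    case 1
    then show ?thesis using var less.prems by simp
  next
    case 2
    have "exchange_monomial e ratvar B k \<in> laurent_ring m {..<m} ratvar" for e
      unfolding exchange_monomial_def using B by (intro laurent_ring_prod laurent_ring_power_int) auto
    then show ?thesis
      using 2 less.prems nm var by (auto simp: fst_seed_mutation intro!: laurent_ring_closed)
  next
    case 3
    then have "fold seed_mutation w (ratvar, B) = fold seed_mutation w' (ratvar, B)"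
      using seed_mutation_involution[OF less.prems(1), of j] less.prems(2) by simp
    then show ?thesis using less.hyps[of w' m B i] less.prems 3 by simp
  next
    case 4
    \<comment> \<open>The new row is zero except for a 1 in column \<open>j\<close>: the exchange
      polynomial at \<open>j\<close> becomes linear in x_m, and the entry in column \<open>k\<close>
      is 0.\<close>
    define B' where "B' = mat (Suc m) n (\<lambda>(r, c). if r < m then B $$ (r, c) else if c = j then 1 else 0)"
    have B': "B' \<in> carrier_mat (Suc m) n" by (simp add: B'_def)
    have "skew_symmetrizer d n B'"
      using skew by (rule skew_symmetrizer_cong) (use nm in \<open>simp add: B'_def\<close>)
    with B' nm have seed: "positive_seed d (Suc m) n (ratvar, B')" by (intro positive_seed_initial) auto
    have jk: "j < n" "k < n" using 4 less.prems(2) by auto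
    define s1 where "s1 = seed_mutation j (ratvar, B')"
    define s2 where "s2 = seed_mutation k s1"
    define s3 where "s3 = seed_mutation j s2"
    have seed1: "positive_seed d (Suc m) n s1" unfolding s1_def by (intro positive_seed_mutation seed jk)
    have seed2: "positive_seed d (Suc m) n s2" unfolding s2_def by (intro positive_seed_mutation seed1 jk)
    have seed3: "positive_seed d (Suc m) n s3" unfolding s3_def by (intro positive_seed_mutation seed2 jk)
    define f where "f = fst (fold seed_mutation w (ratvar, B')) i"
    have from_seed: "fst (fold seed_mutation v s) i \<in> laurent_ring (Suc m) {..<Suc m} (fst s)"
      if "positive_seed d (Suc m) n s" "length v < length w" "set v \<subseteq> {..<n}" for v s
    proof -
      obtain x C where s: "s = (x, C)" by fastforce
      have "positive_seed d (Suc m) n (ratvar, C)" using that(1) pos_ratvar unfolding positive_seed_def s by simp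
      from less.hyps[OF that(2) this that(3), of i] less.prems(3)
      have "fst (fold seed_mutation v (ratvar, C)) i \<in> laurent_ring (Suc m) {..<Suc m} ratvar" by simp
      moreover have "x i \<in> pos" for i using that(1) unfolding positive_seed_def s by simp
      ultimately show ?thesis unfolding s fst_conv by (rule laurent_ring_transfer) simp
    qed
    have "f = fst (fold seed_mutation (k # w') s1) i" unfolding f_def 4 s1_def by simp
    then have f1: "f \<in> laurent_ring (Suc m) {..<Suc m} (fst s1)"
      using from_seed[OF seed1, of "k # w'"] 4 less.prems(2) by simp
    have "seed_mutation j s3 = s2" unfolding s3_def by (rule seed_mutation_involution[OF seed2 jk(1)])
    then have "f = fst (fold seed_mutation (j # w') s3) i" unfolding f_def 4 s2_def s1_def by simp
    then have f3: "f \<in> laurent_ring (Suc m) {..<Suc m} (fst s3)"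
      using from_seed[OF seed3, of "j # w'"] 4 less.prems(2) by simp
    have f: "f \<in> laurent_ring (Suc m) {..<Suc m} ratvar"
      using laurent_step[OF seed jk 4(2) lessI nm, of f] f1 f3 jk 4(2)
      unfolding s3_def s2_def s1_def by (simp add: B'_def)
    \<comment> \<open>Setting x_m = 1 recovers the original seed. No coordinate of this point is
      zero, so the Laurent expansion of \<open>f\<close> can be evaluated at it.\<close>
    let ?y = "ratvar(m := 1)"
    have "ev ?y f (fst (fold seed_mutation w (?y, B')) i)"
      unfolding f_def by (intro ev_fold_seed_mutation ev_ratvar) (auto simp: pos_ratvar pos_1)
    also have "fst (fold seed_mutation w (?y, B')) i = fst (fold seed_mutation w (ratvar, B)) i"
      by (rule fold_seed_mutation_extend[OF B' B nm]) (use less.prems in \<open>auto simp: B'_def\<close>)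
    finally have ev1: "ev ?y f (fst (fold seed_mutation w (ratvar, B)) i)" .
    have "?y i \<noteq> 0" for i by simp
    then obtain r where r: "r \<in> laurent_ring (Suc m) {..<Suc m} ?y" "ev ?y f r"
      using laurent_ring_ev[OF f, of ?y ?y] ev_ratvar[of ?y] by blast
    have "laurent_ring (Suc m) {..<Suc m} ?y \<subseteq> laurent_ring m {..<m} ratvar"
      using var subring.one
      unfolding laurent_ring_def[of "Suc m"] laurent_ring_def[of m]
      by (intro subring_subset) (auto simp: less_Suc_eq split: if_splits)
    then show ?thesis using r ev.ext_unique[OF r(2) ev1] by blast
  qed
qed

section \<open>Polynomiality in the frozen variables\<close>

text \<open>At x_z = 0 at most one of the two exchange monomials vanishes and the other is positive,
  so no denominator becomes zero under repeated mutation.\<close>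

lemma frozen_variable_regular:
  assumes "B \<in> carrier_mat m n" "n \<le> z" "n \<le> m" "set w \<subseteq> {..<n}"
    and "\<And>i. i \<noteq> z \<Longrightarrow> \<exists>s \<in> pos. ev y (x i) s" "ev y (x z) 0" "i \<noteq> z"
  shows "\<exists>s \<in> pos. ev y (fst (fold seed_mutation w (x, B)) i) s"
  using assms
proof (induction w arbitrary: x B)
  case (Cons k w)
  have k: "k < n" "k \<noteq> z" using Cons.prems by auto
  obtain s where s: "\<And>i. i \<noteq> z \<Longrightarrow> s i \<in> pos" "\<And>i. i \<noteq> z \<Longrightarrow> ev y (x i) (s i)"
    using Cons.prems(5) by metis
  let ?s = "s(z := 0)"
  have ev: "ev y (x i) (?s i)" for i using s Cons.prems(6) by simp
  have mon: "ev y (exchange_monomial e x B k) (exchange_monomial e ?s B k)" for e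
    by (intro ev_exchange_monomial ev)
  have val: "exchange_monomial e ?s B k = 0 \<or> exchange_monomial e ?s B k \<in> pos" for e
  proof (cases "z < dim_row B \<and> pos_part (e * B $$ (z, k)) \<noteq> 0")
    case True
    then have "exchange_monomial e ?s B k = 0"
      unfolding exchange_monomial_def by (intro prod_zero) (auto intro!: bexI[of _ z])
    then show ?thesis ..
  next
    case False
    have "?s i powi pos_part (e * B $$ (i, k)) \<in> pos" if "i < dim_row B" for i
      using False that by (cases "i = z") (auto simp: pos_1 intro!: pos_power_int s)
    then show ?thesis unfolding exchange_monomial_def by (intro disjI2 pos_prod) auto
  qed
  have "exchange_monomial 1 ?s B k \<in> pos \<or> exchange_monomial (-1) ?s B k \<in> pos"
  proof -
    \<comment> \<open>The positive and the negative part of b_zk are not both nonzero; the chosen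
      sign yields a monomial free of x_z.\<close>
    have "\<exists>e \<in> {1, -1}. pos_part (e * B $$ (z, k)) = 0" by (auto simp: pos_part_def)
    then obtain e where e: "e \<in> {1, -1}" "pos_part (e * B $$ (z, k)) = 0" by blast
    have "?s i powi pos_part (e * B $$ (i, k)) \<in> pos" for i
      using e by (cases "i = z") (auto simp: pos_1 intro!: pos_power_int s)
    then have "exchange_monomial e ?s B k \<in> pos" unfolding exchange_monomial_def by (intro pos_prod)
    with e show ?thesis by auto
  qed
  then have "exchange_monomial 1 ?s B k + exchange_monomial (-1) ?s B k \<in> pos"
    using val[of 1] val[of "-1"] pos_add by auto
  moreover define x1 where "x1 = fst (seed_mutation k (x, B))"
  moreover have "ev y (x1 k) (inverse (s k) * (exchange_monomial 1 ?s B k + exchange_monomial (-1) ?s B k))"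
    unfolding x1_def fst_seed_mutation using k s pos_nonzero
    by (auto intro!: ev_mult ev.ext_inverse ev.ext_add mon)
  ultimately have "\<exists>t\<in>pos. ev y (x1 k) t" using s(1) k by (auto intro: pos_mult pos_inverse)
  then have "\<exists>t\<in>pos. ev y (x1 i) t" if "i \<noteq> z" for i
    using Cons.prems(5) that unfolding x1_def fst_seed_mutation by (cases "i = k") auto
  moreover have "ev y (x1 z) 0" unfolding x1_def fst_seed_mutation using k Cons.prems by simp
  moreover have "seed_mutation k (x, B) = (x1, matrix_mutation k B)" by (simp add: prod_eq_iff x1_def)
  ultimately show ?case using Cons.IH[of "matrix_mutation k B" x1] Cons.prems by simp
qed simp

text \<open>Here \<open>regular_division\<close> is applied with the divisor x_z: the other
  generators are their own values at x_z = 0, and x_z is congruent to 0.\<close>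

lemma laurent_ring_remove_inverse:
  assumes f: "f \<in> laurent_ring m (insert z J) ratvar" and z: "z < m" "z \<notin> J"
    and ev: "ev (ratvar(z := 0)) f r"
  shows "f \<in> laurent_ring m J ratvar"
proof -
  let ?L = "laurent_ring m J ratvar"
  have zL: "ratvar z \<in> ?L" using z by (intro laurent_ring_var)
  have "\<exists>N. f * ratvar z ^ N \<in> ?L"
    unfolding laurent_ring_def
  proof (rule subring_denominator[OF _ _ f[unfolded laurent_ring_def]], fold laurent_ring_def)
    fix g assume "g \<in> ratvar ` {..<m} \<union> (\<lambda>i. inverse (ratvar i)) ` insert z J"
    then consider "g = inverse (ratvar z)" | "g \<in> ratvar ` {..<m} \<union> (\<lambda>i. inverse (ratvar i)) ` J" by auto
    then show "\<exists>N. g * ratvar z ^ N \<in> ?L"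
    proof cases
      case 1
      then show ?thesis by (intro exI[of _ 1]) (simp add: laurent_ring_closed)
    next
      case 2
      then show ?thesis unfolding laurent_ring_def by (intro exI[of _ 0]) (simp add: subring.base)
    qed
  qed (rule zL)
  then obtain N where N: "f * ratvar z ^ N \<in> ?L" by blast
  have evz: "ev (ratvar(z := 0)) (ratvar z) 0" using ev_ratvar[of "ratvar(z := 0)" z] by simp
  show ?thesis
    unfolding laurent_ring_def
  proof (rule regular_division[OF _ ratvar_nonzero evz ev N[unfolded laurent_ring_def]])
    fix g assume g: "g \<in> ratvar ` {..<m} \<union> (\<lambda>i. inverse (ratvar i)) ` J"
    let ?G = "subring (ratvar ` {..<m} \<union> (\<lambda>i. inverse (ratvar i)) ` J)"
    show "\<exists>s h. ev (ratvar(z := 0)) g s \<and> s \<in> ?G \<and> h \<in> ?G \<and> g - s = ratvar z * h"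
    proof (cases "g = ratvar z")
      case True
      with evz show ?thesis
        by (intro exI[where x = "0 :: ratfun"] exI[where x = "1 :: ratfun"]) (simp add: subring_0 subring.one)
    next
      case False
      from g consider i where "g = ratvar i" | i where "i \<in> J" "g = inverse (ratvar i)" by blast
      then have "ev (ratvar(z := 0)) g g"
      proof cases
        case (1 i)
        with False have "i \<noteq> z" by blast
        then show ?thesis using ev_ratvar[of "ratvar(z := 0)" i] unfolding 1 by simp
      next
        case (2 i)
        with z(2) have "i \<noteq> z" by blast
        then show ?thesis
          using ev.ext_inverse[OF ev_ratvar[of "ratvar(z := 0)" i]] unfolding 2(2) by simp
      qed
      then show ?thesis using subring.base[OF g] subring_0 by (intro exI[of _ g] exI[of _ 0]) simp
    qed
  qed
qed

theorem laurent_phenomenon_frozen: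
  assumes seed: "positive_seed d m n (ratvar, B)" and w: "set w \<subseteq> {..<n}" and i: "i < n"
  shows "fst (fold seed_mutation w (ratvar, B)) i \<in> laurent_ring m {..<n} ratvar"
proof -
  have nm: "n \<le> m" and B: "B \<in> carrier_mat m n" using seed by (auto simp: positive_seed_def)
  let ?f = "fst (fold seed_mutation w (ratvar, B)) i"
  have "?f \<in> laurent_ring m {..<l} ratvar" if "l \<le> m" "n \<le> l" for l
    using that
  proof (induction l rule: inc_induct)
    case base
    show ?case using laurent_phenomenon[OF seed w, of i] i nm by simp
  next
    case (step l)
    let ?y = "ratvar(l := 0)"
    have "\<exists>s\<in>pos. ev ?y ?f s"
    proof (rule frozen_variable_regular[OF B _ nm w])
      show "\<exists>s\<in>pos. ev ?y (ratvar i) s" if "i \<noteq> l" for i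
        using that ev_ratvar[of ?y i] pos_ratvar by auto
      show "ev ?y (ratvar l) 0" using ev_ratvar[of ?y l] by simp
    qed (use step i in auto)
    then obtain s where "ev ?y ?f s" by blast
    moreover have "{..<Suc l} = insert l {..<l}" by auto
    ultimately show ?case
      using laurent_ring_remove_inverse[of ?f m l "{..<l}" s] step.hyps step.IH step.prems by simp
  qed
  from this[OF nm order_refl] show ?thesis .
qed

section \<open>The separation formula\<close>

definition monomials :: "nat \<Rightarrow> ratfun set" where
  "monomials m = vmon m ratvar ` carrier_vec m"

lemma monomials_1: "1 \<in> monomials m"
  unfolding monomials_def by (rule image_eqI[of _ _ "0\<^sub>v m"]) simp_all

lemma monomials_mult: "a \<in> monomials m \<Longrightarrow> b \<in> monomials m \<Longrightarrow> a * b \<in> monomials m"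
proof -
  assume "a \<in> monomials m" "b \<in> monomials m"
  then obtain e f where "e \<in> carrier_vec m" "f \<in> carrier_vec m" "a = vmon m ratvar e" "b = vmon m ratvar f"
    unfolding monomials_def by blast
  then show ?thesis
    unfolding monomials_def by (intro image_eqI[of _ _ "e + f"]) (simp_all add: vmon_add)
qed

lemma monomials_power_int: "a \<in> monomials m \<Longrightarrow> a powi c \<in> monomials m"
proof -
  assume "a \<in> monomials m"
  then obtain e where "a = vmon m ratvar e" unfolding monomials_def by blast
  then have "a powi c = vmon m ratvar (vec m (\<lambda>i. e $ i * c))"
    by (simp add: vmon_def prod_power_int power_int_mult)
  then show ?thesis unfolding monomials_def by simp
qed

lemma monomials_inverse: "a \<in> monomials m \<Longrightarrow> inverse a \<in> monomials m"
  using monomials_power_int[of a m "- 1"] by (simp add: power_int_minus)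

lemma monomials_prod: "(\<And>i. i \<in> I \<Longrightarrow> f i \<in> monomials m) \<Longrightarrow> prod f I \<in> monomials m"
  by (induction I rule: infinite_finite_induct) (simp_all add: monomials_1 monomials_mult)

lemma monomials_ratvar: "i < m \<Longrightarrow> ratvar i \<in> monomials m"
  unfolding monomials_def by (rule image_eqI[of _ _ "unit_vec m i"]) simp_all

lemma monomials_nonzero: "a \<in> monomials m \<Longrightarrow> a \<noteq> 0"
  unfolding monomials_def by (auto simp: vmon_nonzero)

text \<open>Equality up to a Laurent monomial in the initial variables; it lets the polynomial part
  of the separation formula be followed without keeping track of g-vectors.\<close>

definition mon_equiv :: "nat \<Rightarrow> ratfun \<Rightarrow> ratfun \<Rightarrow> bool" where
  "mon_equiv m a b \<longleftrightarrow> (\<exists>g \<in> monomials m. a = b * g)"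

lemma mon_equiv_mult: "mon_equiv m a b \<Longrightarrow> mon_equiv m c d \<Longrightarrow> mon_equiv m (a * c) (b * d)"
proof -
  assume "mon_equiv m a b" "mon_equiv m c d"
  then obtain g h where "g \<in> monomials m" "h \<in> monomials m" "a = b * g" "c = d * h"
    unfolding mon_equiv_def by blast
  then show ?thesis
    unfolding mon_equiv_def by (intro bexI[of _ "g * h"]) (simp_all add: monomials_mult)
qed

lemma mon_equiv_refl: "mon_equiv m a a"
  unfolding mon_equiv_def using monomials_1 by force

lemma mon_equiv_power_int: "mon_equiv m a b \<Longrightarrow> mon_equiv m (a powi c) (b powi c)"
proof -
  assume "mon_equiv m a b"
  then obtain g where "g \<in> monomials m" "a = b * g" unfolding mon_equiv_def by blast
  then show ?thesis
    unfolding mon_equiv_def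
    by (intro bexI[of _ "g powi c"]) (simp_all add: monomials_power_int power_int_mult_distrib)
qed

lemma mon_equiv_inverse: "mon_equiv m a b \<Longrightarrow> mon_equiv m (inverse a) (inverse b)"
  using mon_equiv_power_int[of m a b "- 1"] by (simp add: power_int_minus)

lemma mon_equiv_prod: "(\<And>i. i \<in> I \<Longrightarrow> mon_equiv m (f i) (g i)) \<Longrightarrow> mon_equiv m (prod f I) (prod g I)"
  by (induction I rule: infinite_finite_induct) (simp_all add: mon_equiv_refl mon_equiv_mult)

lemma mon_equiv_monomials:
  assumes "a \<in> monomials m" "b \<in> monomials m" shows "mon_equiv m a b"
  unfolding mon_equiv_def
proof (rule bexI[of _ "a * inverse b"])
  show "a = b * (a * inverse b)" using monomials_nonzero[OF assms(2)] by simp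
qed (intro monomials_mult monomials_inverse assms)

lemma exchange_monomial_split:
  assumes "B \<in> carrier_mat m n" "n \<le> m"
  shows "exchange_monomial e x B k = (\<Prod>i<n. x i powi pos_part (e * B $$ (i, k))) *
    (\<Prod>i\<in>{n..<m}. x i powi pos_part (e * B $$ (i, k)))"
proof -
  have "dim_row B = m" using assms by auto
  then show ?thesis
    unfolding exchange_monomial_def lessThan_atLeast0
    by (simp only: prod.atLeastLessThan_concat[OF le0 assms(2)])
qed

text \<open>
  The exchange relation reads \<open>x\<^sub>k' = x\<^sub>k\<^sup>-\<^sup>1 M (1 + y\<^sub>k)\<close> with a monomial \<open>M\<close>, and the mutation of
  the \<open>y\<^sub>k\<close> involves only the \<open>y\<^sub>k\<close> and the principal part.
\<close>

lemma separation_induct: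
  assumes "positive_seed d m n (x, B)" "positive_seed d m' n (u, B')" "set w \<subseteq> {..<n}" "i < n"
    and "\<And>i j. i < n \<Longrightarrow> j < n \<Longrightarrow> B $$ (i, j) = B' $$ (i, j)"
    and "\<And>j. j < n \<Longrightarrow> yhat x B j = yhat u B' j"
    and "\<And>i. i < n \<Longrightarrow> mon_equiv M (x i) (u i)"
    and "\<And>i. n \<le> i \<Longrightarrow> i < m \<Longrightarrow> x i \<in> monomials M"
    and "\<And>i. n \<le> i \<Longrightarrow> i < m' \<Longrightarrow> u i \<in> monomials M"
  shows "mon_equiv M (fst (fold seed_mutation w (x, B)) i) (fst (fold seed_mutation w (u, B')) i)"
  using assms
proof (induction w arbitrary: x B u B')
  case (Cons k w)
  have k: "k < n" using Cons.prems by auto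
  have B: "B \<in> carrier_mat m n" "n \<le> m" "skew_symmetrizer d n B" and x: "\<And>i. x i \<in> pos"
    using Cons.prems(1) by (auto simp: positive_seed_def)
  have B': "B' \<in> carrier_mat m' n" "n \<le> m'" "skew_symmetrizer d n B'" and u: "\<And>i. u i \<in> pos"
    using Cons.prems(2) by (auto simp: positive_seed_def)
  have x0: "x i \<noteq> 0" and u0: "u i \<noteq> 0" for i using x u pos_nonzero by blast+
  define x1 u1 where "x1 = fst (seed_mutation k (x, B))" and "u1 = fst (seed_mutation k (u, B'))"
  let ?B = "matrix_mutation k B" and ?B' = "matrix_mutation k B'"
  have x1: "seed_mutation k (x, B) = (x1, ?B)" and u1: "seed_mutation k (u, B') = (u1, ?B')"
    by (simp_all add: prod_eq_iff x1_def u1_def)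
  have monom: "mon_equiv M (exchange_monomial (-1) x B k) (exchange_monomial (-1) u B' k)"
    unfolding exchange_monomial_split[OF B(1,2)] exchange_monomial_split[OF B'(1,2)]
  proof (rule mon_equiv_mult)
    show "mon_equiv M (\<Prod>i<n. x i powi pos_part (- 1 * B $$ (i, k))) (\<Prod>i<n. u i powi pos_part (- 1 * B' $$ (i, k)))"
      using Cons.prems(5,7) k by (intro mon_equiv_prod) (simp add: mon_equiv_power_int)
  qed (intro mon_equiv_monomials monomials_prod monomials_power_int Cons.prems(8,9); simp)
  have rel: "mon_equiv M (x1 i) (u1 i)" if "i < n" for i
  proof (cases "i = k")
    case True
    have "x1 k = inverse (x k) * (exchange_monomial (-1) x B k * (1 + yhat x B k))"
      unfolding x1_def fst_seed_mutation using exchange_polynomial_yhat[of B x 1 k] x0 by simp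
    moreover have "u1 k = inverse (u k) * (exchange_monomial (-1) u B' k * (1 + yhat u B' k))"
      unfolding u1_def fst_seed_mutation using exchange_polynomial_yhat[of B' u 1 k] u0 by simp
    ultimately show ?thesis
      unfolding True Cons.prems(6)[OF k]
      using mon_equiv_mult[OF mon_equiv_inverse[OF Cons.prems(7)[OF k]] mon_equiv_mult[OF monom mon_equiv_refl]]
      by simp
  next
    case False
    then show ?thesis using Cons.prems(7)[OF that] by (simp add: x1_def u1_def fst_seed_mutation)
  qed
  have "mon_equiv M (fst (fold seed_mutation w (x1, ?B)) i) (fst (fold seed_mutation w (u1, ?B')) i)"
  proof (rule Cons.IH)
    show "positive_seed d m n (x1, ?B)" "positive_seed d m' n (u1, ?B')"
      using positive_seed_mutation[OF Cons.prems(1) k] positive_seed_mutation[OF Cons.prems(2) k]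
      unfolding x1 u1 .
    show "?B $$ (i, j) = ?B' $$ (i, j)" if "i < n" "j < n" for i j
      using that Cons.prems(5) B(1,2) B'(1,2) k by (simp add: matrix_mutation_index)
    show "mon_equiv M (x1 i) (u1 i)" if "i < n" for i using rel that .
    show "yhat x1 ?B j = yhat u1 ?B' j" if j: "j < n" for j
    proof (cases "j = k")
      case True
      show ?thesis
        unfolding True x1_def u1_def
        using yhat_mutation_self[OF B(1) k B(2) skew_symmetrizer_diag[OF B(3) k]]
          yhat_mutation_self[OF B'(1) k B'(2) skew_symmetrizer_diag[OF B'(3) k]] Cons.prems(6)[OF k] by simp
    next
      case False
      define e :: int where "e = (if B $$ (k, j) \<ge> 0 then 1 else - 1)"
      have e: "e = 1 \<or> e = - 1" "e * B $$ (k, j) \<ge> 0" "e * B' $$ (k, j) \<ge> 0"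
        using Cons.prems(5)[OF k j] by (auto simp: e_def)
      show ?thesis
        unfolding x1_def u1_def
        using yhat_mutation[OF B(1) k B(2) j False skew_symmetrizer_diag[OF B(3) k] _ e(1,2), of x]
          yhat_mutation[OF B'(1) k B'(2) j False skew_symmetrizer_diag[OF B'(3) k] _ e(1,3), of u]
          Cons.prems(6)[OF k] Cons.prems(6)[OF j] Cons.prems(5)[OF k j] x0 u0 by simp
    qed
    show "x1 i \<in> monomials M" if "n \<le> i" "i < m" for i
      using that Cons.prems(8) k by (simp add: x1_def fst_seed_mutation)
    show "u1 i \<in> monomials M" if "n \<le> i" "i < m'" for i
      using that Cons.prems(9) k by (simp add: u1_def fst_seed_mutation)
  qed (use Cons.prems in auto)
  then show ?case by (simp only: fold_Cons o_apply x1 u1)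
qed simp

section \<open>Principal coefficients and the separation formula\<close>

lemma principal_extension_carrier [simp]:
  "B0 \<in> carrier_mat n n \<Longrightarrow> principal_extension B0 \<in> carrier_mat (2 * n) n"
  unfolding principal_extension_def by (simp add: mult_2 carrier_append_rows)

lemma principal_extension_index:
  assumes "B0 \<in> carrier_mat n n" "j < n"
  shows "i < n \<Longrightarrow> principal_extension B0 $$ (i, j) = B0 $$ (i, j)"
    and "i < n \<Longrightarrow> principal_extension B0 $$ (n + i, j) = (if i = j then 1 else 0)"
  using assms by (auto simp: principal_extension_def append_rows_def)

lemma positive_seed_principal:
  assumes "B0 \<in> carrier_mat n n" "skew_symmetrizer d n B0"
  shows "positive_seed d (2 * n) n (ratvar, principal_extension B0)"
proof (rule positive_seed_initial)
  show "skew_symmetrizer d n (principal_extension B0)"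
    using assms(2) by (rule skew_symmetrizer_cong) (simp add: principal_extension_index[OF assms(1)])
qed (use assms in auto)

lemma ev_laurent_eval:
  assumes "\<And>i. i < r \<Longrightarrow> ev y (x i) (s i)" "\<And>i. i < r \<Longrightarrow> s i \<noteq> 0"
  shows "ev y (laurent_eval r x P) (laurent_eval r s P)"
  unfolding laurent_eval_lin lin_def
  by (intro ev.ext_sum ev_mult ev.ext_of_int ev_vmon assms)

lemma y_hat_yhat: "y_hat B = yhat ratvar B"
  by (simp add: y_hat_def yhat_def fun_eq_iff)

lemma vmon_vec_last:
  assumes "e \<in> carrier_vec (2 * n)"
  shows "vmon (2 * n) (\<lambda>i. if i < n then 1 else y (i - n)) e = vmon n y (vec_last e n)"
proof -
  have image: "(\<lambda>i. n + i) ` {..<n} = {n..<2 * n}"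
    using image_add_atLeastLessThan[of n 0 n] by (simp add: lessThan_atLeast0 mult_2)
  let ?f = "\<lambda>i. (if i < n then 1 else y (i - n)) powi (e $ i)"
  have "vmon (2 * n) (\<lambda>i. if i < n then 1 else y (i - n)) e = prod ?f {0..<n} * prod ?f {n..<2 * n}"
    unfolding vmon_def lessThan_atLeast0 by (rule prod.atLeastLessThan_concat[symmetric]) auto
  also have "prod ?f {0..<n} = 1" by (rule prod.neutral) simp
  also have "1 * prod ?f {n..<2 * n} = prod ?f ((\<lambda>i. n + i) ` {..<n})" unfolding image by simp
  also have "\<dots> = (\<Prod>i<n. y i powi (e $ (n + i)))"
    by (subst prod.reindex) auto
  also have "\<dots> = vmon n y (vec_last e n)"
    unfolding vmon_def vec_last_def using assms by (intro prod.cong) auto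
  finally show ?thesis .
qed

lemma laurent_eval_unique:
  assumes "keys P \<subseteq> carrier_vec m" "keys Q \<subseteq> carrier_vec m"
    "laurent_eval m ratvar P = laurent_eval m ratvar Q"
  shows "P = Q"
proof -
  have "keys (P - Q) \<subseteq> carrier_vec m" using assms(1,2) keys_diff[of P Q] by blast
  moreover have "laurent_eval m ratvar (P - Q) = 0"
    using assms(3) by (simp add: laurent_eval_lin lin_diff)
  ultimately have "P - Q = 0" by (rule laurent_independent)
  then show ?thesis by simp
qed

locale cluster_vertex =
  fixes B0 :: "int mat" and d n t0 t j
  assumes B0: "B0 \<in> carrier_mat n n" and skew: "skew_symmetrizer d n B0"
    and t0: "t0 \<in> tree_vertices n" and t: "t \<in> tree_vertices n" and j: "j < n"
begin

abbreviation "Bp \<equiv> principal_extension B0"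
abbreviation "P \<equiv> principal_expansion B0 t0 t j"
abbreviation "F \<equiv> F_polynomial B0 t0 t j"

lemma path: "set (t0 @ rev t) \<subseteq> {..<n}"
  using t0 t by (auto simp: tree_vertices_def)

lemma principal_expansion:
  "keys P \<subseteq> {e \<in> carrier_vec (2 * n). \<forall>i\<in>{n..<2 * n}. e $ i \<ge> 0}"
  "cluster_variable Bp t0 t j = laurent_eval (2 * n) ratvar P"
proof -
  have "fst (pattern Bp t0 t) j \<in> laurent_ring (2 * n) {..<n} ratvar"
    unfolding pattern_def by (rule laurent_phenomenon_frozen[OF positive_seed_principal[OF B0 skew] path j])
  from laurent_ring_laurent_eval[OF this] obtain Q where Q:
    "keys Q \<subseteq> {e \<in> carrier_vec (2 * n). \<forall>i<2 * n. i \<notin> {..<n} \<longrightarrow> e $ i \<ge> 0}"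
    "fst (pattern Bp t0 t) j = laurent_eval (2 * n) ratvar Q" by auto
  have cv: "cluster_variable Bp t0 t j = fst (pattern Bp t0 t) j"
    by (rule cluster_variable_pattern[OF positive_seed_principal[OF B0 skew] t0 t])
  have n: "dim_col B0 = n" using B0 by auto
  let ?p = "\<lambda>P. (\<forall>e\<in>keys P. e \<in> carrier_vec (2 * n) \<and> (\<forall>i\<in>{n..<2 * n}. e $ i \<ge> 0)) \<and>
        cluster_variable Bp t0 t j = laurent_eval (2 * n) ratvar P"
  have "?p Q" using Q cv by auto
  moreover have "P' = Q" if "?p P'" for P'
    using that \<open>?p Q\<close> by (intro laurent_eval_unique[of P' "2 * n" Q]) auto
  ultimately have "?p P"
    unfolding principal_expansion_def Let_def n by (rule theI)
  then show "keys P \<subseteq> {e \<in> carrier_vec (2 * n). \<forall>i\<in>{n..<2 * n}. e $ i \<ge> 0}"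
    "cluster_variable Bp t0 t j = laurent_eval (2 * n) ratvar P" by auto
qed

lemma F_polynomial_push: "F = push (\<lambda>e. vec_last e n) P"
  using B0 by (simp add: F_polynomial_def push_def Let_def)

lemma keys_F_polynomial: "keys F \<subseteq> carrier_vec n"
  unfolding F_polynomial_push using keys_push by fastforce

lemma cluster_variable_nonzero:
  assumes "positive_seed d m n (ratvar, B)" shows "cluster_variable B t0 t j \<noteq> 0"
  using positive_seed_fold[OF assms path] pos_nonzero
  unfolding cluster_variable_pattern[OF assms t0 t] pattern_def positive_seed_def by blast

text \<open>The pattern of \<open>B\<close> is compared with the principal pattern evaluated at a
  point with the same y-hats, so that \<open>separation_induct\<close> makes the two cluster
  variables agree up to a monomial. Evaluating the principal expansion at this point gives F at the
  y-hats.\<close>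

lemma separation:
  assumes seed: "positive_seed d m n (ratvar, B)" and B: "principal_part n B = B0"
  shows "\<exists>g \<in> carrier_vec m. cluster_variable B t0 t j = laurent_eval n (y_hat B) F * vmon m ratvar g"
proof -
  define v where "v = (\<lambda>i. if i < n then 1 else yhat ratvar B (i - n))"
  have Bc: "B \<in> carrier_mat m n" "n \<le> m" using seed by (auto simp: positive_seed_def)
  have entry: "B0 $$ (i, k) = B $$ (i, k)" if "i < n" "k < n" for i k
    using that unfolding B[symmetric] principal_part_def by simp
  have v_pos: "v i \<in> pos" for i
    unfolding v_def yhat_def by (auto intro!: pos_1 pos_prod pos_power_int pos_ratvar)
  have yhat_mon: "yhat ratvar B k \<in> monomials m" for k
    unfolding yhat_def using Bc(1) by (intro monomials_prod monomials_power_int monomials_ratvar) auto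
  let ?w = "t0 @ rev t"
  have "mon_equiv m (fst (fold seed_mutation ?w (ratvar, B)) j) (fst (fold seed_mutation ?w (v, Bp)) j)"
  proof (rule separation_induct[OF seed _ path j])
    show "positive_seed d (2 * n) n (v, Bp)"
      using positive_seed_principal[OF B0 skew] v_pos by (simp add: positive_seed_def)
    show "B $$ (i, k) = Bp $$ (i, k)" if "i < n" "k < n" for i k
      using that entry by (simp add: principal_extension_index[OF B0])
    show "yhat ratvar B k = yhat v Bp k" if k: "k < n" for k
    proof -
      have "yhat v Bp k = vmon (2 * n) v (col Bp k)"
        using k principal_extension_carrier[OF B0] by (subst yhat_vmon) auto
      also have "\<dots> = vmon n (yhat ratvar B) (vec_last (col Bp k) n)"
        unfolding v_def using principal_extension_carrier[OF B0] by (intro vmon_vec_last carrier_vecI) auto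
      also have "vec_last (col Bp k) n = unit_vec n k"
        using k principal_extension_carrier[OF B0]
        by (intro eq_vecI) (auto simp: vec_last_def principal_extension_index[OF B0])
      finally show ?thesis using k by simp
    qed
    show "mon_equiv m (ratvar i) (v i)" if "i < n" for i
      using that Bc(2) unfolding v_def by (intro mon_equiv_monomials) (auto simp: monomials_1 monomials_ratvar)
    show "ratvar i \<in> monomials m" if "n \<le> i" "i < m" for i using that by (intro monomials_ratvar)
    show "v i \<in> monomials m" if "n \<le> i" "i < 2 * n" for i using that yhat_mon by (simp add: v_def)
  qed
  then obtain g where g: "g \<in> carrier_vec m"
    "cluster_variable B t0 t j = fst (fold seed_mutation ?w (v, Bp)) j * vmon m ratvar g"
    unfolding cluster_variable_pattern[OF seed t0 t] pattern_def mon_equiv_def monomials_def by blast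
  have "ev v (cluster_variable Bp t0 t j) (fst (fold seed_mutation ?w (v, Bp)) j)"
    unfolding cluster_variable_pattern[OF positive_seed_principal[OF B0 skew] t0 t] pattern_def
    by (intro ev_fold_seed_mutation ev_ratvar v_pos)
  moreover have "ev v (cluster_variable Bp t0 t j) (laurent_eval (2 * n) v P)"
    unfolding principal_expansion(2) using pos_nonzero[OF v_pos] by (intro ev_laurent_eval ev_ratvar)
  ultimately have "fst (fold seed_mutation ?w (v, Bp)) j = laurent_eval (2 * n) v P"
    by (rule ev.ext_unique)
  also have "\<dots> = lin (vmon n (y_hat B) \<circ> (\<lambda>e. vec_last e n)) P"
    unfolding laurent_eval_lin y_hat_yhat
  proof (rule lin_cong)
    fix e assume "e \<in> keys P"
    then have "e \<in> carrier_vec (2 * n)" using principal_expansion(1) by blast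
    then show "vmon (2 * n) v e = (vmon n (yhat ratvar B) \<circ> (\<lambda>e. vec_last e n)) e"
      unfolding v_def by (simp add: vmon_vec_last)
  qed
  also have "\<dots> = laurent_eval n (y_hat B) F"
    unfolding F_polynomial_push laurent_eval_lin lin_push ..
  finally show ?thesis using g by auto
qed

text \<open>The vector is unique because the cluster variable is nonzero, so the polynomial factor
  can be cancelled and equal monomials have equal exponents.\<close>

lemma extended_g_vector_carrier:
  assumes seed: "positive_seed d m n (ratvar, B)" and B: "principal_part n B = B0"
  shows "extended_g_vector B t0 t j \<in> carrier_vec m"
proof -
  have dims: "dim_row B = m" "dim_col B = n" using seed by (auto simp: positive_seed_def)
  obtain g where g: "g \<in> carrier_vec m" "cluster_variable B t0 t j = laurent_eval n (y_hat B) F * vmon m ratvar g"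
    using separation[OF assms] by blast
  let ?p = "\<lambda>g. g \<in> carrier_vec m \<and> cluster_variable B t0 t j =
    laurent_eval n (y_hat B) F * (\<Prod>i<m. ratvar i powi (g $ i))"
  have "?p g" using g by (simp add: vmon_def)
  moreover have "g' = g" if "?p g'" for g'
  proof (rule vmon_inject)
    have "laurent_eval n (y_hat B) F \<noteq> 0" using cluster_variable_nonzero[OF seed] g(2) by auto
    moreover have "laurent_eval n (y_hat B) F * vmon m ratvar g' = laurent_eval n (y_hat B) F * vmon m ratvar g"
      by (metis that g(2) vmon_def)
    ultimately show "vmon m ratvar g' = vmon m ratvar g" by simp
  qed (use that g in auto)
  ultimately have "?p (THE g. ?p g)" by (rule theI)
  then show ?thesis unfolding extended_g_vector_def Let_def dims B by blast
qed

end

section \<open>The g-vector of a principal pattern\<close>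

lemma power_int_sum_exponent:
  "(x :: 'a::field) \<noteq> 0 \<Longrightarrow> x powi (\<Sum>i\<in>I. f i) = (\<Prod>i\<in>I. x powi f i)"
  by (induction I rule: infinite_finite_induct) (simp_all add: power_int_add)

lemma mult_mat_vec_index:
  "B \<in> carrier_mat m n \<Longrightarrow> c \<in> carrier_vec n \<Longrightarrow> i < m \<Longrightarrow> (B *\<^sub>v c) $ i = (\<Sum>k<n. B $$ (i, k) * c $ k)"
  by (simp add: scalar_prod_def lessThan_atLeast0)

lemma vmon_yhat:
  assumes "B \<in> carrier_mat m n" "c \<in> carrier_vec n" "\<And>i. i < m \<Longrightarrow> x i \<noteq> 0"
  shows "vmon n (yhat x B) c = vmon m x (B *\<^sub>v c)"
proof -
  have "dim_row B = m" using assms by auto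
  then have "vmon n (yhat x B) c = (\<Prod>k<n. \<Prod>i<m. x i powi (B $$ (i, k) * c $ k))"
    by (simp add: vmon_def yhat_def prod_power_int power_int_mult)
  also have "\<dots> = (\<Prod>i<m. \<Prod>k<n. x i powi (B $$ (i, k) * c $ k))" by (rule prod.swap)
  also have "\<dots> = vmon m x (B *\<^sub>v c)"
    unfolding vmon_def using assms
    by (intro prod.cong)
       (simp_all add: mult_mat_vec_index[OF assms(1,2)] power_int_sum_exponent del: index_mult_mat_vec)
  finally show ?thesis .
qed

lemma monomial_degree_index:
  assumes "B0 \<in> carrier_mat n n" "k < n"
  shows "monomial_degree B0 e $ k = e $ k - (\<Sum>i<n. B0 $$ (k, i) * e $ (n + i))"
proof -
  have n: "dim_col B0 = n" using assms by auto
  let ?f = "\<lambda>i. e $ i * variable_degree B0 i $ k"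
  have "monomial_degree B0 e $ k = (\<Sum>i=0..<2 * n. ?f i)"
    using assms(2) by (simp add: monomial_degree_def Let_def n lessThan_atLeast0)
  also have "\<dots> = (\<Sum>i=0..<n. ?f i) + (\<Sum>i=n..<2 * n. ?f i)"
    by (rule sum.atLeastLessThan_concat[symmetric]) auto
  also have "(\<Sum>i=0..<n. ?f i) = (\<Sum>i=0..<n. if i = k then e $ i else 0)"
    using assms(2) by (intro sum.cong) (auto simp: variable_degree_def Let_def n)
  also have "\<dots> = e $ k" using assms(2) by simp
  also have "(\<Sum>i=n..<2 * n. ?f i) = (\<Sum>i=0..<n. ?f (i + n))"
    using sum.shift_bounds_nat_ivl[of ?f 0 n n] by (simp add: mult_2)
  also have "\<dots> = (\<Sum>i=0..<n. - (B0 $$ (k, i) * e $ (n + i)))"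
  proof (intro sum.cong refl)
    fix i assume "i \<in> {0..<n}"
    then show "?f (i + n) = - (B0 $$ (k, i) * e $ (n + i))"
      using assms by (simp add: variable_degree_def Let_def n add.commute)
  qed
  finally show ?thesis by (simp add: sum_negf lessThan_atLeast0)
qed

lemma principal_mult_index:
  assumes "B0 \<in> carrier_mat n n" "c \<in> carrier_vec n" "k < n"
  shows "(principal_extension B0 *\<^sub>v c) $ k = (\<Sum>i<n. B0 $$ (k, i) * c $ i)"
    and "(principal_extension B0 *\<^sub>v c) $ (n + k) = c $ k"
proof -
  note idx = mult_mat_vec_index[OF principal_extension_carrier[OF assms(1)] assms(2)]
  show "(principal_extension B0 *\<^sub>v c) $ k = (\<Sum>i<n. B0 $$ (k, i) * c $ i)"
    using assms by (subst idx) (auto simp: principal_extension_index[OF assms(1)] intro!: sum.cong)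
  have "(principal_extension B0 *\<^sub>v c) $ (n + k) = (\<Sum>i<n. principal_extension B0 $$ (n + k, i) * c $ i)"
    using assms by (intro idx) auto
  also have "\<dots> = (\<Sum>i<n. if i = k then c $ i else 0)"
    using assms by (intro sum.cong) (auto simp: principal_extension_index[OF assms(1)])
  finally show "(principal_extension B0 *\<^sub>v c) $ (n + k) = c $ k" using assms by simp
qed

lemma principal_mult_carrier:
  "B0 \<in> carrier_mat n n \<Longrightarrow> principal_extension B0 *\<^sub>v c \<in> carrier_vec (2 * n)"
  by (metis carrier_matD(1) carrier_vecI dim_mult_mat_vec principal_extension_carrier)

lemma principal_mult_inj:
  assumes "B0 \<in> carrier_mat n n"
  shows "inj_on (\<lambda>c. principal_extension B0 *\<^sub>v c) (carrier_vec n)"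
proof
  fix c d assume "c \<in> carrier_vec n" "d \<in> carrier_vec n"
    "principal_extension B0 *\<^sub>v c = principal_extension B0 *\<^sub>v d"
  then show "c = d"
    using principal_mult_index(2)[OF assms, of c] principal_mult_index(2)[OF assms, of d]
    by (intro eq_vecI) auto
qed

context cluster_vertex
begin

lemma laurent_eval_y_hat:
  assumes "keys G \<subseteq> carrier_vec n"
  shows "laurent_eval n (y_hat Bp) G = lin (vmon (2 * n) ratvar \<circ> (\<lambda>c. Bp *\<^sub>v c)) G"
  unfolding laurent_eval_lin y_hat_yhat
  using assms vmon_yhat[OF principal_extension_carrier[OF B0], of _ ratvar]
  by (intro lin_cong) (auto simp: subset_iff)

text \<open>The identity block of \<open>Bp\<close> recovers \<open>c\<close> from
  \<open>Bp *\<^sub>v c\<close>, so distinct monomials in the y-hats are distinct Laurent monomials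
  in the initial variables.\<close>

lemma laurent_eval_y_hat_unique:
  assumes G: "keys G \<subseteq> carrier_vec n"
    and eq: "laurent_eval n (y_hat Bp) G = laurent_eval n (y_hat Bp) F"
  shows "G = F"
proof -
  let ?f = "\<lambda>c. Bp *\<^sub>v c"
  have keys: "keys (G - F) \<subseteq> carrier_vec n"
    using G keys_F_polynomial keys_diff[of G F] by blast
  have "lin (vmon (2 * n) ratvar) (push ?f (G - F)) = 0"
    using eq unfolding lin_push laurent_eval_y_hat[OF G] laurent_eval_y_hat[OF keys_F_polynomial]
    by (simp add: lin_diff)
  moreover have "keys (push ?f (G - F)) \<subseteq> carrier_vec (2 * n)"
    using keys_push[of ?f "G - F"] principal_mult_carrier[OF B0] by blast
  ultimately have "push ?f (G - F) = 0"
    by (intro laurent_independent[of _ "2 * n"]) (simp_all add: laurent_eval_lin)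
  then show ?thesis using push_eq_0_iff[OF principal_mult_inj[OF B0] keys] by simp
qed

text \<open>By the separation formula all exponents have the form \<open>Bp *\<^sub>v c + h\<close>
  with one fixed h. The y-hats have degree zero, so the common degree is that of h; the expansion is
  nonzero, which makes it the only candidate for the g-vector.\<close>

lemma principal_expansion_homogeneous:
  shows "g_vector B0 t0 t j \<in> carrier_vec n"
    and "e \<in> keys P \<Longrightarrow> monomial_degree B0 e = g_vector B0 t0 t j"
proof -
  have "principal_part n Bp = B0"
    using B0 by (intro eq_matI) (auto simp: principal_part_def principal_extension_index[OF B0])
  from separation[OF positive_seed_principal[OF B0 skew] this] obtain h
    where h: "h \<in> carrier_vec (2 * n)"
    "cluster_variable Bp t0 t j = laurent_eval n (y_hat Bp) F * vmon (2 * n) ratvar h" by blast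
  let ?f = "\<lambda>c. Bp *\<^sub>v c + h"
  have "laurent_eval (2 * n) ratvar P = lin (vmon (2 * n) ratvar \<circ> ?f) F"
    unfolding principal_expansion(2)[symmetric] h(2) laurent_eval_y_hat[OF keys_F_polynomial]
    unfolding lin_def sum_distrib_right using h(1)
    by (intro sum.cong refl) (simp add: vmon_add mult.assoc)
  then have "laurent_eval (2 * n) ratvar P = laurent_eval (2 * n) ratvar (push ?f F)"
    by (simp add: laurent_eval_lin lin_push)
  moreover have "keys (push ?f F) \<subseteq> carrier_vec (2 * n)"
    using keys_push[of ?f F] principal_mult_carrier[OF B0] h(1) by fastforce
  ultimately have P: "P = push ?f F"
    using principal_expansion(1) by (intro laurent_eval_unique[of P "2 * n"]) auto
  define g where "g = vec n (\<lambda>k. h $ k - (\<Sum>i<n. B0 $$ (k, i) * h $ (n + i)))"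
  have deg: "monomial_degree B0 e = g" if e: "e \<in> keys P" for e
  proof -
    obtain c where c: "c \<in> carrier_vec n" "e = Bp *\<^sub>v c + h"
      using e keys_push[of ?f F] keys_F_polynomial unfolding P by blast
    show ?thesis
    proof (rule eq_vecI)
      show "dim_vec (monomial_degree B0 e) = dim_vec g"
        using B0 by (simp add: monomial_degree_def g_def Let_def)
      fix k assume "k < dim_vec g"
      then have k: "k < n" by (simp add: g_def)
      have "e $ k = (\<Sum>i<n. B0 $$ (k, i) * c $ i) + h $ k"
        using h(1) k principal_mult_index(1)[OF B0 c(1) k] unfolding c(2) by simp
      moreover have "e $ (n + i) = c $ i + h $ (n + i)" if "i < n" for i
        using h(1) that principal_mult_index(2)[OF B0 c(1) that] unfolding c(2) by simp
      ultimately show "monomial_degree B0 e $ k = g $ k"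
        using k by (simp add: monomial_degree_index[OF B0] g_def sum.distrib distrib_left)
    qed
  qed
  have "P \<noteq> 0"
    using cluster_variable_nonzero[OF positive_seed_principal[OF B0 skew]] principal_expansion(2)
    by (auto simp: laurent_eval_lin)
  then obtain e0 where "e0 \<in> keys P" by fastforce
  then have g: "g_vector B0 t0 t j = g"
    unfolding g_vector_def using deg by (intro the_equality) auto
  then show "g_vector B0 t0 t j \<in> carrier_vec n" by (simp add: g_def)
  show "e \<in> keys P \<Longrightarrow> monomial_degree B0 e = g_vector B0 t0 t j" using deg g by simp
qed

text \<open>The last n entries of an exponent e are the exponent c in F, and the first n entries
  differ from B0 c by the degree. Hence e is \<open>Bp *\<^sub>v c\<close> plus the g-vector
  followed by zeros.\<close>

lemma principal_formula:
  "cluster_variable Bp t0 t j =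
    laurent_eval n (y_hat Bp) F * vmon (2 * n) ratvar (g_vector B0 t0 t j @\<^sub>v 0\<^sub>v n)"
proof -
  let ?g = "g_vector B0 t0 t j"
  have g: "?g \<in> carrier_vec n" by (rule principal_expansion_homogeneous(1))
  have e: "vmon (2 * n) ratvar e = vmon (2 * n) ratvar (Bp *\<^sub>v vec_last e n) * vmon (2 * n) ratvar (?g @\<^sub>v 0\<^sub>v n)"
    if "e \<in> keys P" for e
  proof -
    have ec: "e \<in> carrier_vec (2 * n)" using that principal_expansion(1) by blast
    let ?c = "vec_last e n"
    have c: "?c \<in> carrier_vec n" by simp
    have ci: "?c $ i = e $ (n + i)" if "i < n" for i using that ec by (simp add: vec_last_def)
    have "e = Bp *\<^sub>v ?c + (?g @\<^sub>v 0\<^sub>v n)"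
    proof (rule eq_vecI)
      show "dim_vec e = dim_vec (Bp *\<^sub>v ?c + (?g @\<^sub>v 0\<^sub>v n))" using ec g by simp
      fix i assume "i < dim_vec (Bp *\<^sub>v ?c + (?g @\<^sub>v 0\<^sub>v n))"
      then have i: "i < 2 * n" using g by simp
      show "e $ i = (Bp *\<^sub>v ?c + (?g @\<^sub>v 0\<^sub>v n)) $ i"
      proof (cases "i < n")
        case True
        have "?g $ i = e $ i - (\<Sum>k<n. B0 $$ (i, k) * e $ (n + k))"
          using principal_expansion_homogeneous(2)[OF that] monomial_degree_index[OF B0 True, of e] by simp
        then show ?thesis
          using True i g principal_mult_index(1)[OF B0 c True] by (simp add: ci)
      next
        case False
        then obtain k where k: "i = n + k" "k < n" using i by (metis add_less_cancel_left le_Suc_ex mult_2 not_less)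
        then show ?thesis using g principal_mult_index(2)[OF B0 c k(2)] by (simp add: ci)
      qed
    qed
    then show ?thesis using g vmon_add[of "2 * n" ratvar "?g @\<^sub>v 0\<^sub>v n" "Bp *\<^sub>v ?c"] by simp
  qed
  have "cluster_variable Bp t0 t j = lin (vmon (2 * n) ratvar) P"
    using principal_expansion(2) by (simp add: laurent_eval_lin)
  also have "\<dots> = (\<Sum>e\<in>keys P. of_int (lookup P e) * vmon (2 * n) ratvar (Bp *\<^sub>v vec_last e n)) *
      vmon (2 * n) ratvar (?g @\<^sub>v 0\<^sub>v n)"
    unfolding lin_def sum_distrib_right mult.assoc using e by (intro sum.cong refl) simp
  also have "(\<Sum>e\<in>keys P. of_int (lookup P e) * vmon (2 * n) ratvar (Bp *\<^sub>v vec_last e n)) =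
      laurent_eval n (y_hat Bp) F"
    unfolding laurent_eval_y_hat[OF keys_F_polynomial]
    unfolding F_polynomial_push lin_push by (simp add: lin_def)
  finally show ?thesis .
qed

end

section \<open>Frames of quantum tori\<close>

text \<open>The form is a function rather than a matrix, so that an antihomomorphic image can carry
  the opposite form. Independence is not demanded: Laurent monomials of a commutative cluster form a
  frame with v = 1 and any \<open>L\<close>.\<close>

definition twisted_frame ::
  "nat \<Rightarrow> 'f::division_ring \<Rightarrow> (int vec \<Rightarrow> int vec \<Rightarrow> int) \<Rightarrow> (int vec \<Rightarrow> 'f) \<Rightarrow> bool" where
  "twisted_frame m v L M \<longleftrightarrow> v \<noteq> 0 \<and> (\<forall>z. v * z = z * v) \<and> M (0\<^sub>v m) = 1 \<and>
     (\<forall>c\<in>carrier_vec m. \<forall>d\<in>carrier_vec m. M c * M d = v powi L c d * M (c + d))"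

lemma power_int_central:
  fixes v :: "'f::division_ring"
  assumes "\<And>z. v * z = z * v"
  shows "v powi k * z = z * v powi k"
proof -
  have *: "w ^ i * z = z * w ^ i" if "\<And>z. w * z = z * w" for w z :: 'f and i
  proof (induction i)
    case (Suc i)
    have "w ^ Suc i * z = w * (z * w ^ i)" using Suc by (simp add: mult.assoc)
    also have "\<dots> = z * w ^ Suc i" using that[of z] by (simp add: mult.assoc[symmetric])
    finally show ?case .
  qed simp
  have inv: "inverse v * z = z * inverse v" for z
  proof (cases "v = 0")
    case False
    have "inverse v * z = inverse v * (z * v) * inverse v" using False by (simp add: mult.assoc)
    also have "\<dots> = z * inverse v" using False by (simp add: assms[symmetric] mult.assoc[symmetric])
    finally show ?thesis .
  qed simp
  show ?thesis using *[OF assms] *[OF inv] by (simp add: power_int_def)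
qed

lemma q_coeff_eval_add: "q_coeff_eval v (a + b) = q_coeff_eval v a + q_coeff_eval v b"
  by (simp add: q_coeff_eval_lin lin_add)

lemma q_coeff_eval_diff: "q_coeff_eval v (a - b) = q_coeff_eval v a - q_coeff_eval v b"
  by (simp add: q_coeff_eval_lin lin_diff)

lemma q_coeff_eval_0 [simp]: "q_coeff_eval v 0 = 0"
  by (simp add: q_coeff_eval_lin)

lemma q_coeff_eval_single [simp]: "q_coeff_eval v (single r a) = of_int a * v powi r"
  by (simp add: q_coeff_eval_lin)

lemma q_coeff_eval_1 [simp]: "q_coeff_eval v 1 = 1"
  using q_coeff_eval_single[of v 0 1] by simp

lemma q_coeff_eval_central:
  assumes "\<And>z. v * z = z * v" shows "q_coeff_eval v a * z = z * q_coeff_eval v a"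
  using subset_UNIV[of "keys a"]
proof (induction a rule: poly_mapping_keys_induct)
  case (add p r a)
  have "of_int a * v powi r * z = z * (of_int a * v powi r)"
    using power_int_central[OF assms, of r z] by (metis mult.assoc mult_of_int_commute)
  with add show ?case by (simp add: q_coeff_eval_add distrib_left distrib_right)
qed simp

lemma q_coeff_eval_mult:
  assumes "v \<noteq> 0" shows "q_coeff_eval v (a * b) = q_coeff_eval v a * q_coeff_eval v b"
proof -
  have 0: "q_coeff_eval v (single r a * single s b) =
      of_int a * v powi r * (of_int b * v powi s)" for r a s b
  proof -
    have "of_int a * v powi r * (of_int b * v powi s) = of_int a * (v powi r * of_int b) * v powi s"
      by (simp only: mult.assoc)
    also have "v powi r * of_int b = of_int b * v powi r" by (simp only: mult_of_int_commute)
    finally have eq: "of_int a * v powi r * (of_int b * v powi s) = of_int a * (of_int b * v powi r) * v powi s" .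
    show ?thesis unfolding eq using assms by (simp add: mult_single power_int_add mult.assoc)
  qed
  have *: "q_coeff_eval v (a * single s b) = q_coeff_eval v a * (of_int b * v powi s)" for a s b
    using subset_UNIV[of "keys a"]
    by (induction a rule: poly_mapping_keys_induct) (simp_all add: distrib_right q_coeff_eval_add 0)
  show ?thesis
    using subset_UNIV[of "keys b"]
    by (induction b rule: poly_mapping_keys_induct) (simp_all add: distrib_left q_coeff_eval_add *)
qed

definition torus_graph ::
  "nat \<Rightarrow> 'f::division_ring \<Rightarrow> (int vec \<Rightarrow> 'f) \<Rightarrow> 'e::division_ring \<Rightarrow> (int vec \<Rightarrow> 'e) \<Rightarrow> ('f \<times> 'e) set" where
  "torus_graph m v M v' N =
    (\<lambda>a. (q_combination v M a, q_combination v' N a)) ` {a. keys a \<subseteq> carrier_vec m}"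

lemma torus_graphI:
  "keys a \<subseteq> carrier_vec m \<Longrightarrow> (q_combination v M a, q_combination v' N a) \<in> torus_graph m v M v' N"
  unfolding torus_graph_def by blast

lemma torus_graph_single:
  "e \<in> carrier_vec m \<Longrightarrow> (q_coeff_eval v a * M e, q_coeff_eval v' a * N e) \<in> torus_graph m v M v' N"
  using torus_graphI[of "single e a" m v M v' N] by (simp split: if_splits)

lemma torus_graph_add:
  assumes "(a, a') \<in> torus_graph m v M v' N" "(b, b') \<in> torus_graph m v M v' N"
  shows "(a + b, a' + b') \<in> torus_graph m v M v' N"
proof -
  obtain p q where pq: "keys p \<subseteq> carrier_vec m" "a = q_combination v M p" "a' = q_combination v' N p"
    "keys q \<subseteq> carrier_vec m" "b = q_combination v M q" "b' = q_combination v' N q"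
    using assms unfolding torus_graph_def by blast
  have "keys (p + q) \<subseteq> carrier_vec m" using pq keys_add[of p q] by blast
  from torus_graphI[OF this, of v M v' N] show ?thesis by (simp add: pq q_combination_add)
qed

lemma torus_graph_uminus:
  assumes "(a, a') \<in> torus_graph m v M v' N"
  shows "(- a, - a') \<in> torus_graph m v M v' N"
proof -
  obtain p where p: "keys p \<subseteq> carrier_vec m" "a = q_combination v M p" "a' = q_combination v' N p"
    using assms unfolding torus_graph_def by blast
  have "keys (- p) = keys p" by (auto simp: in_keys_iff)
  then show ?thesis using torus_graphI[of "- p" m v M v' N] p by (simp add: q_combination_uminus)
qed

lemma twisted_frame_coeff_mult:
  assumes M: "twisted_frame m v L M" and ef: "e \<in> carrier_vec m" "f \<in> carrier_vec m"
  shows "q_coeff_eval v \<alpha> * M e * (q_coeff_eval v \<beta> * M f) =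
    q_coeff_eval v (\<alpha> * \<beta> * single (L e f) 1) * M (e + f)"
proof -
  have v: "v \<noteq> 0" "\<And>z. v * z = z * v" using M unfolding twisted_frame_def by blast+
  have "q_coeff_eval v \<alpha> * M e * (q_coeff_eval v \<beta> * M f) = q_coeff_eval v \<alpha> * (M e * q_coeff_eval v \<beta>) * M f"
    by (simp only: mult.assoc)
  also have "M e * q_coeff_eval v \<beta> = q_coeff_eval v \<beta> * M e"
    by (rule q_coeff_eval_central[OF v(2), symmetric])
  also have "q_coeff_eval v \<alpha> * (q_coeff_eval v \<beta> * M e) * M f = q_coeff_eval v \<alpha> * q_coeff_eval v \<beta> * (M e * M f)"
    by (simp only: mult.assoc)
  also have "M e * M f = v powi L e f * M (e + f)" using M ef unfolding twisted_frame_def by blast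
  finally show ?thesis unfolding q_coeff_eval_mult[OF v(1)] by (simp add: mult.assoc)
qed

text \<open>The second frame carries the opposite form, so M e M f and N f N e both produce the
  exponent L e f. Centrality of v lets the coefficients pass.\<close>

lemma torus_graph_mult:
  assumes M: "twisted_frame m v L M" and N: "twisted_frame m v' (\<lambda>c d. L d c) N"
    and a: "(a, a') \<in> torus_graph m v M v' N" and b: "(b, b') \<in> torus_graph m v M v' N"
  shows "(a * b, b' * a') \<in> torus_graph m v M v' N"
proof -
  let ?G = "torus_graph m v M v' N"
  have 0: "(0, 0) \<in> ?G" using torus_graphI[of 0 m v M v' N] by simp
  have singles: "(q_coeff_eval v \<alpha> * M e * (q_coeff_eval v \<beta> * M f),
      q_coeff_eval v' \<beta> * N f * (q_coeff_eval v' \<alpha> * N e)) \<in> ?G"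
    if ef: "e \<in> carrier_vec m" "f \<in> carrier_vec m" for e f \<alpha> \<beta>
  proof -
    note 1 = twisted_frame_coeff_mult[OF M ef, of \<alpha> \<beta>]
    note 2 = twisted_frame_coeff_mult[OF N ef(2,1), of \<beta> \<alpha>, unfolded mult.commute[of \<beta> \<alpha>] comm_add_vec[OF ef(2,1)]]
    show ?thesis unfolding 1 2 using ef by (intro torus_graph_single) simp
  qed
  have left: "(q_combination v M p * (q_coeff_eval v \<beta> * M f), q_coeff_eval v' \<beta> * N f * q_combination v' N p) \<in> ?G"
    if "keys p \<subseteq> carrier_vec m" "f \<in> carrier_vec m" for p f \<beta>
    using that(1)
  proof (induction p rule: poly_mapping_keys_induct)
    case (add p e \<alpha>)
    from torus_graph_add[OF add.IH singles[OF add.hyps(2) that(2), of \<alpha> \<beta>]]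
    show ?case by (simp add: q_combination_add distrib_left distrib_right)
  qed (simp add: 0)
  obtain p q where pq: "keys p \<subseteq> carrier_vec m" "a = q_combination v M p" "a' = q_combination v' N p"
    "keys q \<subseteq> carrier_vec m" "b = q_combination v M q" "b' = q_combination v' N q"
    using a b unfolding torus_graph_def by blast
  show ?thesis unfolding pq(2,3,5,6) using pq(4)
  proof (induction q rule: poly_mapping_keys_induct)
    case (add q f \<beta>)
    from torus_graph_add[OF add.IH left[OF pq(1) add.hyps(2), of \<beta>]]
    show ?case by (simp add: q_combination_add distrib_left distrib_right)
  qed (simp add: 0)
qed

text \<open>What a toric frame inherits from the ambient torus, with the automorphism and the
  lattice isomorphism no longer visible.\<close>

definition quantum_torus ::
  "nat \<Rightarrow> 'f::division_ring \<Rightarrow> (int vec \<Rightarrow> int vec \<Rightarrow> int) \<Rightarrow> (int vec \<Rightarrow> 'f) \<Rightarrow> bool" where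
  "quantum_torus m v L M \<longleftrightarrow> twisted_frame m v L M \<and>
     (\<forall>c\<in>carrier_vec m. \<forall>d\<in>carrier_vec m. L d c = - L c d) \<and>
     (\<forall>a. keys a \<subseteq> carrier_vec m \<longrightarrow> q_combination v M a = 0 \<longrightarrow> a = 0) \<and>
     (\<forall>z. \<exists>a b. keys a \<subseteq> carrier_vec m \<and> keys b \<subseteq> carrier_vec m \<and> b \<noteq> 0 \<and>
        z = q_combination v M a * inverse (q_combination v M b))"

lemma quantum_torusD:
  assumes "quantum_torus m v L M"
  shows "twisted_frame m v L M" "v \<noteq> 0" "v * z = z * v"
    "c \<in> carrier_vec m \<Longrightarrow> d \<in> carrier_vec m \<Longrightarrow> L d c = - L c d"
    "keys a \<subseteq> carrier_vec m \<Longrightarrow> q_combination v M a = 0 \<Longrightarrow> a = 0"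
    "\<exists>a b. keys a \<subseteq> carrier_vec m \<and> keys b \<subseteq> carrier_vec m \<and> b \<noteq> 0 \<and>
        z = q_combination v M a * inverse (q_combination v M b)"
  using assms unfolding quantum_torus_def twisted_frame_def by blast+

text \<open>Writing b^-1 c as a right fraction yields the Ore condition with a nonzero f. The
  assumption \<open>ore\<close> isolates the remaining task: to replace f by one whose image is
  nonzero.\<close>

lemma antihom_graph_torus:
  assumes M: "quantum_torus m v L M" and N: "twisted_frame m v' (\<lambda>c d. L d c) N"
    and ore: "\<And>b c e f. keys b \<subseteq> carrier_vec m \<Longrightarrow> keys c \<subseteq> carrier_vec m \<Longrightarrow>
      keys e \<subseteq> carrier_vec m \<Longrightarrow> keys f \<subseteq> carrier_vec m \<Longrightarrow>
      q_combination v' N b \<noteq> 0 \<Longrightarrow> f \<noteq> 0 \<Longrightarrow>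
      q_combination v M c * q_combination v M f = q_combination v M b * q_combination v M e \<Longrightarrow>
      \<exists>e f. keys e \<subseteq> carrier_vec m \<and> keys f \<subseteq> carrier_vec m \<and> q_combination v' N f \<noteq> 0 \<and>
      q_combination v M c * q_combination v M f = q_combination v M b * q_combination v M e"
  shows "antihom_graph (torus_graph m v M v' N)"
proof
  let ?G = "torus_graph m v M v' N"
  note tw = quantum_torusD(1)[OF M]
  show "(1, 1) \<in> ?G"
    using torus_graph_single[of "0\<^sub>v m" m v 1 M v' N] tw N by (simp add: twisted_frame_def)
  show "(a + b, a' + b') \<in> ?G" "(a * b, b' * a') \<in> ?G" if "(a, a') \<in> ?G" "(b, b') \<in> ?G" for a a' b b'
    using torus_graph_add torus_graph_mult[OF tw N] that by blast+
  show "(- a, - a') \<in> ?G" if "(a, a') \<in> ?G" for a a' using that by (rule torus_graph_uminus)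
  show "w = 0" if "(0, w) \<in> ?G" for w
    using that quantum_torusD(5)[OF M] unfolding torus_graph_def by fastforce
  fix b b' c c' assume b: "(b, b') \<in> ?G" "b' \<noteq> 0" and c: "(c, c') \<in> ?G"
  obtain p q where pq: "keys p \<subseteq> carrier_vec m" "b = q_combination v M p" "b' = q_combination v' N p"
    "keys q \<subseteq> carrier_vec m" "c = q_combination v M q" "c' = q_combination v' N q"
    using b c unfolding torus_graph_def by blast
  obtain e f where ef: "keys e \<subseteq> carrier_vec m" "keys f \<subseteq> carrier_vec m" "f \<noteq> 0"
    "inverse b * c = q_combination v M e * inverse (q_combination v M f)"
    using quantum_torusD(6)[OF M] by blast
  have "q_combination v M f \<noteq> 0" using quantum_torusD(5)[OF M ef(2)] ef(3) by blast
  moreover have "b \<noteq> 0"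
    using quantum_torusD(5)[OF M pq(1)] b(2) pq(2,3) by auto
  ultimately have "c * q_combination v M f = b * q_combination v M e"
  proof -
    assume f: "q_combination v M f \<noteq> 0" and b0: "b \<noteq> 0"
    have "c * q_combination v M f = b * (inverse b * c) * q_combination v M f"
      using b0 by (simp add: mult.assoc[symmetric])
    also have "\<dots> = b * q_combination v M e" unfolding ef(4) using f by (simp add: mult.assoc)
    finally show ?thesis .
  qed
  from ore[OF pq(1,4) ef(1,2) _ ef(3) this[unfolded pq(2,5)]] b(2)
  show "\<exists>e e' f f'. (e, e') \<in> ?G \<and> (f, f') \<in> ?G \<and> f' \<noteq> 0 \<and> c * f = b * e"
    unfolding pq(2,3,5) using torus_graphI by blast
qed

section \<open>The bar involution\<close>

lemma bar_0 [simp]: "bar 0 = 0"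
  using bar_single[of _ 0 0] by simp

lemma q_laurent_induct [consumes 1, case_names zero add]:
  assumes "keys a \<subseteq> S" "P 0"
    and "\<And>a e r c. keys a \<subseteq> S \<Longrightarrow> e \<in> S \<Longrightarrow> P a \<Longrightarrow>
      P (a + single e (single r c))"
  shows "P (a :: q_laurent)"
  using assms(1)
proof (induction a rule: poly_mapping_keys_induct)
  case (add p e \<alpha>)
  have sub: "keys (p + single e \<beta>) \<subseteq> S" for \<beta>
    using keys_add[of p "single e \<beta>"] add.hyps by (auto split: if_splits)
  show ?case
    using subset_UNIV[of "keys \<alpha>"]
  proof (induction \<alpha> rule: poly_mapping_keys_induct)
    case zero
    then show ?case using add.IH by simp
  next
    case (add \<beta> r c)
    from assms(3)[OF sub \<open>e \<in> S\<close> add.IH] show ?case by (simp add: single_add add.assoc)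
  qed
qed (rule assms(2))

lemma bar_bar [simp]: "bar (bar a) = a"
  using subset_UNIV[of "keys a"]
  by (induction a rule: q_laurent_induct) (simp_all add: bar_add bar_single)

lemma keys_bar [simp]: "keys (bar a) = keys a"
proof -
  have *: "keys (bar a) \<subseteq> keys a" for a
    unfolding bar_def by (auto simp: in_keys_iff Poly_Mapping.map.rep_eq when_def)
  from *[of a] *[of "bar a"] show ?thesis by simp
qed

text \<open>Thus the bar involution is a change of the parameter from v to its inverse, with the
  same frame, and fits the general graph of two tori.\<close>

lemma q_combination_inverse: "q_combination (inverse v) M a = q_combination v M (bar a)"
  using subset_UNIV[of "keys a"]
  by (induction a rule: q_laurent_induct)
     (simp_all add: bar_add bar_single q_combination_add power_int_inverse power_int_minus)

text \<open>Inverting v is compensated by exchanging the arguments of a skew-symmetric form.\<close>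

lemma twisted_frame_bar:
  assumes M: "quantum_torus m v L M"
  shows "twisted_frame m (inverse v) (\<lambda>c d. L d c) M"
proof -
  have "inverse v powi L d c = v powi L c d" if "c \<in> carrier_vec m" "d \<in> carrier_vec m" for c d
    using quantum_torusD(4)[OF M that] by (simp add: power_int_inverse power_int_minus)
  moreover have "inverse v * z = z * inverse v" for z
    using power_int_central[OF quantum_torusD(3)[OF M], of "- 1" z] by (simp add: power_int_minus)
  ultimately show ?thesis
    using quantum_torusD(1)[OF M] unfolding twisted_frame_def by simp
qed

lemma antihom_graph_bar:
  assumes M: "quantum_torus m v L M"
  shows "antihom_graph (torus_graph m v M (inverse v) M)"
proof (rule antihom_graph_torus[OF M twisted_frame_bar[OF M]])
  fix b c e f
  assume *: "keys e \<subseteq> carrier_vec m" "keys f \<subseteq> carrier_vec m" "f \<noteq> 0"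
    "q_combination v M c * q_combination v M f = q_combination v M b * q_combination v M e"
  have "q_combination (inverse v) M f \<noteq> 0"
    using quantum_torusD(5)[OF M, of "bar f"] *(2,3) unfolding q_combination_inverse keys_bar
    by (metis bar_0 bar_bar)
  with * show "\<exists>e f. keys e \<subseteq> carrier_vec m \<and> keys f \<subseteq> carrier_vec m \<and>
      q_combination (inverse v) M f \<noteq> 0 \<and>
      q_combination v M c * q_combination v M f = q_combination v M b * q_combination v M e" by blast
qed

section \<open>Specialization at \<open>q = 1\<close>\<close>

text \<open>
  In the Ore condition for the specialization, common factors \<open>q\<^sup>1\<^sup>/\<^sup>2 - 1\<close> have to be cancelled; the
  width of the support shows that this ends.
\<close>

lemma q_coeff_width_decreases:
  fixes \<beta> :: q_coeff
  assumes "\<beta> \<noteq> 0"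
  defines "\<alpha> \<equiv> (single 1 1 - 1) * \<beta>"
  defines "width \<equiv> \<lambda>\<gamma> :: q_coeff. Max (keys \<gamma>) - Min (keys \<gamma>)"
  shows "width \<beta> < width \<alpha>" "0 \<le> width \<beta>"
proof -
  have shift: "lookup (single 1 1 * \<beta>) r = lookup \<beta> (r - 1)" for r
    using subset_UNIV[of "keys \<beta>"]
    by (induction \<beta> rule: poly_mapping_keys_induct)
       (auto simp: distrib_left lookup_add mult_single lookup_single when_def)
  have \<alpha>: "lookup \<alpha> r = lookup \<beta> (r - 1) - lookup \<beta> r" for r
    unfolding \<alpha>_def by (simp add: left_diff_distrib lookup_minus shift)
  let ?K = "keys \<beta>"
  have ne: "?K \<noteq> {}" using assms(1) by simp
  have max: "Max ?K \<in> ?K" "Max ?K + 1 \<notin> ?K" and min: "Min ?K \<in> ?K" "Min ?K - 1 \<notin> ?K"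
    using ne Max_ge[of ?K "Max ?K + 1"] Min_le[of ?K "Min ?K - 1"] by auto
  \<comment> \<open>Multiplication by u - 1 keeps the lowest exponent and raises the highest by one;
    no cancellation is possible at either end.\<close>
  have "Max ?K + 1 \<in> keys \<alpha>" "Min ?K \<in> keys \<alpha>"
    using max min by (auto simp: in_keys_iff \<alpha>)
  then have "Max ?K + 1 \<le> Max (keys \<alpha>)" "Min (keys \<alpha>) \<le> Min ?K" by auto
  then show "width \<beta> < width \<alpha>" unfolding width_def by linarith
  show "0 \<le> width \<beta>" unfolding width_def using ne Max_ge[of ?K "Min ?K"] min by simp
qed

text \<open>The factor theorem at u = 1 for Laurent polynomials in u = q^(1/2): each u^r - 1, also
  for negative r, is a multiple of u - 1.\<close>

lemma q_coeff_divisible: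
  assumes "lin (\<lambda>_. 1) \<alpha> = (0 :: int)"
  shows "\<exists>\<beta>. \<alpha> = (single 1 1 - 1) * (\<beta> :: q_coeff)"
proof -
  let ?u = "single 1 1 :: q_coeff"
  have mono: "\<exists>\<beta>. single r 1 - 1 = (?u - 1) * \<beta>" for r :: int
  proof (induction r rule: int_induct[where k = 0])
    case base
    show ?case by (intro exI[of _ 0]) simp
  next
    case (step1 i)
    then obtain \<beta> where b: "single i 1 - 1 = (?u - 1) * \<beta>" by blast
    have "?u * (single i 1 - 1) + (?u - 1) = single (i + 1) 1 - 1"
      by (simp add: mult_single algebra_simps)
    then have "single (i + 1) 1 - 1 = (?u - 1) * (?u * \<beta> + 1)"
      unfolding b by (simp add: algebra_simps)
    then show ?case by blast
  next
    case (step2 i)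
    then obtain \<beta> where b: "single i 1 - 1 = (?u - 1) * \<beta>" by blast
    let ?w = "single (- 1) 1 :: q_coeff"
    have "?w * ?u = 1" by (simp add: mult_single)
    then have "?w * (single i 1 - 1) - (?u - 1) * ?w = single (i - 1) 1 - 1"
      by (simp add: mult_single algebra_simps)
    then have "single (i - 1) 1 - 1 = (?u - 1) * (?w * \<beta> - ?w)"
      unfolding b by (simp add: algebra_simps)
    then show ?case by blast
  qed
  have "\<exists>\<beta>. \<alpha> - of_int (lin (\<lambda>_. 1) \<alpha>) = (?u - 1) * \<beta>" for \<alpha> :: q_coeff
    using subset_UNIV[of "keys \<alpha>"]
  proof (induction \<alpha> rule: poly_mapping_keys_induct)
    case (add p r c)
    then obtain \<beta> where b: "p - of_int (lin (\<lambda>_. 1) p) = (?u - 1) * \<beta>" by blast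
    obtain \<gamma> where g: "single r 1 - 1 = (?u - 1) * \<gamma>" using mono by blast
    have single: "single r c = of_int c * (single r 1 :: q_coeff)"
      by (simp add: mult_single flip: single_of_int)
    have l: "lin (\<lambda>_. 1) (p + single r c) = lin (\<lambda>_. 1) p + c" by (simp add: lin_add)
    have "p + single r c - of_int (lin (\<lambda>_. 1) (p + single r c)) =
        (p - of_int (lin (\<lambda>_. 1) p)) + of_int c * (single r 1 - 1)"
      unfolding l unfolding single by (simp add: algebra_simps)
    also have "\<dots> = (?u - 1) * (\<beta> + of_int c * \<gamma>)"
      unfolding b g by (simp add: algebra_simps)
    finally show ?case by blast
  qed simp
  from this[of \<alpha>] assms show ?thesis by simp
qed

lemma lookup_specialize_q1: "lookup (specialize_q1 a) e = lin (\<lambda>_. 1) (lookup a e)"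
  by (simp add: specialize_q1_def Poly_Mapping.map.rep_eq lin_def when_def)

lemma keys_specialize_q1: "keys (specialize_q1 a) \<subseteq> keys a"
  by (auto simp: in_keys_iff lookup_specialize_q1)

lemma q_combination_1: "q_combination 1 X a = lin X (specialize_q1 a)"
proof -
  have "q_coeff_eval (1 :: 'a) b = of_int (lin (\<lambda>_. 1) b)" for b
    by (simp add: q_coeff_eval_def lin_def)
  then have "q_combination 1 X a =
      (\<Sum>e\<in>keys a. of_int (lookup (specialize_q1 a) e) * X e)"
    by (simp add: q_combination_def lookup_specialize_q1)
  also have "\<dots> = lin X (specialize_q1 a)"
    unfolding lin_def using keys_specialize_q1[of a]
    by (intro sum.mono_neutral_right) (auto simp: in_keys_iff)
  finally show ?thesis .
qed

lemma specialize_q1_bar: "specialize_q1 (bar a) = specialize_q1 a"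
proof (rule poly_mapping_eqI)
  fix e
  show "lookup (specialize_q1 (bar a)) e = lookup (specialize_q1 a) e"
    unfolding lookup_specialize_q1
    using subset_UNIV[of "keys a"]
    by (induction a rule: q_laurent_induct)
       (simp_all add: bar_add bar_single lookup_add lin_add lookup_single when_def)
qed

text \<open>Independence of commutative Laurent monomials forces every single coefficient to vanish
  at q = 1, so u - 1 divides the coefficients one by one and can be pulled out.\<close>

lemma q_combination_divisible:
  assumes keys: "keys a \<subseteq> carrier_vec m"
    and 0: "q_combination 1 (vmon m ratvar) a = 0" and v: "v \<noteq> 0"
  obtains b where "keys b \<subseteq> carrier_vec m"
    "\<forall>e. lookup a e = (single 1 1 - 1) * lookup b e"
    "q_combination v M a = (v - 1) * q_combination v M b"
proof -
  have "keys (specialize_q1 a) \<subseteq> carrier_vec m" using keys keys_specialize_q1 by blast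
  moreover have "laurent_eval m ratvar (specialize_q1 a) = 0"
    using 0 by (simp add: q_combination_1 laurent_eval_lin)
  ultimately have "specialize_q1 a = 0" by (rule laurent_independent)
  then have "\<exists>\<beta>. lookup a e = (single 1 1 - 1) * \<beta>" for e
    using lookup_specialize_q1[of a e] by (intro q_coeff_divisible) simp
  then obtain \<beta> where \<beta>: "\<And>e. lookup a e = (single 1 1 - 1) * \<beta> e" by metis
  define b where "b = (\<Sum>e\<in>keys a. single e (\<beta> e))"
  have b: "keys b \<subseteq> carrier_vec m"
    unfolding b_def using keys by (intro order.trans[OF keys_sum_subset]) (auto split: if_splits)
  have lookup: "lookup b e = (if e \<in> keys a then \<beta> e else 0)" for e
    unfolding b_def lookup_sum by (simp add: lookup_single when_def)
  show ?thesis
  proof (rule that[OF b])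
    show "\<forall>e. lookup a e = (single 1 1 - 1) * lookup b e"
      using \<beta> by (auto simp: lookup in_keys_iff)
    have "q_coeff_eval v (single 1 1 - 1) = v - 1"
      unfolding q_coeff_eval_diff by simp
    then have "q_combination v M a = (\<Sum>e\<in>keys a. (v - 1) * (q_coeff_eval v (\<beta> e) * M e))"
      unfolding q_combination_def \<beta> q_coeff_eval_mult[OF v] by (simp add: mult.assoc)
    also have "\<dots> = (v - 1) * q_combination v M b"
      unfolding b_def q_combination_sum by (simp add: sum_distrib_left)
    finally show "q_combination v M a = (v - 1) * q_combination v M b" .
  qed
qed

lemma twisted_frame_vmon:
  "(\<And>i. i < m \<Longrightarrow> x i \<noteq> 0) \<Longrightarrow> twisted_frame m 1 L (vmon m x)"
  unfolding twisted_frame_def by (simp add: vmon_add)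

text \<open>Suppose f vanishes at q = 1. From c f = b e and the nonvanishing of b it follows that e
  vanishes too; then both contain the central factor v - 1, which cancels from the equation.\<close>

lemma antihom_graph_specialize:
  assumes M: "quantum_torus m v L M"
  shows "antihom_graph (torus_graph m v M 1 (vmon m ratvar))"
proof (rule antihom_graph_torus[OF M twisted_frame_vmon])
  fix b c e f
  let ?q = "q_combination v M" and ?s = "q_combination 1 (vmon m ratvar)"
  assume b: "keys b \<subseteq> carrier_vec m" "?s b \<noteq> 0" and c: "keys c \<subseteq> carrier_vec m"
    and *: "keys e \<subseteq> carrier_vec m" "keys f \<subseteq> carrier_vec m" "f \<noteq> 0"
      "?q c * ?q f = ?q b * ?q e"
  have v: "v \<noteq> 0" using quantum_torusD(2)[OF M] .
  have v1: "v - 1 \<noteq> 0"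
  proof
    assume "v - 1 = 0"
    then have "?q (single (0\<^sub>v m) (single 1 1)) =
        ?q (single (0\<^sub>v m) (single 0 1))" by simp
    then have "?q (single (0\<^sub>v m) (single 1 1 - single 0 1)) = 0"
      by (simp only: single_diff q_combination_diff) simp
    then have "single (0\<^sub>v m) (single 1 1 - single 0 1) = (0 :: q_laurent)"
      by (intro quantum_torusD(5)[OF M]) auto
    then have "lookup (single 1 1 - single 0 1) (1 :: int) = (0 :: int)"
      by (metis lookup_single_eq lookup_zero)
    then show False by (simp add: lookup_minus lookup_one)
  qed
  have central: "(v - 1) * z = z * (v - 1)" for z
    using quantum_torusD(3)[OF M, of z] by (simp add: left_diff_distrib right_diff_distrib)
  \<comment> \<open>The width of the coefficient at this one fixed exponent is the measure; it drops
    with each cancellation.\<close>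
  obtain e0 where e0: "lookup f e0 \<noteq> 0" using *(3) by (metis lookup_zero poly_mapping_eqI)
  let ?w = "\<lambda>\<gamma> :: q_coeff. Max (keys \<gamma>) - Min (keys \<gamma>)"
  show "\<exists>e f. keys e \<subseteq> carrier_vec m \<and> keys f \<subseteq> carrier_vec m \<and> ?s f \<noteq> 0 \<and>
      ?q c * ?q f = ?q b * ?q e"
    using *(1,2,4) e0
  proof (induction "nat (?w (lookup f e0))" arbitrary: e f rule: less_induct)
    case less
    show ?case
    proof (cases "?s f = 0")
      case False
      with less.prems show ?thesis by blast
    next
      case True
      have N: "twisted_frame m 1 (\<lambda>c d. L d c) (vmon m ratvar)" by (rule twisted_frame_vmon) simp
      have zero: "w = 0" if "(0, w) \<in> torus_graph m v M 1 (vmon m ratvar)" for w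
        using that quantum_torusD(5)[OF M] unfolding torus_graph_def by fastforce
      \<comment> \<open>The two products coincide in the source, so independence of the frame
        equates their images. Only closure of the graph is used, the Ore condition being what is
        under proof.\<close>
      have "(?q c * ?q f, ?s f * ?s c) \<in> torus_graph m v M 1 (vmon m ratvar)"
        "(?q b * ?q e, ?s e * ?s b) \<in> torus_graph m v M 1 (vmon m ratvar)"
        using torus_graph_mult[OF quantum_torusD(1)[OF M] N] torus_graphI b(1) c less.prems by blast+
      from torus_graph_add[OF this(1) torus_graph_uminus[OF this(2)]]
      have "(0, ?s f * ?s c - ?s e * ?s b) \<in> torus_graph m v M 1 (vmon m ratvar)"
        by (simp add: less.prems(3))
      from zero[OF this] have "?s e * ?s b = 0" using True by simp
      then have "?s e = 0" using b(2) by simp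
      obtain e' where e': "keys e' \<subseteq> carrier_vec m" "?q e = (v - 1) * ?q e'"
        by (rule q_combination_divisible[OF less.prems(1) \<open>?s e = 0\<close> v, of M])
      obtain f' where f': "keys f' \<subseteq> carrier_vec m"
        "\<forall>e. lookup f e = (single 1 1 - 1) * lookup f' e"
        "?q f = (v - 1) * ?q f'"
        by (rule q_combination_divisible[OF less.prems(2) True v, of M])
      have ne: "lookup f' e0 \<noteq> 0" using less.prems(4) f'(2) by auto
      have "(v - 1) * (?q c * ?q f') = ?q c * ?q f" unfolding f'(3) using central by (metis mult.assoc)
      also have "\<dots> = (v - 1) * (?q b * ?q e')"
        unfolding less.prems(3) e'(2) using central by (metis mult.assoc)
      finally have eq: "?q c * ?q f' = ?q b * ?q e'" using v1 by simp
      have "nat (?w (lookup f' e0)) < nat (?w (lookup f e0))"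
        using q_coeff_width_decreases[OF ne] f'(2) by simp
      from less.hyps[OF this e'(1) f'(1) eq ne] show ?thesis .
    qed
  qed
qed simp

section \<open>Toric frames\<close>

lemma form_value_sum:
  assumes "L \<in> carrier_mat m m" "c \<in> carrier_vec m" "d \<in> carrier_vec m"
  shows "form_value L c d = (\<Sum>i<m. \<Sum>j<m. L $$ (i, j) * c $ i * d $ j)"
proof -
  have "form_value L c d = (\<Sum>i<m. c $ i * (L *\<^sub>v d) $ i)"
    using assms(1) by (simp add: form_value_def scalar_prod_def lessThan_atLeast0)
  also have "\<dots> = (\<Sum>i<m. \<Sum>j<m. L $$ (i, j) * c $ i * d $ j)"
    by (intro sum.cong refl) (simp add: mult_mat_vec_index[OF assms(1,3)] sum_distrib_left mult_ac del: index_mult_mat_vec)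
  finally show ?thesis .
qed

lemma skew_symmetric_index:
  assumes "L \<in> carrier_mat m m" "skew_symmetric L" "i < m" "j < m"
  shows "L $$ (j, i) = - L $$ (i, j)"
proof -
  have "transpose_mat L $$ (i, j) = (- L) $$ (i, j)" using assms(2) by (simp add: skew_symmetric_def)
  then show ?thesis using assms by simp
qed

lemma form_value_skew:
  assumes L: "L \<in> carrier_mat m m" "skew_symmetric L" and cd: "c \<in> carrier_vec m" "d \<in> carrier_vec m"
  shows "form_value L d c = - form_value L c d"
proof -
  have "form_value L d c = (\<Sum>i<m. \<Sum>j<m. L $$ (j, i) * d $ j * c $ i)"
    unfolding form_value_sum[OF L(1) cd(2,1)] by (rule sum.swap)
  also have "\<dots> = (\<Sum>i<m. \<Sum>j<m. - (L $$ (i, j) * c $ i * d $ j))"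
  proof (intro sum.cong refl)
    fix i j assume "i \<in> {..<m}" "j \<in> {..<m}"
    then have "L $$ (j, i) = - L $$ (i, j)" by (intro skew_symmetric_index[OF L]) auto
    then show "L $$ (j, i) * d $ j * c $ i = - (L $$ (i, j) * c $ i * d $ j)" by simp
  qed
  also have "\<dots> = - form_value L c d"
    unfolding form_value_sum[OF L(1) cd] by (simp add: sum_negf)
  finally show ?thesis .
qed

text \<open>The automorphism fixes q^(1/2), hence all scalars, and carries combinations of the torus
  basis to combinations of \<open>M\<close> with exponents reindexed by the lattice isomorphism.
  Independence and fractions are transported in this way.\<close>

lemma toric_frame_quantum_torus:
  assumes K: "skew_field_of_fractions m K" and T: "toric_frame m K M \<Lambda>"
  shows "quantum_torus m (qhalf K) (form_value \<Lambda>) M" "\<Lambda> \<in> carrier_mat m m"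
proof -
  let ?v = "qhalf K" and ?X = "torus_basis K" and ?L = "lattice_form K"
  have L: "?L \<in> carrier_mat m m" "skew_symmetric ?L" and v: "\<And>z. ?v * z = z * ?v"
    and X0: "?X (0\<^sub>v m) = 1"
    and X: "\<And>e f. e \<in> carrier_vec m \<Longrightarrow> f \<in> carrier_vec m \<Longrightarrow> ?X e * ?X f = ?v powi form_value ?L e f * ?X (e + f)"
    and indep: "\<And>a. keys a \<subseteq> carrier_vec m \<Longrightarrow> q_combination ?v ?X a = 0 \<Longrightarrow> a = 0"
    and frac: "\<And>z. \<exists>a b. keys a \<subseteq> carrier_vec m \<and> keys b \<subseteq> carrier_vec m \<and>
        b \<noteq> 0 \<and> z = q_combination ?v ?X a * inverse (q_combination ?v ?X b)"
    using K unfolding skew_field_of_fractions_def by blast+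
  from T obtain \<phi> \<eta> where \<phi>: "bij \<phi>" "\<And>a b. \<phi> (a + b) = \<phi> a + \<phi> b" "\<And>a b. \<phi> (a * b) = \<phi> a * \<phi> b"
      "\<phi> ?v = ?v"
    and \<eta>: "bij_betw \<eta> (carrier_vec m) (carrier_vec m)"
      "\<And>c d. c \<in> carrier_vec m \<Longrightarrow> d \<in> carrier_vec m \<Longrightarrow> \<eta> (c + d) = \<eta> c + \<eta> d"
    and M: "\<And>c. c \<in> carrier_vec m \<Longrightarrow> M c = \<phi> (?X (\<eta> c))"
    and \<Lambda>: "\<Lambda> \<in> carrier_mat m m" "\<And>c d. c \<in> carrier_vec m \<Longrightarrow> d \<in> carrier_vec m \<Longrightarrow>
      form_value \<Lambda> c d = form_value ?L (\<eta> c) (\<eta> d)"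
    unfolding toric_frame_def by auto
  show "\<Lambda> \<in> carrier_mat m m" by (rule \<Lambda>(1))
  have \<eta>c: "\<eta> c \<in> carrier_vec m" if "c \<in> carrier_vec m" for c using \<eta>(1) that by (auto simp: bij_betw_def)
  have \<phi>0: "\<phi> 0 = 0" using \<phi>(2)[of 0 0] by simp
  have inj: "\<phi> a = \<phi> b \<longleftrightarrow> a = b" for a b using \<phi>(1) by (auto simp: bij_def inj_eq)
  have \<phi>1: "\<phi> 1 = 1"
  proof -
    have "\<phi> 1 * \<phi> 1 = \<phi> 1 * 1" using \<phi>(3)[of 1 1] by simp
    moreover have "\<phi> 1 \<noteq> 0" using inj[of 1 0] \<phi>0 by simp
    ultimately show ?thesis by (metis mult_left_cancel)
  qed
  have \<phi>m: "\<phi> (- a) = - \<phi> a" for a using \<phi>(2)[of a "- a"] \<phi>0 by (simp add: eq_neg_iff_add_eq_0 add.commute)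
  have \<phi>i: "\<phi> (inverse a) = inverse (\<phi> a)" for a
  proof (cases "a = 0")
    case False
    then have "\<phi> a * \<phi> (inverse a) = 1" using \<phi>(3)[of a "inverse a"] \<phi>1 by simp
    then show ?thesis by (rule inverse_unique[symmetric])
  qed (simp add: \<phi>0)
  have \<phi>n: "\<phi> (of_nat k) = of_nat k" for k by (induction k) (simp_all add: \<phi>0 \<phi>1 \<phi>(2))
  have \<phi>z: "\<phi> (of_int k) = of_int k" for k by (cases k rule: int_cases4) (simp_all add: \<phi>n \<phi>m)
  have \<phi>p: "\<phi> (a ^ k) = \<phi> a ^ k" for a k by (induction k) (simp_all add: \<phi>1 \<phi>(3))
  have \<phi>v: "\<phi> (?v powi k) = ?v powi k" for k
    by (cases k rule: int_cases4) (simp_all add: \<phi>p \<phi>(4) \<phi>i power_int_minus)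
  have \<phi>q: "\<phi> (q_combination ?v Y a) = q_combination ?v (\<phi> \<circ> Y) a" for Y a
    using subset_UNIV[of "keys a"]
    by (induction a rule: q_laurent_induct) (simp_all add: q_combination_add \<phi>0 \<phi> \<phi>z \<phi>v)
  have Mq: "q_combination ?v M a = \<phi> (q_combination ?v ?X (push \<eta> a))" if "keys a \<subseteq> carrier_vec m" for a
    unfolding \<phi>q q_combination_push using that M by (intro q_combination_cong) auto
  have \<eta>0: "\<eta> (0\<^sub>v m) = 0\<^sub>v m"
  proof (rule eq_vecI)
    have c: "\<eta> (0\<^sub>v m) \<in> carrier_vec m" by (intro \<eta>c) simp
    then show "dim_vec (\<eta> (0\<^sub>v m)) = dim_vec (0\<^sub>v m)" by simp
    fix i assume "i < dim_vec (0\<^sub>v m)"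
    moreover have "\<eta> (0\<^sub>v m) = \<eta> (0\<^sub>v m) + \<eta> (0\<^sub>v m)" using \<eta>(2)[of "0\<^sub>v m" "0\<^sub>v m"] by simp
    then have "\<eta> (0\<^sub>v m) $ i = (\<eta> (0\<^sub>v m) + \<eta> (0\<^sub>v m)) $ i" by (rule arg_cong)
    ultimately show "\<eta> (0\<^sub>v m) $ i = 0\<^sub>v m $ i" using c by simp
  qed
  \<comment> \<open>Otherwise q^(1/2) X^0 would be a vanishing combination with a nonzero
    coefficient.\<close>
  have v0: "?v \<noteq> 0"
  proof
    assume "?v = 0"
    then have "q_combination ?v ?X (single (0\<^sub>v m) (single 1 1)) = 0" by simp
    then have "single (0\<^sub>v m) (single 1 1) = (0 :: q_laurent)"
      by (intro indep) auto
    then have "single 1 1 = (0 :: q_coeff)" by (metis lookup_single_eq lookup_zero)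
    then show False by (metis lookup_single_eq lookup_zero zero_neq_one)
  qed
  show "quantum_torus m ?v (form_value \<Lambda>) M"
    unfolding quantum_torus_def twisted_frame_def
  proof (intro conjI ballI allI impI)
    show "?v \<noteq> 0" by (rule v0)
    show "?v * z = z * ?v" for z by (rule v)
    show "M (0\<^sub>v m) = 1" by (simp add: M \<eta>0 X0 \<phi>1)
    fix c d :: "int vec" assume cd: "c \<in> carrier_vec m" "d \<in> carrier_vec m"
    show "M c * M d = ?v powi form_value \<Lambda> c d * M (c + d)"
      using cd X[OF \<eta>c \<eta>c, OF cd] by (simp add: M \<Lambda>(2) \<eta>(2) \<phi>v flip: \<phi>(3))
        (simp add: \<phi>(3) \<phi>v)
    show "form_value \<Lambda> d c = - form_value \<Lambda> c d"
      using form_value_skew[OF L \<eta>c \<eta>c, OF cd] cd by (simp add: \<Lambda>(2))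
  next
    fix a assume a: "keys a \<subseteq> carrier_vec m" "q_combination ?v M a = 0"
    have "q_combination ?v ?X (push \<eta> a) = 0" using a Mq[OF a(1)] inj[of _ 0] \<phi>0 by simp
    moreover have "keys (push \<eta> a) \<subseteq> carrier_vec m" using keys_push[of \<eta> a] a(1) \<eta>c by blast
    ultimately have "push \<eta> a = 0" by (intro indep)
    then show "a = 0" using push_eq_0_iff[of \<eta> "carrier_vec m" a] \<eta>(1) a(1) by (simp add: bij_betw_def)
  next
    fix z
    obtain z0 where z0: "z = \<phi> z0" using \<phi>(1) by (meson bij_pointE)
    obtain a b where ab: "keys a \<subseteq> carrier_vec m" "keys b \<subseteq> carrier_vec m" "b \<noteq> 0"
      "z0 = q_combination ?v ?X a * inverse (q_combination ?v ?X b)" using frac by blast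
    define \<theta> where "\<theta> = inv_into (carrier_vec m) \<eta>"
    have \<theta>: "\<theta> c \<in> carrier_vec m" "\<eta> (\<theta> c) = c" if "c \<in> carrier_vec m" for c
      unfolding \<theta>_def using \<eta>(1) that by (auto simp: bij_betw_def inv_into_into f_inv_into_f)
    have \<theta>_inj: "inj_on \<theta> (carrier_vec m)" by (metis \<theta>(2) inj_onI)
    have conv: "\<phi> (q_combination ?v ?X a) = q_combination ?v M (push \<theta> a) \<and> keys (push \<theta> a) \<subseteq> carrier_vec m"
      if a: "keys a \<subseteq> carrier_vec m" for a
    proof
      show k: "keys (push \<theta> a) \<subseteq> carrier_vec m" using keys_push[of \<theta> a] a \<theta>(1) by blast
      show "\<phi> (q_combination ?v ?X a) = q_combination ?v M (push \<theta> a)"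
        unfolding \<phi>q q_combination_push using a M \<theta> by (intro q_combination_cong) auto
    qed
    have "push \<theta> b \<noteq> 0" using push_eq_0_iff[OF \<theta>_inj ab(2)] ab(3) by simp
    moreover have "z = q_combination ?v M (push \<theta> a) * inverse (q_combination ?v M (push \<theta> b))"
      unfolding z0 ab(4) \<phi>(3) \<phi>i using conv ab(1,2) by simp
    ultimately show "\<exists>a b. keys a \<subseteq> carrier_vec m \<and> keys b \<subseteq> carrier_vec m \<and> b \<noteq> 0 \<and>
        z = q_combination ?v M a * inverse (q_combination ?v M b)"
      using conv ab(1,2) by blast
  qed
qed

text \<open>The frame relation expresses values at c + d and -c through those at c and d, up to
  powers of v. Removing one signed unit vector at a time, by induction on the sum of absolute
  entries, reaches every vector.\<close>

lemma frame_ext: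
  assumes G: "antihom_graph G"
    and M: "twisted_frame m v L M" and N: "twisted_frame m v' (\<lambda>c d. L d c) N"
    and v: "antihom_graph.ext G v v'"
    and units: "\<And>i. i < m \<Longrightarrow> antihom_graph.ext G (M (unit_vec m i)) (N (unit_vec m i))"
    and c: "c \<in> carrier_vec m"
  shows "antihom_graph.ext G (M c) (N c)"
proof -
  interpret antihom_graph G by (rule G)
  have v0: "v \<noteq> 0" "v' \<noteq> 0" and central: "\<And>z. v' * z = z * v'" and unit: "M (0\<^sub>v m) = 1" "N (0\<^sub>v m) = 1"
    and mult: "\<And>c d. c \<in> carrier_vec m \<Longrightarrow> d \<in> carrier_vec m \<Longrightarrow> M c * M d = v powi L c d * M (c + d)"
    "\<And>c d. c \<in> carrier_vec m \<Longrightarrow> d \<in> carrier_vec m \<Longrightarrow> N d * N c = v' powi L c d * N (d + c)"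
    using M N unfolding twisted_frame_def by blast+
  have add: "ext (M (c + d)) (N (c + d))"
    if cd: "c \<in> carrier_vec m" "d \<in> carrier_vec m" "ext (M c) (N c)" "ext (M d) (N d)" for c d
  proof -
    have "M (c + d) = v powi (- L c d) * (M c * M d)"
      unfolding mult(1)[OF cd(1,2)] using v0 by (simp add: power_int_minus mult.assoc[symmetric])
    moreover have "N (c + d) = N d * N c * v' powi (- L c d)"
    proof -
      have "N d * N c * v' powi (- L c d) = v' powi (- L c d) * (N d * N c)"
        by (rule power_int_central[OF central, symmetric])
      also have "\<dots> = N (d + c)"
        unfolding mult(2)[OF cd(1,2)] using v0 by (simp add: power_int_minus mult.assoc[symmetric])
      finally show ?thesis using cd(1,2) by (simp add: comm_add_vec[of c m d])
    qed
    moreover have "ext (v powi (- L c d) * (M c * M d)) (N d * N c * v' powi (- L c d))"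
      by (intro ext_mult ext_power_int v v0 cd)
    ultimately show ?thesis by simp
  qed
  have neg: "ext (M (- c)) (N (- c))" if c: "c \<in> carrier_vec m" "ext (M c) (N c)" for c
  proof -
    have mc: "- c \<in> carrier_vec m" "- c + c = 0\<^sub>v m" "c + - c = 0\<^sub>v m" using c(1) by auto
    have 1: "M (- c) * M c = v powi L (- c) c" using mult(1)[OF mc(1) c(1)] mc unit by simp
    have 2: "N c * N (- c) = v' powi L (- c) c" using mult(2)[OF mc(1) c(1)] mc unit by simp
    have nz: "M c \<noteq> 0" "N c \<noteq> 0" using 1 2 v0 by auto
    have "M (- c) = v powi L (- c) c * inverse (M c)" unfolding 1[symmetric] using nz by (simp add: mult.assoc)
    moreover have "N (- c) = inverse (N c) * v' powi L (- c) c"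
      unfolding 2[symmetric] using nz by (simp add: mult.assoc[symmetric])
    moreover have "ext (v powi L (- c) c * inverse (M c)) (inverse (N c) * v' powi L (- c) c)"
      by (intro ext_mult ext_power_int ext_inverse v v0 c nz)
    ultimately show ?thesis by simp
  qed
  show ?thesis using c
  proof (induction "\<Sum>i<m. nat \<bar>c $ i\<bar>" arbitrary: c rule: less_induct)
    case less
    show ?case
    proof (cases "c = 0\<^sub>v m")
      case True
      then show ?thesis using unit ext_1 by simp
    next
      case False
      have "\<exists>i<m. c $ i \<noteq> 0"
      proof (rule ccontr)
        assume "\<not> (\<exists>i<m. c $ i \<noteq> 0)"
        then have "c = 0\<^sub>v m" using less.prems by (intro eq_vecI) auto
        with False show False ..
      qed
      then obtain i where i: "i < m" "c $ i \<noteq> 0" by blast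
      define u where "u = (if c $ i > 0 then unit_vec m i else - unit_vec m i :: int vec)"
      have u: "u \<in> carrier_vec m" "ext (M u) (N u)"
        unfolding u_def using units[OF i(1)] neg[of "unit_vec m i"] by auto
      have cu: "c - u \<in> carrier_vec m" "c = (c - u) + u" using less.prems u(1) by auto
      have "(\<Sum>k<m. nat \<bar>(c - u) $ k\<bar>) < (\<Sum>k<m. nat \<bar>c $ k\<bar>)"
      proof (rule sum_strict_mono_ex1)
        show "\<forall>k\<in>{..<m}. nat \<bar>(c - u) $ k\<bar> \<le> nat \<bar>c $ k\<bar>"
          using less.prems i(2) by (auto simp: u_def unit_vec_def)
        show "\<exists>k\<in>{..<m}. nat \<bar>(c - u) $ k\<bar> < nat \<bar>c $ k\<bar>"
          using less.prems i by (intro bexI[of _ i]) (auto simp: u_def unit_vec_def)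
      qed simp
      from less.hyps[OF this cu(1)] have "ext (M (c - u)) (N (c - u))" .
      from add[OF cu(1) u(1) this u(2)] show ?thesis using cu(2) by simp
    qed
  qed
qed

lemma ext_q_combination:
  assumes G: "antihom_graph G" and v: "antihom_graph.ext G v v'" "v' \<noteq> 0" "\<And>z. v' * z = z * v'"
    and X: "\<And>e. e \<in> keys a \<Longrightarrow> antihom_graph.ext G (X e) (Y e)"
  shows "antihom_graph.ext G (q_combination v X a) (q_combination v' Y a)"
proof -
  interpret antihom_graph G by (rule G)
  have coeff: "ext (q_coeff_eval v b) (q_coeff_eval v' b)" for b
    unfolding q_coeff_eval_def
  proof (rule ext_sum)
    fix r
    have "ext (of_int (lookup b r) * v powi r) (v' powi r * of_int (lookup b r))"
      by (intro ext_mult ext_of_int ext_power_int v(1,2))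
    then show "ext (of_int (lookup b r) * v powi r) (of_int (lookup b r) * v' powi r)"
      by (simp only: mult_of_int_commute)
  qed
  show ?thesis
    unfolding q_combination_def
  proof (rule ext_sum)
    fix e assume "e \<in> keys a"
    from ext_mult[OF coeff X[OF this], of "lookup a e"]
    show "ext (q_coeff_eval v (lookup a e) * X e) (q_coeff_eval v' (lookup a e) * Y e)"
      by (simp only: q_coeff_eval_central[OF v(3)])
  qed
qed

text \<open>The exchange relation is a sum of two frame values, so an additive relation passes along
  an edge and \<open>frame_ext\<close> recovers the whole new frame. Taking \<open>N\<close> =
  \<open>M\<close> gives bar-invariance, a classical pattern gives the specialization.\<close>

lemma pattern_ext:
  assumes G: "antihom_graph G" and v: "antihom_graph.ext G v v'"
    and frames: "\<And>t. t \<in> tree_vertices n \<Longrightarrow>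
      \<exists>L. twisted_frame m v L (M t) \<and> twisted_frame m v' (\<lambda>c d. L d c) (N t)"
    and edges: "\<And>k t t'. tree_edge n k t t' \<Longrightarrow>
      quantum_mutation m k (M t) (E t) (M t') (E t') \<and> quantum_mutation m k (N t) (E t) (N t') (E t')"
    and base: "\<And>i. i < m \<Longrightarrow> antihom_graph.ext G (M t0 (unit_vec m i)) (N t0 (unit_vec m i))"
    and t: "t0 \<in> tree_vertices n" "t \<in> tree_vertices n" and c: "c \<in> carrier_vec m"
  shows "antihom_graph.ext G (M t c) (N t c)"
proof -
  interpret antihom_graph G by (rule G)
  have all: "ext (M t c) (N t c)"
    if units: "\<And>i. i < m \<Longrightarrow> ext (M t (unit_vec m i)) (N t (unit_vec m i))"
      and tc: "t \<in> tree_vertices n" "c \<in> carrier_vec m" for t c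
  proof -
    obtain L where "twisted_frame m v L (M t)" "twisted_frame m v' (\<lambda>c d. L d c) (N t)"
      using frames[OF tc(1)] by blast
    from frame_ext[OF G this v units tc(2)] show ?thesis .
  qed
  have "\<forall>i<m. ext (M t (unit_vec m i)) (N t (unit_vec m i))"
    using t
  proof (rule tree_connected)
    fix k s s' assume e: "tree_edge n k s s'" and IH: "\<forall>i<m. ext (M s (unit_vec m i)) (N s (unit_vec m i))"
    have s: "s \<in> tree_vertices n" using e by (simp add: tree_edge_def)
    have IH': "ext (M s c) (N s c)" if "c \<in> carrier_vec m" for c using all[OF _ s that] IH by blast
    show "\<forall>i<m. ext (M s' (unit_vec m i)) (N s' (unit_vec m i))"
    proof (intro allI impI)
      fix i assume i: "i < m"
      show "ext (M s' (unit_vec m i)) (N s' (unit_vec m i))"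
      proof (cases "i = k")
        case True
        have "ext (M s (- unit_vec m k + vec m f)) (N s (- unit_vec m k + vec m f))" for f by (rule IH') simp
        then show ?thesis unfolding True using edges[OF e] by (auto simp: quantum_mutation_def intro!: ext_add)
      next
        case False
        then show ?thesis using edges[OF e] IH i by (simp add: quantum_mutation_def)
      qed
    qed
  qed (use base in blast)
  then show ?thesis using all t(2) c by blast
qed

section \<open>Ordered monomials\<close>

text \<open>The form vanishes on the line spanned by \<open>x\<close>, where the frame is therefore
  a group homomorphism from the integers.\<close>

lemma twisted_frame_smult:
  assumes N: "twisted_frame n v (form_value S) N" and S: "S \<in> carrier_mat n n"
    and x: "x \<in> carrier_vec n" "form_value S x x = 0"
  shows "N (k \<cdot>\<^sub>v x) = N x powi k"
proof -
  have form: "form_value S (k \<cdot>\<^sub>v x) (l \<cdot>\<^sub>v x) = 0" for k l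
  proof -
    have "form_value S (k \<cdot>\<^sub>v x) (l \<cdot>\<^sub>v x) = k * l * form_value S x x"
      using x(1) unfolding form_value_sum[OF S x(1,1)]
      by (subst form_value_sum[OF S]) (auto simp: sum_distrib_left mult_ac)
    then show ?thesis using x(2) by simp
  qed
  have mult: "N (k \<cdot>\<^sub>v x) * N (l \<cdot>\<^sub>v x) = N ((k + l) \<cdot>\<^sub>v x)" for k l
    using N x(1) form[of k l] by (simp add: twisted_frame_def add_smult_distrib_vec)
  have 1: "N (1 \<cdot>\<^sub>v x) = N x" by simp
  have 0: "N (0 \<cdot>\<^sub>v x) = 1"
  proof -
    have "0 \<cdot>\<^sub>v x = 0\<^sub>v n" using x(1) by auto
    then show ?thesis using N by (simp add: twisted_frame_def)
  qed
  have "N x * N (- 1 \<cdot>\<^sub>v x) = 1" using mult[of 1 "- 1"] 0 1 by simp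
  then have inv: "N (- 1 \<cdot>\<^sub>v x) = inverse (N x)" and nz: "N x \<noteq> 0"
    by (auto simp: inverse_unique)
  show ?thesis
  proof (induction k rule: int_induct[where k = 0])
    case base
    show ?case using 0 by simp
  next
    case (step1 i)
    then show ?case using mult[of i 1] 1 nz by (simp add: power_int_add)
  next
    case (step2 i)
    have "N x powi (i + - 1) = N x powi i * N x powi (- 1)" using nz by (intro power_int_add) simp
    then show ?case using step2 mult[of i "- 1"] inv by (simp add: power_int_minus)
  qed
qed

text \<open>Appending the factor of index r pairs the partial vector with c_r times the unit vector;
  this pairing is the inner sum for j = r.\<close>

lemma ordered_product:
  assumes N: "twisted_frame n v (form_value S) N" and S: "S \<in> carrier_mat n n" "skew_symmetric S"
    and c: "c \<in> carrier_vec n" and r: "r \<le> n"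
  shows "prod_list (map (\<lambda>i. N (unit_vec n i) powi (c $ i)) [0..<r]) =
    v powi (\<Sum>j<r. \<Sum>i<j. S $$ (i, j) * c $ i * c $ j) * N (vec n (\<lambda>i. if i < r then c $ i else 0))"
  using r
proof (induction r)
  case 0
  have "vec n (\<lambda>i. 0 :: int) = 0\<^sub>v n" by (intro eq_vecI) auto
  then show ?case using N by (simp add: twisted_frame_def)
next
  case (Suc r)
  have r: "r < n" using Suc.prems by simp
  let ?c = "vec n (\<lambda>i. if i < r then c $ i else 0)" and ?x = "unit_vec n r :: int vec"
  let ?E = "\<Sum>j<r. \<Sum>i<j. S $$ (i, j) * c $ i * c $ j"
  have delta: "(\<Sum>j<n. f j * ?x $ j) = f r" for f :: "nat \<Rightarrow> int"
  proof -
    have "(\<Sum>j<n. f j * ?x $ j) = (\<Sum>j<n. if j = r then f j else 0)"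
      using r by (intro sum.cong) auto
    then show ?thesis using r by simp
  qed
  have "S $$ (r, r) = 0" using skew_symmetric_index[OF S r r] by simp
  then have "form_value S ?x ?x = 0"
    by (simp only: form_value_sum[OF S(1) unit_vec_carrier unit_vec_carrier] delta)
  then have pow: "N ?x powi (c $ r) = N (c $ r \<cdot>\<^sub>v ?x)"
    by (intro twisted_frame_smult[OF N S(1), symmetric]) auto
  have form: "form_value S ?c (c $ r \<cdot>\<^sub>v ?x) = (\<Sum>i<r. S $$ (i, r) * c $ i * c $ r)"
  proof -
    have "form_value S ?c (c $ r \<cdot>\<^sub>v ?x) = (\<Sum>i<n. \<Sum>j<n. (S $$ (i, j) * ?c $ i * c $ r) * ?x $ j)"
      by (subst form_value_sum[OF S(1)]) (auto simp: mult_ac intro!: sum.cong)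
    also have "\<dots> = (\<Sum>i<n. if i < r then S $$ (i, r) * c $ i * c $ r else 0)"
      unfolding delta by (intro sum.cong) auto
    also have "\<dots> = (\<Sum>i<r. S $$ (i, r) * c $ i * c $ r)"
      using r by (intro sum.mono_neutral_cong_right) auto
    finally show ?thesis .
  qed
  have step: "N ?c * N (c $ r \<cdot>\<^sub>v ?x) = v powi (\<Sum>i<r. S $$ (i, r) * c $ i * c $ r) * N (?c + c $ r \<cdot>\<^sub>v ?x)"
    unfolding form[symmetric] using N by (simp add: twisted_frame_def)
  have sum: "?c + c $ r \<cdot>\<^sub>v ?x = vec n (\<lambda>i. if i < Suc r then c $ i else 0)"
    using r by (intro eq_vecI) (auto simp: less_Suc_eq)
  have v: "v \<noteq> 0" using N by (simp add: twisted_frame_def)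
  have "prod_list (map (\<lambda>i. N (unit_vec n i) powi (c $ i)) [0..<Suc r]) = v powi ?E * (N ?c * N (c $ r \<cdot>\<^sub>v ?x))"
    using Suc r by (simp add: pow mult.assoc)
  also have "\<dots> = v powi (?E + (\<Sum>i<r. S $$ (i, r) * c $ i * c $ r)) * N (?c + c $ r \<cdot>\<^sub>v ?x)"
    unfolding step using v by (simp add: power_int_add mult.assoc)
  finally show ?case by (simp add: sum)
qed

section \<open>The torus R and compatible pairs\<close>

lemma diagonal_mult_index:
  assumes "D \<in> carrier_mat n n" "diagonal_mat D" "B0 \<in> carrier_mat n n" "i < n" "j < n"
  shows "(D * B0) $$ (i, j) = D $$ (i, i) * B0 $$ (i, j)"
proof -
  have "(D * B0) $$ (i, j) = (\<Sum>k=0..<n. D $$ (i, k) * B0 $$ (k, j))"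
    using assms by (simp add: scalar_prod_def)
  also have "\<dots> = (\<Sum>k=0..<n. if k = i then D $$ (i, k) * B0 $$ (k, j) else 0)"
    using assms by (intro sum.cong) (auto simp: diagonal_mat_def)
  finally show ?thesis using assms by simp
qed

text \<open>The power of q in the definition of Z^c is the inverse of the reordering factor, because
  d_j b_ji = -d_i b_ij.\<close>

lemma Z_monomial_subst_frame:
  assumes B0: "B0 \<in> carrier_mat n n" and D: "D \<in> carrier_mat n n" "diagonal_mat D"
    and S: "skew_symmetric (D * B0)"
    and N: "twisted_frame n v (form_value (D * B0)) N" and c: "c \<in> carrier_vec n"
    and Y: "\<And>i. i < n \<Longrightarrow> Y i = N (unit_vec n i)"
  shows "Z_monomial_subst B0 D v Y c = N c"
proof -
  have n: "dim_col B0 = n" using B0 by auto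
  have Sc: "D * B0 \<in> carrier_mat n n" using D(1) B0 by simp
  let ?E = "\<Sum>j<n. \<Sum>i<j. (D * B0) $$ (i, j) * c $ i * c $ j"
  have "(\<Sum>j<n. \<Sum>i<j. D $$ (j, j) * B0 $$ (j, i) * c $ i * c $ j) = (\<Sum>j<n. \<Sum>i<j. - ((D * B0) $$ (i, j) * c $ i * c $ j))"
  proof (intro sum.cong refl)
    fix j i assume "j \<in> {..<n}" "i \<in> {..<j}"
    then have "i < n" "j < n" by auto
    then have "D $$ (j, j) * B0 $$ (j, i) = - (D * B0) $$ (i, j)"
      using diagonal_mult_index[OF D B0, of j i] skew_symmetric_index[OF Sc S, of i j] by simp
    then show "D $$ (j, j) * B0 $$ (j, i) * c $ i * c $ j = - ((D * B0) $$ (i, j) * c $ i * c $ j)" by simp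
  qed
  also have "\<dots> = - ?E" by (simp add: sum_negf)
  finally have E: "(\<Sum>j<n. \<Sum>i<j. D $$ (j, j) * B0 $$ (j, i) * c $ i * c $ j) = - ?E" .
  have map: "map (\<lambda>i. Y i powi (c $ i)) [0..<n] = map (\<lambda>i. N (unit_vec n i) powi (c $ i)) [0..<n]"
    using Y by simp
  have "vec n (\<lambda>i. if i < n then c $ i else 0) = c" using c by (intro eq_vecI) auto
  then have "prod_list (map (\<lambda>i. Y i powi (c $ i)) [0..<n]) = v powi ?E * N c"
    unfolding map using ordered_product[OF N Sc S c order_refl] by simp
  then show ?thesis
    unfolding Z_monomial_subst_def Let_def n E
    using N by (simp add: twisted_frame_def power_int_minus mult.assoc[symmetric])
qed

text \<open>Moving B across the pairing turns the left side into c paired with (D | 0) B d, and (D |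
  0) sees only the principal part of B.\<close>

lemma compatible_form:
  assumes B: "B \<in> carrier_mat m n" "n \<le> m" and \<Lambda>: "\<Lambda> \<in> carrier_mat m m"
    and D: "D \<in> carrier_mat n n" "diagonal_mat D" and comp: "compatible B \<Lambda> D"
    and cd: "c \<in> carrier_vec n" "d \<in> carrier_vec n"
  shows "form_value \<Lambda> (B *\<^sub>v c) (B *\<^sub>v d) = form_value (D * principal_part n B) c d"
proof -
  let ?B0 = "principal_part n B"
  have B0: "?B0 \<in> carrier_mat n n" by (simp add: principal_part_def)
  have Bd: "B *\<^sub>v d \<in> carrier_vec m" using B cd by simp
  have "form_value \<Lambda> (B *\<^sub>v c) (B *\<^sub>v d) = (\<Lambda> *\<^sub>v (B *\<^sub>v d)) \<bullet> (B *\<^sub>v c)"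
    unfolding form_value_def using B \<Lambda> cd by (intro comm_scalar_prod[of _ m]) auto
  also have "\<dots> = (transpose_mat B *\<^sub>v (\<Lambda> *\<^sub>v (B *\<^sub>v d))) \<bullet> c"
    using transpose_vec_mult_scalar[OF B(1) cd(1), of "\<Lambda> *\<^sub>v (B *\<^sub>v d)"] \<Lambda> Bd by simp
  also have "transpose_mat B *\<^sub>v (\<Lambda> *\<^sub>v (B *\<^sub>v d)) = (transpose_mat B * \<Lambda>) *\<^sub>v (B *\<^sub>v d)"
    using assoc_mult_mat_vec[of "transpose_mat B" n m \<Lambda> m "B *\<^sub>v d"] B \<Lambda> Bd by simp
  also have "\<dots> = (D * ?B0) *\<^sub>v d"
  proof (rule eq_vecI)
    have DB: "transpose_mat B * \<Lambda> = mat n m (\<lambda>(i, j). if j < n then D $$ (i, j) else 0)"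
      using comp B(1) unfolding compatible_def by auto
    then show "dim_vec ((transpose_mat B * \<Lambda>) *\<^sub>v (B *\<^sub>v d)) = dim_vec ((D * ?B0) *\<^sub>v d)" using D(1) by simp
    fix i assume "i < dim_vec ((D * ?B0) *\<^sub>v d)"
    then have i: "i < n" using D(1) by simp
    have "((transpose_mat B * \<Lambda>) *\<^sub>v (B *\<^sub>v d)) $ i =
        (\<Sum>k<m. (if k < n then D $$ (i, k) else 0) * (B *\<^sub>v d) $ k)"
      unfolding DB using mult_mat_vec_index[of "mat n m (\<lambda>(i, j). if j < n then D $$ (i, j) else 0)" m n] i Bd
      by (subst mult_mat_vec_index[of _ n m]) auto
    also have "\<dots> = (\<Sum>k<m. if k = i then D $$ (i, i) * (B *\<^sub>v d) $ i else 0)"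
      using D i by (intro sum.cong) (auto simp: diagonal_mat_def)
    also have "\<dots> = D $$ (i, i) * (B *\<^sub>v d) $ i" using i B(2) by simp
    also have "\<dots> = (\<Sum>k<n. (D * ?B0) $$ (i, k) * d $ k)"
      using i B(2) mult_mat_vec_index[OF B(1) cd(2), of i] diagonal_mult_index[OF D B0 i]
      by (simp add: sum_distrib_left principal_part_def mult.assoc del: index_mult_mat_vec)
    also have "\<dots> = ((D * ?B0) *\<^sub>v d) $ i"
      using D(1) B0 i cd(2) by (subst mult_mat_vec_index[of _ n n]) auto
    finally show "((transpose_mat B * \<Lambda>) *\<^sub>v (B *\<^sub>v d)) $ i = ((D * ?B0) *\<^sub>v d) $ i" .
  qed
  also have "((D * ?B0) *\<^sub>v d) \<bullet> c = form_value (D * ?B0) c d"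
    unfolding form_value_def using D(1) B0 cd by (intro comm_scalar_prod[of _ n]) auto
  finally show ?thesis .
qed

section \<open>Quantum cluster variables\<close>

lemma mult_unit_vec_col:
  assumes "B \<in> carrier_mat m n" "k < n"
  shows "B *\<^sub>v unit_vec n k = (col B k :: int vec)"
proof (rule eq_vecI)
  fix i assume "i < dim_vec (col B k)"
  then have i: "i < m" using assms by simp
  have "(B *\<^sub>v unit_vec n k) $ i = (\<Sum>l<n. B $$ (i, l) * unit_vec n k $ l)"
    by (rule mult_mat_vec_index[OF assms(1) unit_vec_carrier i])
  also have "\<dots> = (\<Sum>l<n. if l = k then B $$ (i, l) else 0)"
    using assms(2) by (intro sum.cong) auto
  finally show "(B *\<^sub>v unit_vec n k) $ i = col B k $ i" using assms i by simp
qed (use assms in simp)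

lemma torus_graph_basis:
  assumes "e \<in> carrier_vec m" shows "(M e, N e) \<in> torus_graph m v M v' N"
  using torus_graph_single[OF assms, of v 1 M v' N] by simp

lemma torus_graph_q:
  assumes "M (0\<^sub>v m) = 1" "N (0\<^sub>v m) = 1" shows "(v, v') \<in> torus_graph m v M v' N"
  using torus_graph_single[of "0\<^sub>v m" m v "single 1 1" M v' N] assms by simp

locale quantum_pattern =
  fixes \<A> :: "'f::division_ring quantum_cluster_data" and B B0 D :: "int mat" and m n t0
  assumes algebra: "quantum_cluster_algebra B D t0 \<A>"
    and B: "B \<in> carrier_mat m n" and B0: "principal_part n B = B0"
    and D: "D \<in> carrier_mat n n" "diagonal_mat D" and S: "skew_symmetric (D * B0)"
    and t0: "t0 \<in> tree_vertices n"
begin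

abbreviation "v \<equiv> qhalf \<A>"
abbreviation "M0 \<equiv> frame \<A> t0"
abbreviation "E \<equiv> exchange_matrix \<A>"

lemma algebraD:
  shows "n \<le> m" "skew_field_of_fractions m \<A>" "E t0 = B"
    "t \<in> tree_vertices n \<Longrightarrow> quantum_seed m n \<A> D (frame \<A> t) (E t)"
    "tree_edge n k t t' \<Longrightarrow> quantum_mutation m k (frame \<A> t) (E t) (frame \<A> t') (E t')"
proof -
  have "dim_row B = m" "dim_col B = n" using B by auto
  then show "n \<le> m" "skew_field_of_fractions m \<A>" "E t0 = B"
    "t \<in> tree_vertices n \<Longrightarrow> quantum_seed m n \<A> D (frame \<A> t) (E t)"
    "tree_edge n k t t' \<Longrightarrow> quantum_mutation m k (frame \<A> t) (E t) (frame \<A> t') (E t')"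
    using algebra unfolding quantum_cluster_algebra_def Let_def by blast+
qed

lemma seed_torus:
  assumes "t \<in> tree_vertices n"
  obtains \<Lambda> where "quantum_torus m v (form_value \<Lambda>) (frame \<A> t)" "\<Lambda> \<in> carrier_mat m m" "compatible (E t) \<Lambda> D"
proof -
  from algebraD(4)[OF assms] obtain \<Lambda> where \<Lambda>: "toric_frame m \<A> (frame \<A> t) \<Lambda>" "compatible (E t) \<Lambda> D"
    unfolding quantum_seed_def by blast
  show ?thesis using that toric_frame_quantum_torus[OF algebraD(2) \<Lambda>(1)] \<Lambda>(2) by blast
qed

lemma quantum_cluster_variable_frame:
  assumes "t \<in> tree_vertices n"
  shows "quantum_cluster_variable \<A> t j = frame \<A> t (unit_vec m j)"
proof -
  have "dim_row (E t) = m" using algebraD(4)[OF assms] by (auto simp: quantum_seed_def)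
  then show ?thesis by (simp add: quantum_cluster_variable_def)
qed

lemma mult_B_carrier: "c \<in> carrier_vec n \<Longrightarrow> B *\<^sub>v c \<in> carrier_vec m"
  using B by simp

text \<open>By compatibility c \<mapsto> \<open>M0 (B *\<^sub>v c)\<close> is a frame for the form
  of R, so each Z^c is sent to a single element of the initial frame. The bar involution fixes such
  elements and acts on coefficients only.\<close>

lemma Z_subst_combination:
  assumes "keys F \<subseteq> carrier_vec n"
  shows "Z_subst B0 D v (Y_hat \<A> t0) F = q_combination v (\<lambda>c. M0 (B *\<^sub>v c)) F"
proof -
  obtain \<Lambda> where \<Lambda>: "quantum_torus m v (form_value \<Lambda>) M0" "\<Lambda> \<in> carrier_mat m m" "compatible B \<Lambda> D"
    using seed_torus[OF t0] algebraD(3) by metis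
  have B0c: "B0 \<in> carrier_mat n n" unfolding B0[symmetric] by (simp add: principal_part_def)
  have form: "form_value \<Lambda> (B *\<^sub>v c) (B *\<^sub>v d) = form_value (D * B0) c d"
    if "c \<in> carrier_vec n" "d \<in> carrier_vec n" for c d
    using compatible_form[OF B algebraD(1) \<Lambda>(2) D \<Lambda>(3) that] unfolding B0 .
  have N: "twisted_frame n v (form_value (D * B0)) (\<lambda>c. M0 (B *\<^sub>v c))"
    unfolding twisted_frame_def
  proof (intro conjI ballI)
    have "B *\<^sub>v 0\<^sub>v n = 0\<^sub>v m" using B by (intro eq_vecI) auto
    then show "M0 (B *\<^sub>v 0\<^sub>v n) = 1" using quantum_torusD(1)[OF \<Lambda>(1)] by (simp add: twisted_frame_def)
    fix c d :: "int vec" assume cd: "c \<in> carrier_vec n" "d \<in> carrier_vec n"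
    have "M0 (B *\<^sub>v c) * M0 (B *\<^sub>v d) = v powi form_value \<Lambda> (B *\<^sub>v c) (B *\<^sub>v d) * M0 (B *\<^sub>v c + B *\<^sub>v d)"
      using quantum_torusD(1)[OF \<Lambda>(1)] mult_B_carrier cd unfolding twisted_frame_def by blast
    then show "M0 (B *\<^sub>v c) * M0 (B *\<^sub>v d) = v powi form_value (D * B0) c d * M0 (B *\<^sub>v (c + d))"
      by (simp add: form[OF cd] mult_add_distrib_mat_vec[OF B cd])
  qed (use quantum_torusD(2,3)[OF \<Lambda>(1)] in blast)+
  have Y: "Y_hat \<A> t0 i = M0 (B *\<^sub>v unit_vec n i)" if "i < n" for i
    unfolding Y_hat_def algebraD(3) mult_unit_vec_col[OF B that] ..
  show ?thesis
    unfolding Z_subst_def using assms Z_monomial_subst_frame[OF B0c D S N _ Y]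
    by (intro q_combination_cong) blast
qed

text \<open>The image of the cluster variable is computed twice: through the mutations, which fix
  it, and through the given expansion, whose factors are reversed. Uniqueness of values equates the
  two.\<close>

lemma bar_formula:
  assumes t: "t \<in> tree_vertices n" and j: "j < n" and F: "keys F \<subseteq> carrier_vec n"
    and g: "g \<in> carrier_vec m"
    and X: "quantum_cluster_variable \<A> t j = v powi l * Z_subst B0 D v (Y_hat \<A> t0) F * M0 g"
  shows "quantum_cluster_variable \<A> t j = v powi (- l) * M0 g * Z_subst B0 D v (Y_hat \<A> t0) (bar F)"
proof -
  obtain \<Lambda> where T: "quantum_torus m v (form_value \<Lambda>) M0" using seed_torus[OF t0] by metis
  let ?G = "torus_graph m v M0 (inverse v) M0"
  have G: "antihom_graph ?G" by (rule antihom_graph_bar[OF T])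
  interpret antihom_graph ?G by (rule G)
  have unit: "M0 (0\<^sub>v m) = 1" using quantum_torusD(1)[OF T] by (simp add: twisted_frame_def)
  have v: "v \<noteq> 0" "\<And>z. v * z = z * v" using quantum_torusD(2,3)[OF T] by blast+
  have iv: "inverse v \<noteq> 0" "\<And>z. inverse v * z = z * inverse v"
    using twisted_frame_bar[OF T] unfolding twisted_frame_def by blast+
  have ev: "ext v (inverse v)" by (intro ext_graph torus_graph_q unit)
  have basis: "ext (M0 c) (M0 c)" if "c \<in> carrier_vec m" for c
    using that by (intro ext_graph torus_graph_basis)
  have "ext (frame \<A> t c) (frame \<A> t c)" if "c \<in> carrier_vec m" for c
  proof (rule pattern_ext[OF G ev _ _ _ t0 t that])
    show "\<exists>L. twisted_frame m v L (frame \<A> s) \<and> twisted_frame m (inverse v) (\<lambda>c d. L d c) (frame \<A> s)"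
      if "s \<in> tree_vertices n" for s
      using seed_torus[OF that] quantum_torusD(1) twisted_frame_bar by metis
    show "quantum_mutation m k (frame \<A> s) (E s) (frame \<A> s') (E s') \<and>
        quantum_mutation m k (frame \<A> s) (E s) (frame \<A> s') (E s')"
      if "tree_edge n k s s'" for k s s' using algebraD(5)[OF that] by blast
  qed (intro basis unit_vec_carrier)
  then have 1: "ext (quantum_cluster_variable \<A> t j) (quantum_cluster_variable \<A> t j)"
    unfolding quantum_cluster_variable_frame[OF t] by simp
  have Q: "ext (q_combination v (\<lambda>c. M0 (B *\<^sub>v c)) F) (q_combination (inverse v) (\<lambda>c. M0 (B *\<^sub>v c)) F)"
    using F by (intro ext_q_combination[OF G ev iv] basis mult_B_carrier) blast
  have "ext (v powi l * q_combination v (\<lambda>c. M0 (B *\<^sub>v c)) F * M0 g)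
      (M0 g * (q_combination (inverse v) (\<lambda>c. M0 (B *\<^sub>v c)) F * inverse v powi l))"
    by (intro ext_mult ext_power_int ev iv Q basis g)
  then have 2: "ext (quantum_cluster_variable \<A> t j)
      (M0 g * (q_combination v (\<lambda>c. M0 (B *\<^sub>v c)) (bar F) * v powi (- l)))"
    unfolding X Z_subst_combination[OF F] q_combination_inverse
    by (simp add: power_int_inverse power_int_minus)
  have "quantum_cluster_variable \<A> t j = M0 g * (q_combination v (\<lambda>c. M0 (B *\<^sub>v c)) (bar F) * v powi (- l))"
    by (rule ext_unique[OF 1 2])
  also have "\<dots> = M0 g * q_combination v (\<lambda>c. M0 (B *\<^sub>v c)) (bar F) * v powi (- l)"
    by (simp only: mult.assoc)
  also have "\<dots> = v powi (- l) * (M0 g * q_combination v (\<lambda>c. M0 (B *\<^sub>v c)) (bar F))"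
    by (rule power_int_central[OF v(2), symmetric])
  also have "q_combination v (\<lambda>c. M0 (B *\<^sub>v c)) (bar F) = Z_subst B0 D v (Y_hat \<A> t0) (bar F)"
    using F by (intro Z_subst_combination[symmetric]) simp
  finally show ?thesis by (simp only: mult.assoc)
qed

text \<open>The quantum cluster variable has two images at q = 1: the classical cluster variable,
  followed along the tree, and the specialized expansion in the initial variables.\<close>

lemma specialization:
  assumes seed: "positive_seed d m n (ratvar, B)" and t: "t \<in> tree_vertices n" and j: "j < n"
    and F: "keys F \<subseteq> carrier_vec n" and g: "g \<in> carrier_vec m"
    and X: "quantum_cluster_variable \<A> t j = Z_subst B0 D v (Y_hat \<A> t0) F * M0 g"
  shows "cluster_variable B t0 t j = lin (vmon m ratvar \<circ> (\<lambda>c. B *\<^sub>v c)) (specialize_q1 F) * vmon m ratvar g"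
proof -
  obtain \<Lambda> where T: "quantum_torus m v (form_value \<Lambda>) M0" using seed_torus[OF t0] by metis
  let ?G = "torus_graph m v M0 (1 :: ratfun) (vmon m ratvar)"
  have G: "antihom_graph ?G" by (rule antihom_graph_specialize[OF T])
  interpret antihom_graph ?G by (rule G)
  have unit: "M0 (0\<^sub>v m) = 1" using quantum_torusD(1)[OF T] by (simp add: twisted_frame_def)
  have ev: "ext v 1" by (intro ext_graph torus_graph_q unit) simp
  have basis: "ext (M0 c) (vmon m ratvar c)" if "c \<in> carrier_vec m" for c
    using that by (intro ext_graph torus_graph_basis)
  have mn: "n \<le> m" by (rule algebraD(1))
  define x where "x s = fst (pattern B t0 s)" for s
  have E: "E s = snd (pattern B t0 s)" if "s \<in> tree_vertices n" for s
    using t0 that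
  proof (rule tree_connected)
    have "pattern B t0 t0 = (ratvar, B)"
      unfolding pattern_def using t0 by (intro pattern_initial[OF seed]) (auto simp: tree_vertices_def)
    then show "E t0 = snd (pattern B t0 t0)" using algebraD(3) by simp
    fix k s s' assume e: "tree_edge n k s s'" and "E s = snd (pattern B t0 s)"
    then show "E s' = snd (pattern B t0 s')"
      using algebraD(5)[OF e] pattern_edge[OF seed t0 e] by (simp add: quantum_mutation_def)
  qed
  have pos: "positive_seed d m n (pattern B t0 s)" if "s \<in> tree_vertices n" for s
    unfolding pattern_def using t0 that
    by (intro positive_seed_fold[OF seed]) (auto simp: tree_vertices_def)
  have x0: "x s i \<noteq> 0" if "s \<in> tree_vertices n" for s i
    using pos[OF that] pos_nonzero unfolding positive_seed_def x_def by blast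
  have "ext (frame \<A> t c) (vmon m (x t) c)" if "c \<in> carrier_vec m" for c
  proof (rule pattern_ext[OF G ev _ _ _ t0 t that])
    show "\<exists>L. twisted_frame m v L (frame \<A> s) \<and> twisted_frame m 1 (\<lambda>c d. L d c) (vmon m (x s))"
      if "s \<in> tree_vertices n" for s
      using seed_torus[OF that] quantum_torusD(1) twisted_frame_vmon[of m "x s"] x0[OF that] by metis
    show "ext (M0 (unit_vec m i)) (vmon m (x t0) (unit_vec m i))" if "i < m" for i
    proof -
      have "x t0 = ratvar"
        unfolding x_def pattern_def using t0 by (subst pattern_initial[OF seed]) (auto simp: tree_vertices_def)
      then show ?thesis using basis by simp
    qed
    fix k s s' assume e: "tree_edge n k s s'"
    have s: "s \<in> tree_vertices n" and k: "k < n" using e by (auto simp: tree_edge_def tree_vertices_def)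
    have dim: "dim_row (E s) = m" using algebraD(4)[OF s] by (auto simp: quantum_seed_def)
    have "pattern B t0 s' = seed_mutation k (x s, E s)"
      unfolding pattern_edge[OF seed t0 e] x_def E[OF s] by simp
    then have x': "x s' = (x s)(k := inverse (x s k) *
        (exchange_monomial 1 (x s) (E s) k + exchange_monomial (-1) (x s) (E s) k))"
      unfolding x_def by (simp add: fst_seed_mutation)
    have mon: "vmon m (x s) (- unit_vec m k + vec m (\<lambda>i. pos_part (e * E s $$ (i, k)))) =
        inverse (x s k) * exchange_monomial e (x s) (E s) k" for e
      unfolding exchange_monomial_vmon dim using k mn x0[OF s] by (simp add: vmon_add vmon_uminus)
    \<comment> \<open>On Laurent monomials of commutative clusters the classical exchange relation
      has exactly the form of a quantum mutation.\<close>
    have "quantum_mutation m k (vmon m (x s)) (E s) (vmon m (x s')) (E s')"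
      using algebraD(5)[OF e] mon[of 1] mon[of "-1"] k mn
      unfolding quantum_mutation_def x' by (simp add: distrib_left)
    with algebraD(5)[OF e] show "quantum_mutation m k (frame \<A> s) (E s) (frame \<A> s') (E s') \<and>
        quantum_mutation m k (vmon m (x s)) (E s) (vmon m (x s')) (E s')" ..
  qed
  from this[of "unit_vec m j"] have 1: "ext (quantum_cluster_variable \<A> t j) (cluster_variable B t0 t j)"
    using j mn unfolding quantum_cluster_variable_frame[OF t] cluster_variable_pattern[OF seed t0 t] x_def by simp
  have Q: "ext (q_combination v (\<lambda>c. M0 (B *\<^sub>v c)) F) (q_combination 1 (\<lambda>c. vmon m ratvar (B *\<^sub>v c)) F)"
    using F by (intro ext_q_combination[OF G ev] basis mult_B_carrier) auto
  have "ext (q_combination v (\<lambda>c. M0 (B *\<^sub>v c)) F * M0 g)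
      (vmon m ratvar g * q_combination 1 (\<lambda>c. vmon m ratvar (B *\<^sub>v c)) F)"
    by (intro ext_mult Q basis g)
  from ext_unique[OF 1 this[folded Z_subst_combination[OF F], folded X]] show ?thesis
    by (simp add: q_combination_1 o_def mult.commute)
qed

end

theorem proposition6p4:
  fixes \<A>p :: "'f::division_ring quantum_cluster_data"
    and B0 D \<Lambda> :: "int mat" and n j :: nat and t0 t :: "nat list"
    and F :: q_laurent
  assumes "B0 \<in> carrier_mat n n"
    and "D \<in> carrier_mat n n" and "diagonal_mat D" and "\<forall>i<n. D $$ (i, i) > 0"
    and "skew_symmetric (D * B0)"
    and "\<Lambda> \<in> carrier_mat n n" and "skew_symmetric \<Lambda>"
    and "t0 \<in> tree_vertices n" and "t \<in> tree_vertices n" and "j < n"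
    and "principal_quantum_cluster_algebra B0 D \<Lambda> t0 \<A>p"
    and "left_quantum_F_polynomial \<A>p B0 D t0 t j F"
  shows
    "(\<forall>P. (P \<in> Z_polynomials n \<and>
           quantum_cluster_variable \<A>p t j =
             frame \<A>p t0 (g_vector B0 t0 t j @\<^sub>v 0\<^sub>v n) *
             Z_subst B0 D (qhalf \<A>p) (Y_hat \<A>p t0) P)
         \<longleftrightarrow> P = bar F)
     \<and> (\<forall>m (B :: int mat) lam2 :: int.
          n \<le> m \<and> B \<in> carrier_mat m n \<and> principal_part n B = B0 \<longrightarrow>
          \<comment> \<open>\<open>lam2\<close> is twice the exponent \<open>\<lambda>\<close>, which depends on \<open>B\<close> but not on the algebra\<close>
          (\<forall>\<A> :: 'g::division_ring quantum_cluster_data. quantum_cluster_algebra B D t0 \<A> \<longrightarrow>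
             quantum_cluster_variable \<A> t j =
               qhalf \<A> powi lam2 * Z_subst B0 D (qhalf \<A>) (Y_hat \<A> t0) F *
               frame \<A> t0 (extended_g_vector B t0 t j)) \<longrightarrow>
          (\<forall>\<A> :: 'g quantum_cluster_data. quantum_cluster_algebra B D t0 \<A> \<longrightarrow>
             quantum_cluster_variable \<A> t j =
               qhalf \<A> powi (- lam2) * frame \<A> t0 (extended_g_vector B t0 t j) *
               Z_subst B0 D (qhalf \<A>) (Y_hat \<A> t0) (bar F)))
     \<and> specialize_q1 (bar F) = F_polynomial B0 t0 t j"
proof -
  have B0: "B0 \<in> carrier_mat n n" and D: "D \<in> carrier_mat n n" "diagonal_mat D" "\<forall>i<n. D $$ (i, i) > 0"
    and S: "skew_symmetric (D * B0)" and t0: "t0 \<in> tree_vertices n" and t: "t \<in> tree_vertices n" and j: "j < n"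
    using assms by blast+
  define d where "d = (\<lambda>i. D $$ (i, i))"
  have skew: "skew_symmetrizer d n B0"
    unfolding skew_symmetrizer_def
  proof (intro conjI allI impI)
    fix i k assume ik: "i < n" "k < n"
    have "(D * B0) $$ (i, k) = - (D * B0) $$ (k, i)"
      using skew_symmetric_index[of "D * B0" n k i] S D(1) B0 ik by simp
    then show "d i * B0 $$ (i, k) = - (d k * B0 $$ (k, i))"
      unfolding d_def using diagonal_mult_index[OF D(1,2) B0] ik by simp
  qed (use D(3) in \<open>simp add: d_def\<close>)
  interpret vertex: cluster_vertex B0 d n t0 t j
    by unfold_locales (fact B0 skew t0 t j)+
  have n: "dim_col B0 = n" using B0 by simp
  let ?Bp = "principal_extension B0"
  let ?g = "g_vector B0 t0 t j @\<^sub>v 0\<^sub>v n"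
  have Bp: "?Bp \<in> carrier_mat (2 * n) n" using B0 by simp
  have part: "principal_part n ?Bp = B0"
    using B0 by (intro eq_matI) (auto simp: principal_part_def principal_extension_index[OF B0])
  interpret principal: quantum_pattern \<A>p ?Bp B0 D "2 * n" n t0
  proof
    show "quantum_cluster_algebra ?Bp D t0 \<A>p"
      using assms(11) by (simp add: principal_quantum_cluster_algebra_def)
  qed (fact Bp part D S t0)+
  have g: "?g \<in> carrier_vec (2 * n)"
    using vertex.principal_expansion_homogeneous(1) by (simp add: mult_2)
  have F: "F \<in> Z_polynomials n" and X: "quantum_cluster_variable \<A>p t j =
      Z_subst B0 D (qhalf \<A>p) (Y_hat \<A>p t0) F * frame \<A>p t0 ?g"
    using assms(12) unfolding left_quantum_F_polynomial_def Let_def n by blast+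
  have keys: "keys P \<subseteq> carrier_vec n" if "P \<in> Z_polynomials n" for P
    using that by (auto simp: Z_polynomials_def)
  have barF: "bar F \<in> Z_polynomials n" using F by (simp add: Z_polynomials_def)
  \<comment> \<open>With principal coefficients the left formula carries no power of q, hence
    \<open>l = 0\<close>.\<close>
  have right: "quantum_cluster_variable \<A>p t j =
      frame \<A>p t0 ?g * Z_subst B0 D (qhalf \<A>p) (Y_hat \<A>p t0) (bar F)"
    using principal.bar_formula[OF t j keys[OF F] g, of 0] X by simp
  obtain \<Lambda>0 where T: "quantum_torus (2 * n) (qhalf \<A>p) (form_value \<Lambda>0) (frame \<A>p t0)"
    using principal.seed_torus[OF t0] by metis
  have unique: "P = bar F"
    if P: "P \<in> Z_polynomials n" and eq: "quantum_cluster_variable \<A>p t j =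
      frame \<A>p t0 ?g * Z_subst B0 D (qhalf \<A>p) (Y_hat \<A>p t0) P" for P
  proof -
    let ?f = "\<lambda>c. ?Bp *\<^sub>v c" and ?q = "q_combination (qhalf \<A>p) (frame \<A>p t0)"
    \<comment> \<open>An invertible frame element can be cancelled from both right formulas;
      injectivity on exponents and independence of the frame then identify the coefficients.\<close>
    have "frame \<A>p t0 ?g \<noteq> 0"
    proof
      assume "frame \<A>p t0 ?g = 0"
      then have "?q (single ?g 1) = 0" by simp
      then have "single ?g 1 = (0 :: q_laurent)"
        using g by (intro quantum_torusD(5)[OF T]) auto
      then show False by (metis lookup_single_eq lookup_zero zero_neq_one)
    qed
    then have "Z_subst B0 D (qhalf \<A>p) (Y_hat \<A>p t0) P = Z_subst B0 D (qhalf \<A>p) (Y_hat \<A>p t0) (bar F)"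
      using eq right by simp
    then have "?q (push ?f (P - bar F)) = 0"
      unfolding principal.Z_subst_combination[OF keys[OF P]] principal.Z_subst_combination[OF keys[OF barF]]
        q_combination_push q_combination_diff by (simp add: o_def)
    moreover have K: "keys (P - bar F) \<subseteq> carrier_vec n"
    proof
      fix e assume "e \<in> keys (P - bar F)"
      then have "e \<in> keys P \<or> e \<in> keys (bar F)"
        by (metis diff_self in_keys_iff lookup_minus)
      then show "e \<in> carrier_vec n" using keys[OF P] keys[OF barF] by blast
    qed
    then have "keys (push ?f (P - bar F)) \<subseteq> carrier_vec (2 * n)"
      using keys_push[of ?f "P - bar F"] principal.mult_B_carrier by blast
    ultimately have "push ?f (P - bar F) = 0" by (intro quantum_torusD(5)[OF T])
    then show ?thesis using push_eq_0_iff[OF principal_mult_inj[OF B0] K] by simp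
  qed
  have general: "quantum_cluster_variable \<A> t j =
      qhalf \<A> powi (- lam2) * frame \<A> t0 (extended_g_vector B t0 t j) *
      Z_subst B0 D (qhalf \<A>) (Y_hat \<A> t0) (bar F)"
    if B: "n \<le> m" "B \<in> carrier_mat m n" "principal_part n B = B0"
      and A: "quantum_cluster_algebra B D t0 \<A>"
      and left: "quantum_cluster_variable \<A> t j =
        qhalf \<A> powi lam2 * Z_subst B0 D (qhalf \<A>) (Y_hat \<A> t0) F * frame \<A> t0 (extended_g_vector B t0 t j)"
    for m B lam2 and \<A> :: "'g quantum_cluster_data"
  proof -
    interpret alg: quantum_pattern \<A> B B0 D m n t0
      by unfold_locales (fact A B(2,3) D(1,2) S t0)+
    have "skew_symmetrizer d n B"
      using skew unfolding B(3)[symmetric]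
      by (rule skew_symmetrizer_cong) (simp add: principal_part_def)
    then have "extended_g_vector B t0 t j \<in> carrier_vec m"
      by (intro vertex.extended_g_vector_carrier positive_seed_initial B)
    from alg.bar_formula[OF t j keys[OF F] this left] show ?thesis .
  qed
  \<comment> \<open>Specialized and classical expansions are polynomials in the y-hats times the
    same monomial, so uniqueness for principal coefficients applies. Summing coefficients over
    powers of q is blind to the bar involution.\<close>
  have "specialize_q1 F = F_polynomial B0 t0 t j"
  proof (rule vertex.laurent_eval_y_hat_unique)
    show K: "keys (specialize_q1 F) \<subseteq> carrier_vec n"
      using keys_specialize_q1[of F] keys[OF F] by blast
    have "laurent_eval n (y_hat ?Bp) (specialize_q1 F) * vmon (2 * n) ratvar ?g =
        laurent_eval n (y_hat ?Bp) (F_polynomial B0 t0 t j) * vmon (2 * n) ratvar ?g"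
      using principal.specialization[OF positive_seed_principal[OF B0 skew] t j keys[OF F] g X]
      unfolding vertex.principal_formula vertex.laurent_eval_y_hat[OF K] by (rule sym)
    moreover have "vmon (2 * n) ratvar ?g \<noteq> 0" by (intro vmon_nonzero) simp
    ultimately show "laurent_eval n (y_hat ?Bp) (specialize_q1 F) =
        laurent_eval n (y_hat ?Bp) (F_polynomial B0 t0 t j)" by simp
  qed
  then show ?thesis
    unfolding specialize_q1_bar
    using right unique barF general by blast
qed

end
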